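(* Let $\mathbb{F}_{4,3}$ be the $4$-graph on $\{1,\dots,7\}$ with edges $\{1234,1235,1236,1237,4567\}$. There exist constants $N_0$ and $c>0$ such that for all integers $n\ge N_0$ and all integers $t\in[0,cn]$ we have \[ \mathrm{EX}\left(n,(t+1)\mathbb{F}_{4,3}\right)\subseteq K_t^4\bowtie\left\{B^{\mathrm{odd}}_4(n-t,m): m\in\left[0,\sqrt{4(n-t)}\right]\right\}. \]
   Context: For integers $n$ and $m\ge 0$, $B^{\mathrm{odd}}_4(n,m)$ is the $4$-graph on $[n]=V_1\cup V_2$ with $|V_1|=\lfloor n/2\rfloor+m$ whose edges are all $4$-sets meeting $V_1$ in exactly one or exactly three vertices; $m$ ranges over integers. $K_t^4$ is the complete $4$-graph on $t$ vertices; for $4$-graphs on disjoint vertex sets, $\mathcal{G}\bowtie\mathcal{H}$ consists of the edges of both plus all $4$-subsets meeting both vertex sets, and $\mathcal{G}\bowtie\mathcal{F}=\{\mathcal{G}\bowtie\mathcal{H}:\mathcal{H}\in\mathcal{F}\}$. $\mathrm{EX}(n,(t+1)F)$ is the set (up to isomorphism) of $n$-vertex $4$-graphs not containing $t+1$ pairwise vertex-disjoint copies of $F$ with the maximum number of edges among such. *)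

theory Defs
  imports Complex_Main
begin

datatype 'a hypergraph = Hypergraph (verts: "'a set") (edges: "'a set set")

definition four_graph :: "'a hypergraph \<Rightarrow> bool" where
  "four_graph G \<longleftrightarrow> finite (verts G) \<and> (\<forall>e\<in>edges G. e \<subseteq> verts G \<and> card e = 4)"

definition isomorphic :: "'a hypergraph \<Rightarrow> 'b hypergraph \<Rightarrow> bool" where
  "isomorphic G H \<longleftrightarrow>
     (\<exists>f. bij_betw f (verts G) (verts H) \<and> edges H = (\<lambda>e. f ` e) ` edges G)"

text \<open>Containment as a not necessarily induced subgraph.\<close>

definition contains_copy :: "'a hypergraph \<Rightarrow> 'b hypergraph \<Rightarrow> bool" where
  "contains_copy G F \<longleftrightarrow>
     (\<exists>f. inj_on f (verts F) \<and> f ` verts F \<subseteq> verts G \<and> (\<forall>e\<in>edges F. f ` e \<in> edges G))"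

text \<open>The hypergraph \<open>sF\<close>, the union of \<open>s\<close> pairwise vertex-disjoint copies of \<open>F\<close>,
  the \<open>i\<close>-th copy having vertex set \<open>{i} \<times> verts F\<close>.\<close>

definition disjoint_copies :: "nat \<Rightarrow> 'a hypergraph \<Rightarrow> (nat \<times> 'a) hypergraph" where
  "disjoint_copies s F =
     Hypergraph ({..<s} \<times> verts F) {{i} \<times> e | i e. i < s \<and> e \<in> edges F}"

definition free_four_graphs :: "nat \<Rightarrow> 'a hypergraph \<Rightarrow> nat hypergraph set" where
  "free_four_graphs n F = {G. four_graph G \<and> verts G = {1..n} \<and> \<not> contains_copy G F}"

text \<open>\<open>EX(n, F)\<close>, which is taken up to isomorphism, is represented by its members on the vertex
  set \<open>{1..n}\<close>; inclusion up to isomorphism is \<open>iso_subset\<close>.\<close>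

definition extremal :: "nat \<Rightarrow> 'a hypergraph \<Rightarrow> nat hypergraph set" where
  "extremal n F = {G \<in> free_four_graphs n F. \<forall>G'\<in>free_four_graphs n F. card (edges G') \<le> card (edges G)}"

definition iso_subset :: "'a hypergraph set \<Rightarrow> 'b hypergraph set \<Rightarrow> bool" where
  "iso_subset \<A> \<B> \<longleftrightarrow> (\<forall>G\<in>\<A>. \<exists>H\<in>\<B>. isomorphic G H)"

definition K4 :: "nat \<Rightarrow> nat hypergraph" where
  "K4 t = Hypergraph {1..t} {e. e \<subseteq> {1..t} \<and> card e = 4}"

text \<open>The sum type makes the two vertex sets disjoint.\<close>

definition join :: "'a hypergraph \<Rightarrow> 'b hypergraph \<Rightarrow> ('a + 'b) hypergraph" where
  "join G H = Hypergraph (verts G <+> verts H)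
     ((\<lambda>e. Inl ` e) ` edges G \<union> (\<lambda>e. Inr ` e) ` edges H \<union>
      {e. e \<subseteq> verts G <+> verts H \<and> card e = 4 \<and>
          e \<inter> Inl ` verts G \<noteq> {} \<and> e \<inter> Inr ` verts H \<noteq> {}})"

text \<open>With \<open>V1\<close> an initial segment of \<open>[n]\<close>. This makes sense only if \<open>n div 2 + m \<le> n\<close>;
  otherwise \<open>V1\<close> is not contained in \<open>[n]\<close> and \<open>B_odd n m\<close> is not an \<open>n\<close>-vertex hypergraph.\<close>

definition B_odd :: "nat \<Rightarrow> nat \<Rightarrow> nat hypergraph" where
  "B_odd n m =
     (let V1 = {1..n div 2 + m}; V2 = {n div 2 + m + 1..n}
      in Hypergraph (V1 \<union> V2)
           {e. e \<subseteq> V1 \<union> V2 \<and> card e = 4 \<and> (card (e \<inter> V1) = 1 \<or> card (e \<inter> V1) = 3)})"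

definition F43 :: "nat hypergraph" where
  "F43 = Hypergraph {1..7} {{1,2,3,4}, {1,2,3,5}, {1,2,3,6}, {1,2,3,7}, {4,5,6,7}}"

end

theory Submission
  imports Defs "HOL-Library.Ramsey"
begin

text \<open>
  A copy of \<open>F\<close> is a triple together with an edge inside its neighbourhood, so \<open>F\<close>-freeness says
  that the neighbourhood of every triple is independent. Let \<open>A\<close> be a largest such neighbourhood, of size
  \<open>n/2 + x\<close>. Summing neighbourhood sizes over the triples meeting \<open>A\<close> in \<open>0\<close> or \<open>2\<close> vertices bounds the
  degree sum of \<open>A\<close>, and gives \<open>n\<^sup>3/12 - 2x\<^sup>3/3\<close> as an upper bound for the minimum degree. As any
  two vertices of \<open>F\<close> lie in a common edge, cloning a vertex preserves \<open>F\<close>-freeness; hence extremal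
  hypergraphs are almost regular, have density \<open>1/2\<close>, and are close to the odd quadruples of \<open>A\<close>.
  For a partition with the most odd edges, every even edge turns out to be of type \<open>(2,2)\<close>, and almost
  all odd quadruples sharing a triple with it are missing. Double counting pairs of an even edge and a
  missing quadruple sharing a triple shows that there are more missing quadruples than even edges.
  For \<open>t > 0\<close>, one finds a vertex whose deletion leaves no \<open>t\<close> disjoint copies and inducts.
\<close>

text \<open>With parts of sizes n/2 + x and n/2 - x there are about n^4/48 - x^4/3 odd quadruples.
  This is so flat at x = 0 that lower order terms decide the best x, which is of order sqrt n. Hence
  the sizes are never prescribed: E is compared with the odd quadruples of whatever near-balanced
  partition arises, and the bound on m comes last, from optimality against moving one vertex. The
  neighbourhood A is right only on average, while excluding even edges needs control at every
  vertex. A partition with the most odd edges supplies it, since no vertex can gain by changing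
  sides. The final count wins by a constant factor. Each of the four triples of an even edge lies in
  about n/2 missing quadruples, 2n in total. Of the four triples of a missing quadruple, the one
  inside a part lies in no even edge and the others in at most about n/2 each, 3n/2 in total. This
  gap absorbs all approximations. Deleting a vertex lowers both n and t by one, so a hypothesis like
  10^6 t <= n survives the induction; this is why t may grow linearly.\<close>

lemma nsetsI: "S \<subseteq> V \<Longrightarrow> finite S \<Longrightarrow> card S = k \<Longrightarrow> S \<in> nsets V k"
  by (simp add: nsets_def)

lemma nsetsD:
  assumes "S \<in> nsets V k"
  shows "S \<subseteq> V" "finite S" "card S = k"
  using assms by (auto simp: nsets_def)

lemma edgeD:
  assumes "E \<subseteq> nsets V k" "e \<in> E"
  shows "e \<subseteq> V" "finite e" "card e = k"
  using assms by (auto simp: nsets_def)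

lemma card_nsets_split:
  assumes fin: "finite V" and A: "A \<subseteq> V" and j: "j \<le> k"
  shows "card {S \<in> nsets V k. card (S \<inter> A) = j} = (card A choose j) * (card (V - A) choose (k - j))"
proof -
  have "bij_betw (\<lambda>(P, Q). P \<union> Q) (nsets A j \<times> nsets (V - A) (k - j)) {S \<in> nsets V k. card (S \<inter> A) = j}"
  proof (rule bij_betwI[where g = "\<lambda>S. (S \<inter> A, S - A)"])
    show "(\<lambda>(P, Q). P \<union> Q) \<in> nsets A j \<times> nsets (V - A) (k - j) \<rightarrow> {S \<in> nsets V k. card (S \<inter> A) = j}"
    proof (clarsimp, intro conjI)
      fix P Q assume P: "P \<in> nsets A j" and Q: "Q \<in> nsets (V - A) (k - j)"
      have "card (P \<union> Q) = j + (k - j)"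
        using nsetsD[OF P] nsetsD[OF Q] by (subst card_Un_disjoint) auto
      then show "P \<union> Q \<in> nsets V k"
        using nsetsD[OF P] nsetsD[OF Q] A j by (auto intro!: nsetsI)
      have "(P \<union> Q) \<inter> A = P" using nsetsD[OF P] nsetsD[OF Q] by auto
      then show "card ((P \<union> Q) \<inter> A) = j" using nsetsD[OF P] by simp
    qed
    show "(\<lambda>S. (S \<inter> A, S - A)) \<in> {S \<in> nsets V k. card (S \<inter> A) = j} \<rightarrow> nsets A j \<times> nsets (V - A) (k - j)"
    proof (clarsimp, intro conjI)
      fix S assume S: "S \<in> nsets V k" and j: "j = card (S \<inter> A)"
      have "card (S - A) = card S - card (S \<inter> A)"
        using nsetsD[OF S] by (metis card_Diff_subset_Int finite_Int)
      then show "S \<inter> A \<in> nsets A (card (S \<inter> A))" "S - A \<in> nsets (V - A) (k - card (S \<inter> A))"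
        using nsetsD[OF S] by (auto intro!: nsetsI)
    qed
    show "(\<lambda>S. (S \<inter> A, S - A)) (case p of (P, Q) \<Rightarrow> P \<union> Q) = p"
      if "p \<in> nsets A j \<times> nsets (V - A) (k - j)" for p
      using that nsetsD(1) by fastforce
    show "(case (S \<inter> A, S - A) of (P, Q) \<Rightarrow> P \<union> Q) = S" for S
      by blast
  qed
  from bij_betw_same_card[OF this] show ?thesis
    by (simp add: card_cartesian_product)
qed

section \<open>Polynomial bounds for small binomial coefficients\<close>

lemma choose_2_eq: "real (n choose 2) = real n * (real n - 1) / 2"
proof (induction n)
  case (Suc n)
  have "Suc n choose 2 = n + (n choose 2)" by (simp add: numeral_2_eq_2)
  then show ?case using Suc by (simp add: field_simps)
qed simp

lemma choose_3_eq: "real (n choose 3) = real n * (real n - 1) * (real n - 2) / 6"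
proof (induction n)
  case (Suc n)
  have "Suc n choose 3 = (n choose 2) + (n choose 3)" by (simp add: numeral_3_eq_3 numeral_2_eq_2)
  then show ?case using Suc by (simp add: choose_2_eq field_simps)
qed simp

lemma choose_2_le: "real (n choose 2) \<le> real n ^ 2 / 2"
  unfolding choose_2_eq by (simp add: power2_eq_square field_simps)

lemma choose_3_le: "real (n choose 3) \<le> real n ^ 3 / 6"
proof -
  have "n = 0 \<or> n = 1 \<or> n \<ge> 2" by linarith
  moreover have "real n * (real n - 1) * (real n - 2) \<le> real n * real n * real n" if "n \<ge> 2"
    using that by (intro mult_mono) auto
  ultimately show ?thesis unfolding choose_3_eq by (auto simp: power3_eq_cube)
qed

lemma choose_3_ge: "real (n choose 3) \<ge> real n ^ 3 / 6 - real n ^ 2 / 2"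
  unfolding choose_3_eq by (simp add: power2_eq_square power3_eq_cube field_simps)

section \<open>Copies, packings and neighbourhoods of triples\<close>

text \<open>\<open>T\<close> and \<open>Q\<close> play the roles of \<open>{1,2,3}\<close> and \<open>{4,5,6,7}\<close> in \<^const>\<open>F43\<close>.\<close>

definition is_copy :: "'a set set \<Rightarrow> 'a set \<Rightarrow> bool" where
  "is_copy E S \<longleftrightarrow> (\<exists>T Q. card T = 3 \<and> Q \<in> E \<and> (\<forall>w\<in>Q. insert w T \<in> E) \<and> S = T \<union> Q)"

text \<open>Copies are recorded by their vertex sets alone. Nothing is lost: a copy of 4-edges has
  seven vertices, so disjoint copies have distinct vertex sets, and a set \<open>C\<close> can
  replace an indexed family.\<close>

definition packs :: "'a set set \<Rightarrow> nat \<Rightarrow> bool" where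
  "packs E s \<longleftrightarrow> (\<exists>C. finite C \<and> card C = s \<and> pairwise disjnt C \<and> (\<forall>S\<in>C. is_copy E S))"

definition F_free :: "'a set set \<Rightarrow> bool" where
  "F_free E \<longleftrightarrow> (\<nexists>S. is_copy E S)"

definition deg :: "'a set set \<Rightarrow> 'a \<Rightarrow> nat" where
  "deg E v = card {e \<in> E. v \<in> e}"

text \<open>No condition \<open>w \<notin> T\<close> is imposed: for a triple \<open>T\<close> and
  4-element edges, \<open>insert w T = T\<close> would be too small to be an edge.\<close>

definition nb :: "'a set set \<Rightarrow> 'a set \<Rightarrow> 'a set" where
  "nb E T = {w. insert w T \<in> E}"

lemma F_freeD:
  assumes "F_free E" "card T = 3" "Q \<in> E" "Q \<subseteq> nb E T"
  shows False
  using assms unfolding F_free_def is_copy_def nb_def by blast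

lemma is_copy_mono: "is_copy E S \<Longrightarrow> E \<subseteq> E' \<Longrightarrow> is_copy E' S"
  unfolding is_copy_def by blast

lemma F_free_mono: "F_free E' \<Longrightarrow> E \<subseteq> E' \<Longrightarrow> F_free E"
  using is_copy_mono unfolding F_free_def by blast

lemma packs_1_iff: "packs E 1 \<longleftrightarrow> \<not> F_free E"
proof
  assume "packs E 1"
  then obtain C where "card C = 1" "\<forall>S\<in>C. is_copy E S" unfolding packs_def by blast
  then show "\<not> F_free E" unfolding F_free_def by (metis card_1_singletonE insertI1)
next
  assume "\<not> F_free E"
  then obtain S where "is_copy E S" unfolding F_free_def by blast
  then show "packs E 1" unfolding packs_def by (intro exI[of _ "{S}"]) auto
qed

text \<open>\<open>is_copy\<close> does not ask for \<open>T\<close> and \<open>Q\<close> to be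
  disjoint. The edge size forces it: a common vertex \<open>w\<close> would make
  \<open>insert w T\<close> an edge with three vertices.\<close>

lemma is_copy_props:
  assumes "is_copy E S" "E \<subseteq> nsets V 4"
  shows "S \<subseteq> V" "finite S" "card S = 7"
proof -
  obtain T Q where TQ: "card T = 3" "Q \<in> E" "\<And>w. w \<in> Q \<Longrightarrow> insert w T \<in> E" "S = T \<union> Q"
    using assms(1) unfolding is_copy_def by blast
  have Q: "Q \<subseteq> V" "finite Q" "card Q = 4" using edgeD[OF assms(2) TQ(2)] by auto
  then obtain q where "q \<in> Q" by fastforce
  then have T: "T \<subseteq> V" "finite T" using edgeD[OF assms(2) TQ(3)] by auto
  have "w \<notin> T" if "w \<in> Q" for w
  proof
    assume "w \<in> T"
    then have "insert w T = T" by blast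
    then show False using TQ(1) edgeD(3)[OF assms(2) TQ(3)[OF that]] by simp
  qed
  then have "card (T \<union> Q) = 3 + 4"
    using T Q TQ(1) by (subst card_Un_disjoint) auto
  then show "S \<subseteq> V" "finite S" "card S = 7" using T Q TQ by auto
qed

lemma finite_edges: "finite V \<Longrightarrow> E \<subseteq> nsets V k \<Longrightarrow> finite E"
  by (meson finite_imp_finite_nsets finite_subset)

lemma notin_nb: "E \<subseteq> nsets V 4 \<Longrightarrow> card T = 3 \<Longrightarrow> w \<in> nb E T \<Longrightarrow> w \<notin> T"
  unfolding nb_def using edgeD(3)[of E V 4 "insert w T"] by (auto simp: insert_absorb)

lemma nb_subset: "E \<subseteq> nsets V 4 \<Longrightarrow> nb E T \<subseteq> V"
  unfolding nb_def using edgeD(1) by fast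

section \<open>Double counting of degrees and of neighbourhoods of triples\<close>

lemma sum_deg:
  assumes "finite V" "E \<subseteq> nsets V 4" "S \<subseteq> V"
  shows "(\<Sum>v\<in>S. deg E v) = (\<Sum>e\<in>E. card (e \<inter> S))"
proof -
  have fin: "finite S" "finite E" using assms finite_edges finite_subset by blast+
  have *: "e \<inter> S = {v \<in> S. v \<in> e}" for e by blast
  show ?thesis unfolding deg_def *
    by (rule sum_multicount_gen[OF fin]) simp
qed

lemma handshake:
  assumes "finite V" "E \<subseteq> nsets V 4"
  shows "(\<Sum>v\<in>V. deg E v) = 4 * card E"
proof -
  have "(\<Sum>e\<in>E. card (e \<inter> V)) = (\<Sum>e\<in>E. 4)"
    using edgeD[OF assms(2)] by (intro sum.cong) (auto simp: Int_absorb2)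
  then show ?thesis using sum_deg[OF assms subset_refl] by simp
qed

lemma card_superedges:
  assumes "finite V" "E \<subseteq> nsets V 4" "card T = 3"
  shows "card {e \<in> E. T \<subseteq> e} = card (nb E T)"
proof -
  have finT: "finite T" using assms(3) card.infinite by fastforce
  have "bij_betw (\<lambda>w. insert w T) (nb E T) {e \<in> E. T \<subseteq> e}"
    unfolding bij_betw_def
  proof
    show "inj_on (\<lambda>w. insert w T) (nb E T)"
      using notin_nb[OF assms(2,3)] by (auto simp: inj_on_def)
    show "(\<lambda>w. insert w T) ` nb E T = {e \<in> E. T \<subseteq> e}"
    proof (intro equalityI subsetI)
      fix e assume "e \<in> {e \<in> E. T \<subseteq> e}"
      then have e: "e \<in> E" "T \<subseteq> e" by auto
      then have "finite e" "card e = 4" using edgeD[OF assms(2)] by auto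
      then have "card (e - T) = 1" using e(2) assms(3) finT by (simp add: card_Diff_subset)
      then obtain w where "e - T = {w}" using card_1_singletonE by blast
      then have "e = insert w T" using e(2) by blast
      then show "e \<in> (\<lambda>w. insert w T) ` nb E T" using e(1) unfolding nb_def by blast
    qed (auto simp: nb_def)
  qed
  from bij_betw_same_card[OF this] show ?thesis by simp
qed

lemma card_triples_in_quad:
  assumes "finite e" "card e = 4"
  shows "card {T \<in> nsets e 3. R T} = card {x \<in> e. R (e - {x})}"
proof -
  have "bij_betw (\<lambda>x. e - {x}) {x \<in> e. R (e - {x})} {T \<in> nsets e 3. R T}"
    unfolding bij_betw_def
  proof
    show "inj_on (\<lambda>x. e - {x}) {x \<in> e. R (e - {x})}" by (auto simp: inj_on_def)
    show "(\<lambda>x. e - {x}) ` {x \<in> e. R (e - {x})} = {T \<in> nsets e 3. R T}"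
    proof (intro equalityI subsetI)
      fix T assume "T \<in> {T \<in> nsets e 3. R T}"
      then have T: "T \<subseteq> e" "finite T" "card T = 3" "R T" by (auto simp: nsets_def)
      then have "card (e - T) = 1" using assms by (simp add: card_Diff_subset)
      then obtain w where w: "e - T = {w}" using card_1_singletonE by blast
      then have "T = e - {w}" "w \<in> e" using T(1) by blast+
      then show "T \<in> (\<lambda>x. e - {x}) ` {x \<in> e. R (e - {x})}" using T(4) by blast
    qed (use assms in \<open>auto intro!: nsetsI\<close>)
  qed
  from bij_betw_same_card[OF this] show ?thesis by simp
qed

lemma sum_nb:
  assumes "finite V" "E \<subseteq> nsets V 4"
  shows "(\<Sum>T\<in>{T \<in> nsets V 3. R T}. card (nb E T)) = (\<Sum>e\<in>E. card {x \<in> e. R (e - {x})})"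
proof -
  have fin: "finite {T \<in> nsets V 3. R T}" "finite E"
    using assms finite_edges by (auto simp: finite_imp_finite_nsets)
  have "(\<Sum>T\<in>{T \<in> nsets V 3. R T}. card (nb E T)) = (\<Sum>T\<in>{T \<in> nsets V 3. R T}. card {e \<in> E. T \<subseteq> e})"
    by (rule sum.cong[OF refl]) (use card_superedges[OF assms] in \<open>auto simp: nsets_def\<close>)
  also have "\<dots> = (\<Sum>e\<in>E. card {T \<in> {T \<in> nsets V 3. R T}. T \<subseteq> e})"
    by (rule sum_multicount_gen[OF fin]) simp
  also have "\<dots> = (\<Sum>e\<in>E. card {x \<in> e. R (e - {x})})"
  proof (rule sum.cong[OF refl])
    fix e assume "e \<in> E"
    note e = edgeD[OF assms(2) this]
    have "{T \<in> {T \<in> nsets V 3. R T}. T \<subseteq> e} = {T \<in> nsets e 3. R T}"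
      using e(1) by (auto simp: nsets_def)
    then show "card {T \<in> {T \<in> nsets V 3. R T}. T \<subseteq> e} = card {x \<in> e. R (e - {x})}"
      using card_triples_in_quad[OF e(2,3)] by simp
  qed
  finally show ?thesis .
qed

definition type_count :: "'a set set \<Rightarrow> 'a set \<Rightarrow> nat \<Rightarrow> nat" where
  "type_count E A i = card {e \<in> E. card (e \<inter> A) = i}"

lemma type_count_eq_sum: "finite E \<Longrightarrow> type_count E A i = (\<Sum>e\<in>E. if card (e \<inter> A) = i then 1 else 0)"
  unfolding type_count_def by (simp add: sum.If_cases Int_def)

text \<open>A triple meeting \<open>A\<close> in \<open>j\<close> vertices arises from an edge
  either by removing one of \<open>j + 1\<close> vertices in \<open>A\<close>, or by removing one of
  \<open>4 - j\<close> vertices outside \<open>A\<close> when the edge itself meets \<open>A\<close>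
  in \<open>j\<close>. These are the two coefficients.\<close>

lemma sum_nb_type:
  assumes "finite V" "E \<subseteq> nsets V 4" "j \<le> 3"
  shows "(\<Sum>T\<in>{T \<in> nsets V 3. card (T \<inter> A) = j}. card (nb E T))
       = (j + 1) * type_count E A (j + 1) + (4 - j) * type_count E A j"
proof -
  have fin: "finite E" using assms finite_edges by blast
  have "card {x \<in> e. card ((e - {x}) \<inter> A) = j}
      = (j + 1) * (if card (e \<inter> A) = j + 1 then 1 else 0) + (4 - j) * (if card (e \<inter> A) = j then 1 else 0)"
    if "e \<in> E" for e
  proof -
    have e: "finite e" "card e = 4" using edgeD[OF assms(2) that] by auto
    have 1: "card ((e - {x}) \<inter> A) = card (e \<inter> A) - 1" "card (e \<inter> A) > 0" if "x \<in> e \<inter> A" for x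
    proof -
      have "(e - {x}) \<inter> A = (e \<inter> A) - {x}" by blast
      then show "card ((e - {x}) \<inter> A) = card (e \<inter> A) - 1" using that e(1) by simp
      show "card (e \<inter> A) > 0" using that e(1) by (auto simp: card_gt_0_iff)
    qed
    have 2: "card ((e - {x}) \<inter> A) = card (e \<inter> A)" if "x \<notin> A" for x
    proof -
      have "(e - {x}) \<inter> A = e \<inter> A" using that by blast
      then show ?thesis by simp
    qed
    consider "card (e \<inter> A) = j + 1" | "card (e \<inter> A) = j" | "card (e \<inter> A) \<noteq> j + 1" "card (e \<inter> A) \<noteq> j" by blast
    then show ?thesis
    proof cases
      case 1
      then have "{x \<in> e. card ((e - {x}) \<inter> A) = j} = e \<inter> A" using \<open>\<And>x. x \<in> e \<inter> A \<Longrightarrow> card ((e - {x}) \<inter> A) = card (e \<inter> A) - 1\<close> 2 by force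
      then show ?thesis using 1 by simp
    next
      case 2
      then have "{x \<in> e. card ((e - {x}) \<inter> A) = j} = e - A" using 1 \<open>\<And>x. x \<notin> A \<Longrightarrow> card ((e - {x}) \<inter> A) = card (e \<inter> A)\<close> by force
      moreover have "card (e - A) = 4 - j" using 2 e by (metis card_Diff_subset_Int finite_Int)
      ultimately show ?thesis using 2 by simp
    next
      case 3
      have "card ((e - {x}) \<inter> A) \<noteq> j" if "x \<in> e" for x
        using 1[of x] 2[of x] 3 that by (cases "x \<in> A") auto
      then have "card {x \<in> e. card ((e - {x}) \<inter> A) = j} = 0"
        by (simp only: card_eq_0_iff) blast
      then show ?thesis using 3 by (simp only: if_False)
    qed
  qed
  then show ?thesis
    unfolding sum_nb[OF assms(1,2)] type_count_eq_sum[OF fin]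
    by (simp add: sum.distrib sum_distrib_left)
qed

lemma card_nsets_superset_le:
  assumes "finite V" "X \<subseteq> V"
  shows "card {e \<in> nsets V k. X \<subseteq> e} \<le> card V choose (k - card X)"
proof -
  have finX: "finite X" using assms finite_subset by blast
  have "inj_on (\<lambda>e. e - X) {e \<in> nsets V k. X \<subseteq> e}" by (auto simp: inj_on_def)
  moreover have "(\<lambda>e. e - X) ` {e \<in> nsets V k. X \<subseteq> e} \<subseteq> nsets V (k - card X)"
    using finX by (auto simp: nsets_def card_Diff_subset)
  ultimately have "card {e \<in> nsets V k. X \<subseteq> e} \<le> card (nsets V (k - card X))"
    using assms(1) by (intro card_inj_on_le) (auto simp: finite_imp_finite_nsets)
  then show ?thesis by simp
qed

lemma deg_le:
  assumes "finite V" "E \<subseteq> nsets V 4" "v \<in> V"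
  shows "deg E v \<le> card V choose 3"
proof -
  have "{e \<in> E. v \<in> e} \<subseteq> {e \<in> nsets V 4. {v} \<subseteq> e}" using assms(2) by auto
  then have "deg E v \<le> card {e \<in> nsets V 4. {v} \<subseteq> e}"
    unfolding deg_def using assms(1) by (intro card_mono) (auto simp: finite_imp_finite_nsets)
  then show ?thesis using card_nsets_superset_le[of V "{v}" 4] assms by simp
qed

section \<open>Cloning vertices\<close>

definition add_clone :: "'a set set \<Rightarrow> 'a \<Rightarrow> 'a \<Rightarrow> 'a set set" where
  "add_clone E v x = E \<union> (\<lambda>e. insert x (e - {v})) ` {e \<in> E. v \<in> e}"

text \<open>Any two vertices of a copy lie in a common edge of it, so no copy contains both a vertex
  and its clone.\<close>

lemma F_free_add_clone:
  assumes E: "E \<subseteq> nsets V 4" and x: "x \<notin> V" and free: "F_free E"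
  shows "F_free (add_clone E v x)"
  unfolding F_free_def
proof (clarify, unfold is_copy_def, clarify)
  fix T Q assume T: "card T = 3" and Q: "Q \<in> add_clone E v x"
    and TQ: "\<forall>w\<in>Q. insert w T \<in> add_clone E v x"
  define \<phi> where "\<phi> = (\<lambda>y. if y = x then v else y)"
  \<comment> \<open>Folding the clone back onto the original sends edges to edges. Injectivity on
    the copy is all that remains, and it can fail only if the copy contains both \<open>x\<close>
    and \<open>v\<close>.\<close>
  have key: "\<phi> ` e \<in> E \<and> \<not> (x \<in> e \<and> v \<in> e)" if e: "e \<in> add_clone E v x" for e
  proof (cases "e \<in> E")
    case True
    then have "x \<notin> e" using E x edgeD(1) by blast
    moreover from this have "\<phi> ` e = e" unfolding \<phi>_def by (auto simp: image_iff)
    ultimately show ?thesis using True by simp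
  next
    case False
    then obtain f where f: "f \<in> E" "v \<in> f" "e = insert x (f - {v})"
      using e unfolding add_clone_def by blast
    then have "x \<notin> f" using E x edgeD(1) by blast
    then have "\<phi> ` e = f" "v \<notin> e" using f unfolding \<phi>_def by (auto simp: image_iff)
    then show ?thesis using f by simp
  qed
  \<comment> \<open>If \<open>x\<close> and \<open>v\<close> both lie in \<open>T\<close>, an edge
    containing them exists only because some \<open>w\<close> in \<open>Q\<close> gives
    \<open>insert w T\<close>.\<close>
  have "Q \<noteq> {}" using key[OF Q] edgeD(3)[OF E, of "\<phi> ` Q"] by auto
  then have "\<not> (x \<in> T \<union> Q \<and> v \<in> T \<union> Q)"
    using key[OF Q] key[OF bspec[OF TQ]] by blast
  then have inj: "inj_on \<phi> (T \<union> Q)" unfolding \<phi>_def inj_on_def by auto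
  then have "card (\<phi> ` T) = 3" using T by (metis card_image inj_on_Un)
  moreover have "\<phi> ` Q \<in> E" using key[OF Q] by blast
  moreover have "insert w (\<phi> ` T) \<in> E" if "w \<in> \<phi> ` Q" for w
    using that key[OF bspec[OF TQ]] by auto
  ultimately show False using free unfolding F_free_def is_copy_def by blast
qed

lemma add_clone_props:
  assumes "finite V" and E: "E \<subseteq> nsets V 4" and x: "x \<notin> V" and v: "v \<in> V"
  shows "add_clone E v x \<subseteq> nsets (insert x V) 4"
    and "card (add_clone E v x) = card E + deg E v"
    and "deg (add_clone E v x) v = deg E v"
proof -
  have x': "x \<notin> e" if "e \<in> E" for e using that E x edgeD(1) by blast
  have finE: "finite E" using assms finite_edges by blast
  have vx: "v \<noteq> x" using v x by blast
  have "insert x (e - {v}) \<in> nsets (insert x V) 4" if "e \<in> E" "v \<in> e" for e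
    using edgeD[OF E that(1)] x'[OF that(1)] that by (intro nsetsI) (auto simp: card_insert_if)
  moreover have "nsets V 4 \<subseteq> nsets (insert x V) 4" by (auto simp: nsets_def)
  ultimately show "add_clone E v x \<subseteq> nsets (insert x V) 4"
    using E unfolding add_clone_def by blast
  have "inj_on (\<lambda>e. insert x (e - {v})) {e \<in> E. v \<in> e}"
  proof (rule inj_on_inverseI)
    fix e assume "e \<in> {e \<in> E. v \<in> e}"
    then show "insert v (insert x (e - {v}) - {x}) = e" using x' by auto
  qed
  then have "card ((\<lambda>e. insert x (e - {v})) ` {e \<in> E. v \<in> e}) = deg E v"
    unfolding deg_def by (rule card_image)
  moreover have "E \<inter> (\<lambda>e. insert x (e - {v})) ` {e \<in> E. v \<in> e} = {}" using x' by blast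
  ultimately show "card (add_clone E v x) = card E + deg E v"
    unfolding add_clone_def using finE by (subst card_Un_disjoint) auto
  have "{e \<in> add_clone E v x. v \<in> e} = {e \<in> E. v \<in> e}"
    unfolding add_clone_def using vx by auto
  then show "deg (add_clone E v x) v = deg E v" unfolding deg_def by simp
qed

lemma ex_add_clones:
  assumes "finite X" "finite V" "E \<subseteq> nsets V 4" "F_free E" "v \<in> V" "X \<inter> V = {}"
  shows "\<exists>E' \<subseteq> nsets (V \<union> X) 4. F_free E' \<and> card E' = card E + card X * deg E v"
proof -
  \<comment> \<open>The induction also carries the degree of \<open>v\<close>: the clones share no
    edge with \<open>v\<close>, so every further clone adds the same number of edges.\<close>
  have "\<exists>E' \<subseteq> nsets (V \<union> X) 4. F_free E' \<and> card E' = card E + card X * deg E v \<and> deg E' v = deg E v"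
    using assms(1,6)
  proof (induction X rule: finite_induct)
    case empty
    then show ?case using assms by auto
  next
    case (insert x X)
    then obtain E' where E': "E' \<subseteq> nsets (V \<union> X) 4" "F_free E'"
      "card E' = card E + card X * deg E v" "deg E' v = deg E v" by auto
    have "finite (V \<union> X)" "x \<notin> V \<union> X" "v \<in> V \<union> X" using assms insert by auto
    then show ?case
      using add_clone_props[OF _ E'(1), of x v] F_free_add_clone[OF E'(1) _ E'(2), of x v] E'(3,4) insert
      by (intro exI[of _ "add_clone E' v x"]) (auto simp: algebra_simps)
  qed
  then show ?thesis by blast
qed

section \<open>Extremal hypergraphs\<close>

definition pack_extremal :: "'a set \<Rightarrow> nat \<Rightarrow> 'a set set \<Rightarrow> bool" where
  "pack_extremal V s E \<longleftrightarrow> E \<subseteq> nsets V 4 \<and> \<not> packs E s \<and>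
     (\<forall>E'. E' \<subseteq> nsets V 4 \<and> \<not> packs E' s \<longrightarrow> card E' \<le> card E)"

lemma ex_maximizer:
  fixes f :: "'b \<Rightarrow> nat"
  assumes "finite S" "S \<noteq> {}"
  shows "\<exists>x\<in>S. \<forall>y\<in>S. f y \<le> f x"
proof -
  have "Max (f ` S) \<in> f ` S" using assms by (intro Max_in) auto
  then obtain x where x: "x \<in> S" "Max (f ` S) = f x" by blast
  have "f y \<le> f x" if "y \<in> S" for y
    unfolding x(2)[symmetric] using assms(1) that by (intro Max_ge) auto
  then show ?thesis using x(1) by blast
qed

lemma ex_pack_extremal:
  assumes "finite V" "s > 0"
  shows "\<exists>E. pack_extremal V s E"
proof -
  let ?P = "{E. E \<subseteq> nsets V 4 \<and> \<not> packs E s}"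
  have "finite ?P"
    by (rule finite_subset[of _ "Pow (nsets V 4)"]) (use assms in \<open>auto simp: finite_imp_finite_nsets\<close>)
  moreover have "\<not> packs {} s"
    using assms(2) unfolding packs_def is_copy_def by (metis card_gt_0_iff ex_in_conv)
  then have "?P \<noteq> {}" by blast
  ultimately obtain E where "E \<in> ?P" "\<forall>E'\<in>?P. card E' \<le> card E"
    using ex_maximizer[of ?P card] by blast
  then show ?thesis unfolding pack_extremal_def by (intro exI[of _ E]) auto
qed

text \<open>Zykov symmetrization: delete \<open>u\<close> and let it return as a clone of
  \<open>v\<close>. The loss is the degree of \<open>u\<close>; the gain is the degree of
  \<open>v\<close> apart from edges through both vertices, of which there are at most
  \<open>card V choose 2\<close>. The competitor stays on \<open>V\<close> because \<open>u\<close>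
  itself serves as the new vertex.\<close>

lemma extremal_degree_le:
  assumes fin: "finite V" and ext: "pack_extremal V 1 E" and u: "u \<in> V" and v: "v \<in> V"
  shows "deg E v \<le> deg E u + (card V choose 2)"
proof (cases "u = v")
  case False
  have E: "E \<subseteq> nsets V 4" and free: "F_free E" using ext unfolding pack_extremal_def packs_1_iff by auto
  have finE: "finite E" using E fin finite_edges by blast
  define E0 where "E0 = {e \<in> E. u \<notin> e}"
  have E0: "E0 \<subseteq> nsets (V - {u}) 4" using E unfolding E0_def by (auto simp: nsets_def)
  have free0: "F_free E0" by (rule F_free_mono[OF free]) (auto simp: E0_def)
  have V: "insert u (V - {u}) = V" "finite (V - {u})" "u \<notin> V - {u}" "v \<in> V - {u}" using u v fin False by auto
  have "card (add_clone E0 v u) \<le> card E"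
    using ext F_free_add_clone[OF E0 V(3) free0, of v] add_clone_props(1)[OF V(2) E0 V(3,4)] V(1)
    unfolding pack_extremal_def packs_1_iff by auto
  moreover have "card (add_clone E0 v u) = card E0 + deg E0 v"
    by (rule add_clone_props(2)[OF V(2) E0 V(3,4)])
  moreover have "card E = card E0 + deg E u"
    unfolding E0_def deg_def using finE by (subst card_Un_disjoint[symmetric]) (auto intro: arg_cong[where f = card])
  moreover have "deg E v \<le> deg E0 v + (card V choose 2)"
  proof -
    have "{e \<in> E. v \<in> e} \<subseteq> {e \<in> E0. v \<in> e} \<union> {e \<in> nsets V 4. {u, v} \<subseteq> e}"
      using E unfolding E0_def by auto
    then have "deg E v \<le> card ({e \<in> E0. v \<in> e} \<union> {e \<in> nsets V 4. {u, v} \<subseteq> e})"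
      unfolding deg_def using fin finE by (intro card_mono) (auto simp: E0_def finite_imp_finite_nsets)
    also have "\<dots> \<le> deg E0 v + card {e \<in> nsets V 4. {u, v} \<subseteq> e}"
      unfolding deg_def by (rule card_Un_le)
    also have "\<dots> \<le> deg E0 v + (card V choose 2)"
      using card_nsets_superset_le[OF fin, of "{u, v}" 4] u v False by simp
    finally show ?thesis .
  qed
  ultimately show ?thesis by linarith
qed simp

section \<open>Odd quadruples\<close>

definition odd_quads :: "'a set \<Rightarrow> 'a set \<Rightarrow> 'a set set" where
  "odd_quads V A = {e \<in> nsets V 4. odd (card (e \<inter> A))}"

text \<open>Four is even, so a quadruple meets both parts with the same parity. This symmetry lets
  either part play the role of \<open>A\<close> later on.\<close>

lemma odd_quads_compl: "odd_quads V (V - A) = odd_quads V A"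
proof -
  have "odd (card (e \<inter> (V - A))) \<longleftrightarrow> odd (card (e \<inter> A))" if "e \<in> nsets V 4" for e
  proof -
    have "e \<inter> (V - A) = e - A" using nsetsD(1)[OF that] by blast
    moreover have "card (e \<inter> A) + card (e - A) = 4"
      using nsetsD[OF that] by (subst card_Un_disjoint[symmetric]) (auto simp: Int_Diff_Un)
    ultimately show ?thesis by presburger
  qed
  then show ?thesis unfolding odd_quads_def by blast
qed

lemma card_insert_Int:
  assumes "finite T" "w \<notin> T"
  shows "card (insert w T \<inter> A) = card (T \<inter> A) + (if w \<in> A then 1 else 0)"
  using assms by (simp add: Int_insert_left)

text \<open>The neighbourhood of a triple lies inside one part, namely \<open>A\<close> if the
  triple meets \<open>A\<close> evenly and the complement otherwise. A quadruple inside one part is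
  even, hence no edge.\<close>

lemma F_free_odd_quads: "F_free (odd_quads V A)"
  unfolding F_free_def
proof (clarify, unfold is_copy_def, clarify)
  let ?E = "odd_quads V A"
  fix T Q assume T: "card T = 3" and Q: "Q \<in> ?E" and TQ: "\<forall>w\<in>Q. insert w T \<in> ?E"
  have E: "?E \<subseteq> nsets V 4" unfolding odd_quads_def by blast
  have finT: "finite T" using T card.infinite by fastforce
  have *: "w \<in> A \<longleftrightarrow> even (card (T \<inter> A))" if "w \<in> Q" for w
  proof -
    have "insert w T \<in> ?E" using TQ that by blast
    then have "odd (card (insert w T \<inter> A))" unfolding odd_quads_def by blast
    moreover have "w \<notin> T" using notin_nb[OF E T, of w] TQ that unfolding nb_def by blast
    ultimately show ?thesis using card_insert_Int[OF finT, of w A] by (auto split: if_splits)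
  qed
  have "card (Q \<inter> A) = 4 \<or> card (Q \<inter> A) = 0"
  proof (cases "even (card (T \<inter> A))")
    case True
    then have "Q \<inter> A = Q" using * by blast
    then show ?thesis using edgeD(3)[OF E Q] by simp
  next
    case False
    then have "Q \<inter> A = {}" using * by blast
    then show ?thesis by simp
  qed
  then show False using Q unfolding odd_quads_def by auto
qed

lemma odd_quads_eq:
  "odd_quads V A = {e \<in> nsets V 4. card (e \<inter> A) = 1} \<union> {e \<in> nsets V 4. card (e \<inter> A) = 3}"
proof -
  have "odd (card (e \<inter> A)) \<longleftrightarrow> card (e \<inter> A) = 1 \<or> card (e \<inter> A) = 3" if "e \<in> nsets V 4" for e
  proof -
    have "card (e \<inter> A) \<le> 4" using nsetsD[OF that] by (metis card_mono inf_le1)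
    then show ?thesis by presburger
  qed
  then show ?thesis unfolding odd_quads_def by blast
qed

lemma card_odd_quads:
  assumes "finite V" "A \<subseteq> V"
  shows "card (odd_quads V A) = card A * (card (V - A) choose 3) + (card A choose 3) * card (V - A)"
proof -
  have "card (odd_quads V A) = card {e \<in> nsets V 4. card (e \<inter> A) = 1} + card {e \<in> nsets V 4. card (e \<inter> A) = 3}"
    unfolding odd_quads_eq using assms by (intro card_Un_disjoint) (auto simp: finite_imp_finite_nsets)
  then show ?thesis using card_nsets_split[OF assms, of 1 4] card_nsets_split[OF assms, of 3 4] by simp
qed

lemma card_odd_quads_real:
  assumes "finite V" "A \<subseteq> V"
  shows "real (card (odd_quads V A)) = real (card A) * real (card (V - A)) *
    (real (card A) ^ 2 + real (card (V - A)) ^ 2 - 3 * real (card V) + 4) / 6"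
proof -
  have "card V = card A + card (V - A)"
    using assms by (metis card_Diff_subset card_mono finite_subset le_add_diff_inverse)
  then show ?thesis unfolding card_odd_quads[OF assms]
    by (simp add: choose_3_eq power2_eq_square field_simps)
qed

text \<open>The equal split is not the best one, but it is optimal up to lower order terms, which
  the generous cubic error covers.\<close>

lemma ex_large_odd_quads:
  assumes "finite V"
  shows "\<exists>A \<subseteq> V. real (card (odd_quads V A)) \<ge> real (card V) ^ 4 / 48 - real (card V) ^ 3"
proof -
  define n where "n = card V"
  obtain A where A: "A \<subseteq> V" "card A = n div 2"
    using obtain_subset_with_card_n[of "n div 2" V] n_def by auto
  define a b where "a = real (card A)" and "b = real (card (V - A))"
  have "card (V - A) = n - n div 2" using A assms n_def by (simp add: card_Diff_subset finite_subset)
  then have ab: "a + b = n" "(a - b)^2 \<le> 1"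
    unfolding a_def b_def A(2) by (cases "even n"; auto elim!: evenE oddE)+
  have s: "4 * (a * b) = n^2 - (a - b)^2" using ab(1)[symmetric] by (simp add: power2_eq_square algebra_simps)
  have val: "real (card (odd_quads V A)) = a * b * (real n ^ 2 - 2 * (a * b) - 3 * real n + 4) / 6"
    unfolding card_odd_quads_real[OF assms A(1)] n_def[symmetric] a_def[symmetric] b_def[symmetric]
    using ab(1)[symmetric] by (simp add: power2_eq_square algebra_simps)
  have "real n ^ 4 / 48 - real n ^ 3 \<le> real (card (odd_quads V A))"
  \<comment> \<open>From 6 on, the lower bound \<open>n^2/2 - 3n\<close> of the second factor is
    nonnegative, as multiplying inequalities requires. Below 6 the claimed bound is not
    positive.\<close>
  proof (cases "n \<ge> 6")
    case True
    have "(real n ^ 2 - 1) / 4 * (real n ^ 2 / 2 - 3 * real n) \<le> (a * b) * (real n ^ 2 - 2 * (a * b) - 3 * real n + 4)"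
    proof (rule mult_mono)
      show "(real n ^ 2 - 1) / 4 \<le> a * b" using s ab(2) by simp
      show "real n ^ 2 / 2 - 3 * real n \<le> real n ^ 2 - 2 * (a * b) - 3 * real n + 4"
        using s zero_le_power2[of "a - b"] by simp
      show "0 \<le> a * b" unfolding a_def b_def by simp
      have "0 \<le> real n * (real n / 2 - 3)" using True by (intro mult_nonneg_nonneg) auto
      then show "0 \<le> real n ^ 2 / 2 - 3 * real n" by (simp add: power2_eq_square algebra_simps)
    qed
    moreover have "(real n ^ 2 - 1) / 4 * (real n ^ 2 / 2 - 3 * real n)
        = real n ^ 4 / 8 - 3 / 4 * real n ^ 3 - real n ^ 2 / 8 + 3 / 4 * real n"
      by (simp add: power2_eq_square power3_eq_cube power4_eq_xxxx field_simps)
    moreover have "real n ^ 2 \<le> real n ^ 3" using True by (intro power_increasing) auto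
    moreover have "real n \<ge> 0" "real n ^ 3 \<ge> 0" by auto
    ultimately show ?thesis unfolding val by linarith
  next
    case False
    then have "real n ^ 3 * (real n / 48 - 1) \<le> 0" by (intro mult_nonneg_nonpos) auto
    then have "real n ^ 4 / 48 - real n ^ 3 \<le> 0" by (simp add: power3_eq_cube power4_eq_xxxx field_simps)
    then show ?thesis by (meson of_nat_0_le_iff order_trans)
  qed
  then show ?thesis using A(1) n_def by blast
qed

section \<open>A neighbourhood of maximum size\<close>

lemma sum_by_type:
  fixes f :: "nat \<Rightarrow> nat"
  assumes "finite V" "E \<subseteq> nsets V 4"
  shows "(\<Sum>e\<in>E. f (card (e \<inter> A))) = (\<Sum>i\<le>4. f i * type_count E A i)"
proof -
  have fin: "finite E" using assms finite_edges by blast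
  have "f (card (e \<inter> A)) = (\<Sum>i\<le>4. f i * (if card (e \<inter> A) = i then 1 else 0))" if "e \<in> E" for e
  proof -
    have "card (e \<inter> A) \<le> 4" using edgeD[OF assms(2) that] by (metis card_mono inf_le1)
    then show ?thesis by (subst sum.remove[of _ "card (e \<inter> A)"]) (auto intro!: sum.neutral)
  qed
  then have "(\<Sum>e\<in>E. f (card (e \<inter> A))) = (\<Sum>e\<in>E. \<Sum>i\<le>4. f i * (if card (e \<inter> A) = i then 1 else 0))"
    by (intro sum.cong) auto
  also have "\<dots> = (\<Sum>i\<le>4. \<Sum>e\<in>E. f i * (if card (e \<inter> A) = i then 1 else 0))" by (rule sum.swap)
  also have "\<dots> = (\<Sum>i\<le>4. f i * type_count E A i)"
    unfolding type_count_eq_sum[OF fin] sum_distrib_left ..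
  finally show ?thesis .
qed

lemma atMost_4: "{..4} = {0, 1, 2, 3, 4 :: nat}" by auto

text \<open>Each bound sums neighbourhood sizes over the triples of one type and replaces every size
  by the largest, \<open>card A\<close>. Independence of the neighbourhood \<open>A\<close> removes
  type 4. The last bound sums over all triples; it is what keeps \<open>A\<close> from being small
  when there are many edges.\<close>

lemma max_nb_bounds:
  assumes fin: "finite V" and E: "E \<subseteq> nsets V 4" and free: "F_free E" and n: "card V \<ge> 3"
  obtains A where "A \<subseteq> V" "type_count E A 4 = 0"
    "3 * type_count E A 3 + 2 * type_count E A 2 \<le> card A * ((card A choose 2) * card (V - A))"
    "2 * type_count E A 2 + 3 * type_count E A 1 \<le> card A * (card A * (card (V - A) choose 2))"
    "type_count E A 1 + 4 * type_count E A 0 \<le> card A * (card (V - A) choose 3)"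
    "4 * card E \<le> (card V choose 3) * card A"
proof -
  obtain S where "S \<subseteq> V" "card S = 3" "finite S" using obtain_subset_with_card_n[OF n] by blast
  then have "nsets V 3 \<noteq> {}" using nsetsI by blast
  moreover have "finite (nsets V 3)" using fin by (rule finite_imp_finite_nsets)
  ultimately obtain T0 where T0: "T0 \<in> nsets V 3" and max: "\<forall>T\<in>nsets V 3. card (nb E T) \<le> card (nb E T0)"
    using ex_maximizer[of "nsets V 3" "\<lambda>T. card (nb E T)"] by blast
  define A where "A = nb E T0"
  have A: "A \<subseteq> V" unfolding A_def by (rule nb_subset[OF E])
  have 4: "type_count E A 4 = 0"
  proof -
    have "card (e \<inter> A) \<noteq> 4" if "e \<in> E" for e
    proof
      assume "card (e \<inter> A) = 4"
      then have "e \<inter> A = e" using edgeD[OF E that] by (intro card_subset_eq) auto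
      then show False using F_freeD[OF free nsetsD(3)[OF T0] that] unfolding A_def by blast
    qed
    then show ?thesis unfolding type_count_def by (simp add: card_eq_0_iff)
  qed
  have bound: "(\<Sum>T\<in>P. card (nb E T)) \<le> card P * card A" if "P \<subseteq> nsets V 3" for P
    using sum_bounded_above[of P "\<lambda>T. card (nb E T)" "card A"] max that unfolding A_def by auto
  have type_bound: "(j + 1) * type_count E A (j + 1) + (4 - j) * type_count E A j
      \<le> ((card A choose j) * (card (V - A) choose (3 - j))) * card A" if "j \<le> 3" for j
    using bound[of "{T \<in> nsets V 3. card (T \<inter> A) = j}"]
    unfolding sum_nb_type[OF fin E that] card_nsets_split[OF fin A that] by blast
  have "(\<Sum>T\<in>nsets V 3. card (nb E T)) = 4 * card E"
  proof -
    have "(\<Sum>T\<in>{T \<in> nsets V 3. True}. card (nb E T)) = (\<Sum>e\<in>E. card {x \<in> e. True})"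
      by (rule sum_nb[OF fin E])
    also have "\<dots> = (\<Sum>e\<in>E. 4)" using edgeD(3)[OF E] by (intro sum.cong) auto
    finally show ?thesis by simp
  qed
  then have e4: "4 * card E \<le> (card V choose 3) * card A" using bound[of "nsets V 3"] by simp
  have "3 * type_count E A 3 + 2 * type_count E A 2 \<le> card A * ((card A choose 2) * card (V - A))"
    using type_bound[of 2] by (simp add: mult.commute)
  moreover have "2 * type_count E A 2 + 3 * type_count E A 1 \<le> card A * (card A * (card (V - A) choose 2))"
    using type_bound[of 1] unfolding one_add_one by (simp add: mult.commute)
  moreover have "type_count E A 1 + 4 * type_count E A 0 \<le> card A * (card (V - A) choose 3)"
    using type_bound[of 0] by (simp add: mult.commute)
  ultimately show ?thesis using that A 4 e4 by blast
qed

text \<open>The degree sum over \<open>A\<close> is \<open>r 1 + 2 * r 2 + 3 * r 3\<close>, at most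
  the sum of the bounds for triples of type 2 and type 0. Dividing by \<open>a\<close> leaves
  \<open>a^2 b/2 + b^3/6\<close>, which is the cubic in \<open>x\<close>. The slack in this estimate
  bounds the edges of types 0 and 2.\<close>

lemma min_degree_structure:
  fixes d :: real
  assumes fin: "finite V" and E: "E \<subseteq> nsets V 4" and free: "F_free E" and n: "card V \<ge> 3"
    and d: "\<And>v. v \<in> V \<Longrightarrow> d \<le> real (deg E v)"
  obtains A and x :: real where "A \<subseteq> V" "real (card A) = card V / 2 + x" "\<bar>x\<bar> \<le> card V / 2"
    "d \<le> real (card V) ^ 3 / 12" "card A > 0 \<longrightarrow> d \<le> real (card V) ^ 3 / 12 - 2 / 3 * x ^ 3"
    "24 * real (card E) \<le> real (card V) ^ 3 * (card V / 2 + x)" "type_count E A 4 = 0"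
    "4 * real (type_count E A 0) \<le> (card V / 2 + x) * (real (card V) ^ 3 / 12 - 2 / 3 * x ^ 3 - d)"
    "2 * real (type_count E A 2) \<le> (card V / 2 + x) *
      ((real (card V) ^ 2 / 4 - x ^ 2) * (card V + x) - 3 * d)"
proof -
  obtain A where A: "A \<subseteq> V" and r4: "type_count E A 4 = 0"
    and r32: "3 * type_count E A 3 + 2 * type_count E A 2 \<le> card A * ((card A choose 2) * card (V - A))"
    and r21: "2 * type_count E A 2 + 3 * type_count E A 1 \<le> card A * (card A * (card (V - A) choose 2))"
    and r10: "type_count E A 1 + 4 * type_count E A 0 \<le> card A * (card (V - A) choose 3)"
    and e4: "4 * card E \<le> (card V choose 3) * card A"
    using max_nb_bounds[OF fin E free n] by blast
  define n a b x where "n = real (card V)" and "a = real (card A)" and "b = real (card (V - A))"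
    and "x = a - n / 2"
  define r where "r = (\<lambda>i. real (type_count E A i))"
  have "card V = card A + card (V - A)"
    using A fin by (metis card_Diff_subset card_mono finite_subset le_add_diff_inverse)
  then have ab: "a = n / 2 + x" "b = n / 2 - x" unfolding n_def a_def b_def x_def by simp_all
  have nn: "a \<ge> 0" "b \<ge> 0" "r i \<ge> 0" "n \<ge> 3" for i unfolding a_def b_def r_def n_def using n by auto
  have "3 * r 3 + 2 * r 2 \<le> a * (real (card A choose 2) * b)"
    using r32 unfolding r_def a_def b_def of_nat_mult[symmetric] by linarith
  also have "\<dots> \<le> a * (a ^ 2 / 2 * b)"
    using choose_2_le[of "card A"] nn unfolding a_def[symmetric] by (intro mult_left_mono mult_right_mono)
  finally have s32: "3 * r 3 + 2 * r 2 \<le> a * (a ^ 2 / 2 * b)" .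
  have "2 * r 2 + 3 * r 1 \<le> a * (a * real (card (V - A) choose 2))"
    using r21 unfolding r_def a_def b_def of_nat_mult[symmetric] by linarith
  also have "\<dots> \<le> a * (a * (b ^ 2 / 2))"
    using choose_2_le[of "card (V - A)"] nn unfolding b_def[symmetric] by (intro mult_left_mono)
  finally have s21: "2 * r 2 + 3 * r 1 \<le> a * (a * (b ^ 2 / 2))" .
  have "r 1 + 4 * r 0 \<le> a * real (card (V - A) choose 3)"
    using r10 unfolding r_def a_def b_def of_nat_mult[symmetric] by linarith
  also have "\<dots> \<le> a * (b ^ 3 / 6)"
    using choose_3_le[of "card (V - A)"] nn unfolding b_def[symmetric] by (intro mult_left_mono)
  finally have s10: "r 1 + 4 * r 0 \<le> a * (b ^ 3 / 6)" .
  have "4 * real (card E) \<le> real (card V choose 3) * a"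
    using e4 unfolding a_def of_nat_mult[symmetric] by linarith
  also have "\<dots> \<le> n ^ 3 / 6 * a"
    using choose_3_le[of "card V"] nn unfolding n_def[symmetric] by (intro mult_right_mono)
  finally have se: "24 * real (card E) \<le> n ^ 3 * a" by simp
  have "real (\<Sum>v\<in>A. deg E v) = r 1 + 2 * r 2 + 3 * r 3"
    unfolding sum_deg[OF fin E A] sum_by_type[OF fin E, of "\<lambda>i. i"] atMost_4 r_def using r4 by simp
  moreover have "(\<Sum>v\<in>A. d) \<le> (\<Sum>v\<in>A. real (deg E v))" using d A by (intro sum_mono) auto
  ultimately have sd: "a * d \<le> r 1 + 2 * r 2 + 3 * r 3" unfolding a_def by simp
  have poly: "a ^ 2 / 2 * b + b ^ 3 / 6 = n ^ 3 / 12 - 2 / 3 * x ^ 3"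
    unfolding ab by (simp add: power2_eq_square power3_eq_cube field_simps)
  have key: "a * d \<le> a * (n ^ 3 / 12 - 2 / 3 * x ^ 3)"
  proof -
    have "a * d \<le> a * (a ^ 2 / 2 * b + b ^ 3 / 6)"
      unfolding distrib_left using sd s32 s10 nn(3)[of 0] by linarith
    then show ?thesis unfolding poly .
  qed
  have dx: "d \<le> n ^ 3 / 12 - 2 / 3 * x ^ 3" if "card A > 0"
    using key that unfolding a_def by simp
  \<comment> \<open>For negative \<open>x\<close> the cubic exceeds \<open>n^3/12\<close>. But then
    \<open>A\<close>, the largest neighbourhood, has fewer than half of the vertices, so there are
    few edges and the average degree gives the bound.\<close>
  have d12: "d \<le> n ^ 3 / 12"
  proof (cases "x \<ge> 0")
    case True
    then have "a > 0" using ab nn by linarith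
    then have "d \<le> n ^ 3 / 12 - 2 / 3 * x ^ 3" using dx unfolding a_def by simp
    then show ?thesis using zero_le_power[OF True, of 3] by linarith
  next
    case False
    have "(\<Sum>v\<in>V. d) \<le> (\<Sum>v\<in>V. real (deg E v))" using d by (intro sum_mono) auto
    also have "\<dots> = real (4 * card E)" unfolding handshake[OF fin E, symmetric] by simp
    finally have "n * d \<le> 4 * real (card E)" unfolding n_def by simp
    also have "\<dots> \<le> n ^ 3 / 6 * a" using se by simp
    also have "\<dots> \<le> n ^ 3 / 6 * (n / 2)" using False ab nn by (intro mult_left_mono) auto
    also have "\<dots> = n * (n ^ 3 / 12)" by simp
    finally show ?thesis using nn by (simp add: mult_le_cancel_left)
  qed
  have x0: "4 * r 0 \<le> a * (n ^ 3 / 12 - 2 / 3 * x ^ 3 - d)"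
  proof -
    have "4 * r 0 \<le> a * (b ^ 3 / 6) + a * (a ^ 2 / 2 * b) - a * d"
      using sd s32 s10 by linarith
    also have "\<dots> = a * (a ^ 2 / 2 * b + b ^ 3 / 6 - d)" by (simp add: algebra_simps)
    finally show ?thesis unfolding poly .
  qed
  \<comment> \<open>Three times the degree sum minus three times \<open>s32\<close> bounds
    \<open>3 * r 1\<close> from below; inserting this into \<open>s21\<close> isolates
    \<open>r 2\<close>.\<close>
  have x2: "2 * r 2 \<le> a * ((n ^ 2 / 4 - x ^ 2) * (n + x) - 3 * d)"
  proof -
    have "2 * r 2 \<le> a * (a * (b ^ 2 / 2)) - 3 * (a * d) + 3 * (a * (a ^ 2 / 2 * b))"
      using sd s32 s21 by linarith
    also have "\<dots> = a * (a * (b ^ 2 / 2) + 3 * (a ^ 2 / 2 * b) - 3 * d)" by (simp add: algebra_simps)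
    also have "a * (b ^ 2 / 2) + 3 * (a ^ 2 / 2 * b) = (n ^ 2 / 4 - x ^ 2) * (n + x)"
      unfolding ab by (simp add: power2_eq_square power3_eq_cube field_simps)
    finally show ?thesis .
  qed
  show ?thesis
    by (rule that[of A x, folded n_def a_def])
      (use A ab nn d12 dx se r4 x0 x2 in \<open>auto simp: r_def abs_le_iff\<close>)
qed

text \<open>An arbitrary F-free \<open>E\<close> may be irregular, so it is replaced by an extremal
  \<open>E'\<close>. There all degrees are within \<open>card V choose 2\<close> of the minimum
  degree, which is at most \<open>n^3/12\<close>.\<close>

lemma card_F_free_le:
  assumes fin: "finite V" and E: "E \<subseteq> nsets V 4" and free: "F_free E"
  shows "real (card E) \<le> real (card V) ^ 4 / 48 + real (card V) ^ 3 / 8"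
proof (cases "card V \<ge> 3")
  case True
  obtain E' where E': "pack_extremal V 1 E'" using ex_pack_extremal[OF fin, of 1] by auto
  then have sub: "E' \<subseteq> nsets V 4" and free': "F_free E'" and "card E \<le> card E'"
    using E free unfolding pack_extremal_def packs_1_iff by auto
  define n where "n = real (card V)"
  have n: "n > 0" using True unfolding n_def by simp
  have "V \<noteq> {}" using True by auto
  then have "Min (deg E' ` V) \<in> deg E' ` V" using fin by (intro Min_in) auto
  then obtain u where u: "u \<in> V" "deg E' u = Min (deg E' ` V)" by (metis imageE)
  have "real (deg E' u) \<le> real (deg E' v)" if "v \<in> V" for v
    using u(2) fin that by (simp add: Min_le)
  from min_degree_structure[OF fin sub free' True this]
  have d: "real (deg E' u) \<le> n ^ 3 / 12" unfolding n_def by blast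
  have "real (4 * card E') = (\<Sum>v\<in>V. real (deg E' v))" unfolding handshake[OF fin sub, symmetric] by simp
  also have "\<dots> \<le> (\<Sum>v\<in>V. n ^ 3 / 12 + n ^ 2 / 2)"
  proof (rule sum_mono)
    fix v assume "v \<in> V"
    then have "deg E' v \<le> deg E' u + (card V choose 2)" by (rule extremal_degree_le[OF fin E' u(1)])
    then have "real (deg E' v) \<le> real (deg E' u) + real (card V choose 2)" by linarith
    then show "real (deg E' v) \<le> n ^ 3 / 12 + n ^ 2 / 2"
      using d choose_2_le[of "card V"] unfolding n_def by linarith
  qed
  also have "\<dots> = n * (n ^ 3 / 12 + n ^ 2 / 2)" unfolding n_def by simp
  also have "\<dots> = n ^ 4 / 12 + n ^ 3 / 2" by (simp add: power2_eq_square power3_eq_cube power4_eq_xxxx field_simps)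
  finally show ?thesis using \<open>card E \<le> card E'\<close> unfolding n_def by simp
next
  case False
  then have "nsets V 4 = {}" using fin by (simp add: nsets_eq_empty)
  then show ?thesis using E by simp
qed

text \<open>Almost regularity turns the lower bound on the number of edges into one on every degree.
  With a minimum degree this close to \<open>n^3/12\<close>, the cubic bound leaves little room for
  \<open>x\<close>, and then for edges of types 0 and 2. The partition is tied to one neighbourhood
  and only close to correct on average.\<close>

lemma extremal_near_odd:
  fixes \<epsilon> :: real
  assumes fin: "finite V" and ext: "pack_extremal V 1 E"
    and \<epsilon>: "0 < \<epsilon>" "\<epsilon> \<le> 1 / 10" and n: "real (card V) \<ge> 100 / \<epsilon> ^ 3"
  shows "\<forall>v\<in>V. real (deg E v) \<ge> real (card V) ^ 3 / 12 - 5 * real (card V) ^ 2"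
    and "\<exists>A\<subseteq>V. real (card (E - odd_quads V A)) \<le> 2 * \<epsilon> * real (card V) ^ 4"
    and "real (card E) \<ge> real (card V) ^ 4 / 48 - real (card V) ^ 3"
proof -
  define n where "n = real (card V)"
  have E: "E \<subseteq> nsets V 4" and free: "F_free E"
    using ext unfolding pack_extremal_def packs_1_iff by auto
  have finE: "finite E" using E fin finite_edges by blast
  have e3: "\<epsilon> ^ 3 > 0" using \<epsilon> by simp
  have "\<epsilon> ^ 3 \<le> \<epsilon> ^ 1" using \<epsilon> by (intro power_decreasing) auto
  then have "100 / \<epsilon> ^ 3 \<ge> 100 / \<epsilon>" using \<epsilon> e3 by (intro divide_left_mono) auto
  moreover have "100 / \<epsilon> \<ge> 100" using \<epsilon> by (simp add: field_simps)
  ultimately have n100: "n \<ge> 100" "n \<ge> 100 / \<epsilon>" using n unfolding n_def by linarith+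
  have n\<epsilon>: "\<epsilon> * n \<ge> 100" "\<epsilon> ^ 3 * n \<ge> 100"
    using n100(2) n \<epsilon> e3 unfolding n_def by (auto simp: field_simps)
  have "card (odd_quads V A) \<le> card E" for A
    using ext F_free_odd_quads[of V A] unfolding pack_extremal_def packs_1_iff odd_quads_def by auto
  then show lower: "real (card E) \<ge> real (card V) ^ 4 / 48 - real (card V) ^ 3"
    using ex_large_odd_quads[OF fin] by (meson of_nat_le_iff order_trans)
  have deg_lower: "real (deg E v) \<ge> n ^ 3 / 12 - 5 * n ^ 2" if v: "v \<in> V" for v
  proof -
    have "real (4 * card E) = (\<Sum>u\<in>V. real (deg E u))" unfolding handshake[OF fin E, symmetric] by simp
    also have "\<dots> \<le> (\<Sum>u\<in>V. real (deg E v) + n ^ 2 / 2)"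
    proof (rule sum_mono)
      fix u assume "u \<in> V"
      then have "deg E u \<le> deg E v + (card V choose 2)" by (rule extremal_degree_le[OF fin ext v])
      then have "real (deg E u) \<le> real (deg E v) + real (card V choose 2)" by linarith
      then show "real (deg E u) \<le> real (deg E v) + n ^ 2 / 2"
        using choose_2_le[of "card V"] unfolding n_def by linarith
    qed
    also have "\<dots> = n * (real (deg E v) + n ^ 2 / 2)" unfolding n_def by simp
    finally have "n * (n ^ 3 / 12 - 4 * n ^ 2) \<le> n * (real (deg E v) + n ^ 2 / 2)"
      using lower unfolding n_def[symmetric] by (simp add: power2_eq_square power3_eq_cube power4_eq_xxxx field_simps)
    then have "n ^ 3 / 12 - 4 * n ^ 2 \<le> real (deg E v) + n ^ 2 / 2"
      using n100 by (simp add: mult_le_cancel_left)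
    then show ?thesis using zero_le_power2[of n] by linarith
  qed
  then show "\<forall>v\<in>V. real (deg E v) \<ge> real (card V) ^ 3 / 12 - 5 * real (card V) ^ 2"
    unfolding n_def by blast
  have n3: "card V \<ge> 3" using n100 unfolding n_def by linarith
  obtain A and x :: real where A: "A \<subseteq> V" "real (card A) = n / 2 + x" and xn: "\<bar>x\<bar> \<le> n / 2"
    and "n ^ 3 / 12 - 5 * n ^ 2 \<le> n ^ 3 / 12"
    and dx: "card A > 0 \<longrightarrow> n ^ 3 / 12 - 5 * n ^ 2 \<le> n ^ 3 / 12 - 2 / 3 * x ^ 3"
    and e24: "24 * real (card E) \<le> n ^ 3 * (n / 2 + x)" and r4: "type_count E A 4 = 0"
    and r0: "4 * real (type_count E A 0) \<le> (n / 2 + x) * (n ^ 3 / 12 - 2 / 3 * x ^ 3 - (n ^ 3 / 12 - 5 * n ^ 2))"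
    and r2: "2 * real (type_count E A 2) \<le> (n / 2 + x) *
      ((n ^ 2 / 4 - x ^ 2) * (n + x) - 3 * (n ^ 3 / 12 - 5 * n ^ 2))"
    by (rule min_degree_structure[OF fin E free n3 deg_lower, folded n_def])
  \<comment> \<open>Compare \<open>24 * card E\<close> from both sides:
    \<open>n^4/2 - 24 n^3\<close> from the odd quadruples, and \<open>n^3 (n/2 + x)\<close> from the
    size of \<open>A\<close>.\<close>
  have x24: "x \<ge> -24"
  proof -
    have "n ^ 3 * (n / 2 - 24) \<le> n ^ 3 * (n / 2 + x)"
      using lower e24 unfolding n_def[symmetric] by (simp add: power3_eq_cube power4_eq_xxxx field_simps)
    then show ?thesis using n100 by (simp add: mult_le_cancel_left)
  qed
  \<comment> \<open>The degree bound gives only \<open>x^3 = O(n^2)\<close>. The hypothesis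
    \<open>n \<ge> 100 / \<epsilon>^3\<close> is cubic in order to turn this into
    \<open>x \<le> \<epsilon> n\<close>.\<close>
  have x_le: "x \<le> \<epsilon> * n"
  proof (rule ccontr)
    assume x: "\<not> x \<le> \<epsilon> * n"
    then have "x > 0" using n\<epsilon> by linarith
    then have "card A > 0" using A(2) n100 by (metis add_pos_pos half_gt_zero less_le_trans of_nat_0_less_iff zero_less_numeral)
    then have "2 / 3 * x ^ 3 \<le> 5 * n ^ 2" using dx by auto
    moreover have "x ^ 3 \<ge> (\<epsilon> * n) ^ 3" using x n\<epsilon> by (intro power_mono) auto
    moreover have "(\<epsilon> * n) ^ 3 = (\<epsilon> ^ 3 * n) * n ^ 2" by (simp add: power2_eq_square power3_eq_cube)
    moreover have "(\<epsilon> ^ 3 * n) * n ^ 2 \<ge> 100 * n ^ 2" using n\<epsilon> by (intro mult_right_mono) auto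
    moreover have "n ^ 2 > 0" using n100 by simp
    ultimately show False by linarith
  qed
  have absx: "\<bar>x\<bar> \<le> \<epsilon> * n" using x_le x24 n\<epsilon> by linarith
  have x3: "\<bar>x ^ 3\<bar> \<le> \<epsilon> / 100 * n ^ 3"
  proof -
    have "\<bar>x ^ 3\<bar> \<le> (\<epsilon> * n) ^ 3" unfolding power_abs using absx by (intro power_mono) auto
    also have "\<dots> = \<epsilon> * (\<epsilon> ^ 2) * n ^ 3" by (simp add: power2_eq_square power3_eq_cube)
    also have "\<dots> \<le> \<epsilon> * ((1 / 10) ^ 2) * n ^ 3"
      using \<epsilon> n100 by (intro mult_right_mono mult_left_mono power_mono) auto
    finally show ?thesis by (simp add: power2_eq_square)
  qed
  have half: "0 \<le> n / 2 + x" "n / 2 + x \<le> n" using xn by linarith+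
  have n2: "n ^ 2 \<le> \<epsilon> / 100 * n ^ 3"
  proof -
    have "100 * n ^ 2 \<le> (\<epsilon> * n) * n ^ 2" using n\<epsilon> by (intro mult_right_mono) auto
    then show ?thesis by (simp add: power2_eq_square power3_eq_cube)
  qed
  have "4 * real (type_count E A 0) \<le> (n / 2 + x) * (\<epsilon> / 10 * n ^ 3)"
  proof -
    have "n ^ 3 / 12 - 2 / 3 * x ^ 3 - (n ^ 3 / 12 - 5 * n ^ 2) \<le> \<epsilon> / 10 * n ^ 3"
      using x3 n2 by linarith
    then show ?thesis using r0 half(1) by (meson mult_left_mono order_trans)
  qed
  also have "\<dots> \<le> n * (\<epsilon> / 10 * n ^ 3)" using half(2) \<epsilon> n100 by (intro mult_right_mono) auto
  finally have r0': "4 * real (type_count E A 0) \<le> \<epsilon> / 10 * n ^ 4"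
    by (simp add: power3_eq_cube power4_eq_xxxx mult_ac)
  have "2 * real (type_count E A 2) \<le> (n / 2 + x) * (\<epsilon> * n ^ 3)"
  proof -
    \<comment> \<open>The terms \<open>n^3/4\<close> cancel, so what remains either carries a factor
      \<open>x\<close> or is of order \<open>n^2\<close>.\<close>
    have "(n ^ 2 / 4 - x ^ 2) * (n + x) - 3 * (n ^ 3 / 12 - 5 * n ^ 2)
        = n ^ 2 * x / 4 - n * x ^ 2 - x ^ 3 + 15 * n ^ 2"
      by (simp add: power2_eq_square power3_eq_cube field_simps)
    moreover have "n ^ 2 * x \<le> n ^ 2 * (\<epsilon> * n)" using x_le by (intro mult_left_mono) auto
    moreover have "n ^ 2 * (\<epsilon> * n) = \<epsilon> * n ^ 3" by (simp add: power2_eq_square power3_eq_cube)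
    moreover have "n * x ^ 2 \<ge> 0" using n100 by auto
    moreover have "\<epsilon> * n ^ 3 \<ge> 0" using n100 \<epsilon> by auto
    ultimately have "(n ^ 2 / 4 - x ^ 2) * (n + x) - 3 * (n ^ 3 / 12 - 5 * n ^ 2) \<le> \<epsilon> * n ^ 3"
      using x3 n2 by linarith
    then show ?thesis using r2 half(1) by (meson mult_left_mono order_trans)
  qed
  also have "\<dots> \<le> n * (\<epsilon> * n ^ 3)" using half(2) \<epsilon> n100 by (intro mult_right_mono) auto
  finally have r2': "2 * real (type_count E A 2) \<le> \<epsilon> * n ^ 4"
    by (simp add: power3_eq_cube power4_eq_xxxx mult_ac)
  have "card (E - odd_quads V A) \<le> type_count E A 0 + type_count E A 2 + type_count E A 4"
  proof -
    have "E - odd_quads V A \<subseteq> {e \<in> E. card (e \<inter> A) = 0} \<union> {e \<in> E. card (e \<inter> A) = 2} \<union> {e \<in> E. card (e \<inter> A) = 4}"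
    proof
      fix e assume e: "e \<in> E - odd_quads V A"
      then have "even (card (e \<inter> A))" using E unfolding odd_quads_def by blast
      moreover have "card (e \<inter> A) \<le> 4" using edgeD[OF E] e by (metis DiffD1 card_mono inf_le1)
      ultimately have "card (e \<inter> A) = 0 \<or> card (e \<inter> A) = 2 \<or> card (e \<inter> A) = 4" by presburger
      then show "e \<in> {e \<in> E. card (e \<inter> A) = 0} \<union> {e \<in> E. card (e \<inter> A) = 2} \<union> {e \<in> E. card (e \<inter> A) = 4}"
        using e by blast
    qed
    then have "card (E - odd_quads V A) \<le>
        card ({e \<in> E. card (e \<inter> A) = 0} \<union> {e \<in> E. card (e \<inter> A) = 2} \<union> {e \<in> E. card (e \<inter> A) = 4})"
      using finE by (intro card_mono) auto
    also have "\<dots> \<le> type_count E A 0 + type_count E A 2 + type_count E A 4"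
      unfolding type_count_def by (intro order_trans[OF card_Un_le] add_mono card_Un_le order_refl)
    finally show ?thesis .
  qed
  then have "real (card (E - odd_quads V A)) \<le> 2 * \<epsilon> * n ^ 4"
    using r4 r0' r2' \<epsilon> zero_le_power[of n 4] n100 mult_nonneg_nonneg[of \<epsilon> "n ^ 4"] by simp
  then show "\<exists>A\<subseteq>V. real (card (E - odd_quads V A)) \<le> 2 * \<epsilon> * real (card V) ^ 4"
    using A(1) unfolding n_def by blast
qed

section \<open>From approximate to exact structure\<close>

lemma card_link:
  assumes "finite V" "E \<subseteq> nsets V 4"
  shows "card {T \<in> nsets V 3. v \<notin> T \<and> insert v T \<in> E \<and> R T} = card {e \<in> E. v \<in> e \<and> R (e - {v})}"
proof -
  have "bij_betw (insert v) {T \<in> nsets V 3. v \<notin> T \<and> insert v T \<in> E \<and> R T} {e \<in> E. v \<in> e \<and> R (e - {v})}"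
    unfolding bij_betw_def
  proof
    show "inj_on (insert v) {T \<in> nsets V 3. v \<notin> T \<and> insert v T \<in> E \<and> R T}"
      by (rule inj_on_inverseI[where g = "\<lambda>e. e - {v}"]) auto
    show "insert v ` {T \<in> nsets V 3. v \<notin> T \<and> insert v T \<in> E \<and> R T} = {e \<in> E. v \<in> e \<and> R (e - {v})}"
    proof (intro equalityI subsetI)
      fix e assume e: "e \<in> {e \<in> E. v \<in> e \<and> R (e - {v})}"
      then have "e - {v} \<in> nsets V 3" using edgeD[OF assms(2), of e] by (intro nsetsI) auto
      then show "e \<in> insert v ` {T \<in> nsets V 3. v \<notin> T \<and> insert v T \<in> E \<and> R T}"
        using e by (intro image_eqI[of _ _ "e - {v}"]) (auto simp: insert_absorb)
    qed auto
  qed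
  from bij_betw_same_card[OF this] show ?thesis .
qed

lemma card_triples_containing_le:
  assumes "finite V" "w \<in> V"
  shows "card {T \<in> nsets V 3. w \<in> T} \<le> card V choose 2"
  using card_nsets_superset_le[OF assms(1), of "{w}" 3] assms(2) by simp

text \<open>When \<open>g\<close> counts the members of a second family above \<open>T\<close>, the
  right side is symmetric in the two families. This allows the exchange in
  \<open>even_le_missing\<close>.\<close>

lemma sum_over_triples:
  fixes g :: "'a set \<Rightarrow> nat"
  assumes "finite V" "E \<subseteq> nsets V 4"
  shows "(\<Sum>e\<in>E. \<Sum>T\<in>nsets e 3. g T) = (\<Sum>T\<in>nsets V 3. card {e \<in> E. T \<subseteq> e} * g T)"
proof -
  have fin: "finite E" "finite (nsets V 3)"
    using assms finite_edges by (auto simp: finite_imp_finite_nsets)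
  have "(\<Sum>e\<in>E. \<Sum>T\<in>nsets e 3. g T) = (\<Sum>e\<in>E. \<Sum>T\<in>{T \<in> nsets V 3. T \<subseteq> e}. g T)"
  proof (rule sum.cong[OF refl])
    fix e assume "e \<in> E"
    then have "nsets e 3 = {T \<in> nsets V 3. T \<subseteq> e}" using edgeD(1)[OF assms(2)] by (auto simp: nsets_def)
    then show "(\<Sum>T\<in>nsets e 3. g T) = (\<Sum>T\<in>{T \<in> nsets V 3. T \<subseteq> e}. g T)" by simp
  qed
  also have "\<dots> = (\<Sum>T\<in>nsets V 3. \<Sum>e\<in>{e \<in> E. T \<subseteq> e}. g T)" by (rule sum.swap_restrict[OF fin])
  finally show ?thesis by simp
qed

text \<open>\<open>A\<close> and \<open>V - A\<close> enter symmetrically, so each of two mirror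
  cases is proved once and transferred by \<open>near_odd_compl\<close>. \<open>few_missing\<close>
  controls only averages; \<open>min_degree\<close> and \<open>max_cut\<close> give control at
  single vertices.\<close>

locale near_odd =
  fixes V :: "'a set" and E :: "'a set set" and A :: "'a set" and n :: real
  assumes fin: "finite V" and E: "E \<subseteq> nsets V 4" and free: "F_free E" and A: "A \<subseteq> V"
    and n_def: "n = real (card V)" and n_large: "n \<ge> 10 ^ 12"
    and few_missing: "real (card (odd_quads V A - E)) \<le> n ^ 4 / 10 ^ 10"
    and balanced: "\<bar>real (card A) - n / 2\<bar> \<le> n / 200"
    and min_degree: "\<And>v. v \<in> V \<Longrightarrow> real (deg E v) \<ge> n ^ 3 / 12 - n ^ 3 / 10 ^ 9"
    and max_cut: "\<And>A'. A' \<subseteq> V \<Longrightarrow> card (E \<inter> odd_quads V A') \<le> card (E \<inter> odd_quads V A)"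
begin

lemma card_compl: "real (card A) + real (card (V - A)) = n"
  unfolding n_def using A fin by (metis card_Diff_subset card_mono finite_subset le_add_diff_inverse of_nat_add)

lemma near_odd_compl: "near_odd V E (V - A) n"
proof
  show "\<bar>real (card (V - A)) - n / 2\<bar> \<le> n / 200" using balanced card_compl by linarith
qed (use fin E free n_def n_large few_missing min_degree max_cut in \<open>simp_all add: odd_quads_compl\<close>)

section \<open>Links and missing quadruples relative to the partition\<close>

definition missing :: "'a set set" where "missing = odd_quads V A - E"

definition link :: "'a \<Rightarrow> ('a set \<Rightarrow> bool) \<Rightarrow> 'a set set" where
  "link v R = {T \<in> nsets V 3. v \<notin> T \<and> insert v T \<in> E \<and> R T}"

lemma finite_sets: "finite (nsets V k)" "finite E" "finite missing" "finite (link v R)" "finite A"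
  using fin E A finite_edges unfolding missing_def odd_quads_def link_def
  by (auto simp: finite_imp_finite_nsets finite_subset)

lemma missing_subset: "missing \<subseteq> nsets V 4"
  unfolding missing_def odd_quads_def by blast

lemma n_powers: "n ^ 5 \<le> n ^ 6 / 10 ^ 12" "n ^ 3 \<le> n ^ 4 / 10 ^ 12" "n ^ 2 \<le> n ^ 3 / 10 ^ 12" "n > 0" "n \<ge> 1000"
proof -
  show "n \<ge> 1000" using n_large by (rule order_trans[rotated]) simp
  show "n > 0" using n_large by (rule less_le_trans[rotated]) simp
  then show "n ^ 5 \<le> n ^ 6 / 10 ^ 12" "n ^ 3 \<le> n ^ 4 / 10 ^ 12" "n ^ 2 \<le> n ^ 3 / 10 ^ 12"
    using mult_right_mono[OF n_large, of "n ^ 5"] mult_right_mono[OF n_large, of "n ^ 3"]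
      mult_right_mono[OF n_large, of "n ^ 2"]
    by (simp_all add: eval_nat_numeral mult_ac)
qed

text \<open>Pairs sharing a vertex number at most \<open>n^5\<close>. Otherwise a missing quadruple
  \<open>m\<close> and a vertex \<open>w\<close> of it determine \<open>T = m - {w}\<close>, and
  \<open>T'\<close> is one of at most \<open>n^2/2\<close> triples through \<open>w\<close>: at most
  \<open>2 n^2\<close> pairs for each \<open>m\<close>.\<close>

lemma card_pairs_le:
  assumes X: "X \<subseteq> nsets V 3" and Y: "Y \<subseteq> nsets V 3"
    and hit: "\<And>T T'. T \<in> X \<Longrightarrow> T' \<in> Y \<Longrightarrow> \<exists>w\<in>T'. w \<in> T \<or> insert w T \<in> missing"
  shows "real (card X) * real (card Y) \<le> n ^ 6 / 10 ^ 9"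
proof -
  define S where "S = (\<lambda>w. {T \<in> nsets V 3. w \<in> T})"
  define P1 P2 where "P1 = (\<Union>w\<in>V. S w \<times> S w)" and "P2 = (\<Union>m\<in>missing. \<Union>w\<in>m. {m - {w}} \<times> S w)"
  have finS: "finite (S w)" for w unfolding S_def using finite_sets by simp
  have finP: "finite P1" "finite P2"
    unfolding P1_def P2_def using fin finS finite_sets edgeD(2)[OF missing_subset] by auto
  have "X \<times> Y \<subseteq> P1 \<union> P2"
  proof clarify
    fix T T' assume T: "T \<in> X" "T' \<in> Y" and n2: "(T, T') \<notin> P2"
    obtain w where w: "w \<in> T'" "w \<in> T \<or> insert w T \<in> missing" using hit[OF T] by blast
    have wV: "w \<in> V" using T(2) w(1) Y nsetsD(1) by blast
    show "(T, T') \<in> P1"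
    proof (cases "w \<in> T")
      case True
      then show ?thesis unfolding P1_def S_def using w(1) T X Y wV by blast
    next
      case False
      then have "insert w T \<in> missing" "T = insert w T - {w}" using w by auto
      then have "(T, T') \<in> P2" unfolding P2_def S_def using w(1) T(2) Y by blast
      then show ?thesis using n2 by blast
    qed
  qed
  then have "card (X \<times> Y) \<le> card (P1 \<union> P2)" using finP by (intro card_mono) auto
  also have "\<dots> \<le> card P1 + card P2" by (rule card_Un_le)
  finally have "card X * card Y \<le> card P1 + card P2" by (simp add: card_cartesian_product)
  then have "real (card X) * real (card Y) \<le> real (card P1) + real (card P2)"
    by (metis of_nat_add of_nat_le_iff of_nat_mult)
  moreover have S_le: "real (card (S w)) \<le> n ^ 2 / 2" if "w \<in> V" for w
    using card_triples_containing_le[OF fin that] choose_2_le[of "card V"] unfolding S_def n_def by linarith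
  have "real (card P1) \<le> n ^ 5"
  proof -
    have "real (card P1) \<le> (\<Sum>w\<in>V. real (card (S w) * card (S w)))"
      unfolding P1_def using card_UN_le[OF fin, of "\<lambda>w. S w \<times> S w"]
      by (simp only: card_cartesian_product of_nat_sum[symmetric] of_nat_le_iff)
    also have "\<dots> \<le> (\<Sum>w\<in>V. n ^ 2 * n ^ 2)"
    proof (rule sum_mono)
      fix w assume "w \<in> V"
      then have "real (card (S w)) \<le> n ^ 2" using S_le[of w] zero_le_power2[of n] by linarith
      then show "real (card (S w) * card (S w)) \<le> n ^ 2 * n ^ 2" unfolding of_nat_mult by (intro mult_mono) auto
    qed
    also have "\<dots> = n ^ 5" unfolding n_def by (simp add: eval_nat_numeral)
    finally show ?thesis .
  qed
  moreover have "real (card P2) \<le> 2 * (n ^ 4 / 10 ^ 10) * n ^ 2"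
  proof -
    have "real (card (\<Union>w\<in>m. {m - {w}} \<times> S w)) \<le> 2 * n ^ 2" if m: "m \<in> missing" for m
    proof -
      note m' = edgeD[OF missing_subset m]
      have "real (card (\<Union>w\<in>m. {m - {w}} \<times> S w)) \<le> (\<Sum>w\<in>m. real (card (S w)))"
        using card_UN_le[OF m'(2), of "\<lambda>w. {m - {w}} \<times> S w"]
        by (simp add: card_cartesian_product of_nat_sum[symmetric] del: of_nat_sum)
      also have "\<dots> \<le> (\<Sum>w\<in>m. n ^ 2 / 2)" using S_le m'(1) by (intro sum_mono) auto
      finally show ?thesis using m'(3) by simp
    qed
    then have "(\<Sum>m\<in>missing. real (card (\<Union>w\<in>m. {m - {w}} \<times> S w))) \<le> (\<Sum>m\<in>missing. 2 * n ^ 2)"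
      by (rule sum_mono)
    moreover have "real (card P2) \<le> (\<Sum>m\<in>missing. real (card (\<Union>w\<in>m. {m - {w}} \<times> S w)))"
      unfolding P2_def using card_UN_le[OF finite_sets(3), of "\<lambda>m. \<Union>w\<in>m. {m - {w}} \<times> S w"]
      by (simp only: of_nat_sum[symmetric] of_nat_le_iff)
    ultimately have "real (card P2) \<le> real (card missing) * (2 * n ^ 2)" by simp
    also have "\<dots> \<le> (n ^ 4 / 10 ^ 10) * (2 * n ^ 2)"
      using few_missing unfolding missing_def by (intro mult_right_mono) auto
    finally show ?thesis by simp
  qed
  moreover have "2 * (n ^ 4 / 10 ^ 10) * n ^ 2 = 2 * n ^ 6 / 10 ^ 10" by (simp add: eval_nat_numeral)
  ultimately show ?thesis using n_powers by simp
qed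

text \<open>\<open>T\<close> and \<open>insert v T'\<close> form a copy unless some \<open>insert w T\<close> is missing.\<close>

lemma cross:
  assumes X: "X \<subseteq> link v (\<lambda>_. True)" and Y: "Y \<subseteq> link v (\<lambda>_. True)"
    and odd: "\<And>T T' w. T \<in> X \<Longrightarrow> T' \<in> Y \<Longrightarrow> w \<in> T' \<Longrightarrow> w \<notin> T \<Longrightarrow> odd (card (insert w T \<inter> A))"
  shows "real (card X) * real (card Y) \<le> n ^ 6 / 10 ^ 9"
proof (rule card_pairs_le)
  fix T T' assume T: "T \<in> X" "T' \<in> Y"
  have l: "T \<in> nsets V 3" "insert v T \<in> E" "T' \<in> nsets V 3" "insert v T' \<in> E"
    using T X Y unfolding link_def by auto
  show "\<exists>w\<in>T'. w \<in> T \<or> insert w T \<in> missing"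
  proof (rule ccontr)
    assume neg: "\<not> ?thesis"
    have "insert w T \<in> E" if w: "w \<in> T'" for w
    proof -
      have "w \<notin> T" "insert w T \<notin> missing" using neg w by auto
      moreover have "w \<in> V" using l(3) w nsetsD(1) by blast
      then have "insert w T \<in> nsets V 4"
        using nsetsD[OF l(1)] \<open>w \<notin> T\<close> by (intro nsetsI) auto
      ultimately show ?thesis using odd[OF T w] unfolding missing_def odd_quads_def by blast
    qed
    then have "insert v T' \<subseteq> nb E T" using l(2) unfolding nb_def by blast
    then show False using F_freeD[OF free nsetsD(3)[OF l(1)] l(4)] by blast
  qed
qed (use X Y in \<open>auto simp: link_def\<close>)

text \<open>No neighbourhood meets both parts substantially: one vertex in \<open>A\<close> with
  three outside, all from the neighbourhood, is an odd quadruple that F-freeness makes missing. So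
  one of the intersections has size below \<open>n/100\<close>, and the other lies in a
  part.\<close>

lemma card_nb_le:
  assumes "card T = 3"
  shows "real (card (nb E T)) \<le> n / 2 + n / 200 + n / 100"
proof -
  define D1 D2 where "D1 = nb E T \<inter> A" and "D2 = nb E T - A"
  have sub: "nb E T \<subseteq> V" by (rule nb_subset[OF E])
  then have finD: "finite D1" "finite D2" unfolding D1_def D2_def using fin finite_subset by blast+
  have "(\<lambda>p. insert (fst p) (snd p)) ` (D1 \<times> nsets D2 3) \<subseteq> missing"
  proof (rule image_subsetI)
    fix p assume "p \<in> D1 \<times> nsets D2 3"
    then obtain w S where p: "p = (w, S)" and w: "w \<in> D1" and S: "S \<in> nsets D2 3" by blast
    have "insert w S \<subseteq> nb E T" using w nsetsD(1)[OF S] unfolding D1_def D2_def by blast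
    then have "insert w S \<notin> E" using F_freeD[OF free assms] by blast
    moreover have "insert w S \<inter> A = {w}" "w \<notin> S" using w nsetsD(1)[OF S] unfolding D1_def D2_def by auto
    moreover have "insert w S \<in> nsets V 4"
      using \<open>insert w S \<subseteq> nb E T\<close> sub nsetsD[OF S] \<open>w \<notin> S\<close> by (intro nsetsI) auto
    ultimately show "insert (fst p) (snd p) \<in> missing" unfolding missing_def odd_quads_def p by simp
  qed
  moreover have "inj_on (\<lambda>p. insert (fst p) (snd p)) (D1 \<times> nsets D2 3)"
  proof (rule inj_on_inverseI[where g = "\<lambda>m. (the_elem (m \<inter> A), m - A)"])
    fix p assume "p \<in> D1 \<times> nsets D2 3"
    then obtain w S where p: "p = (w, S)" and w: "w \<in> D1" and S: "S \<in> nsets D2 3" by blast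
    then have "insert w S \<inter> A = {w}" "insert w S - A = S" using nsetsD(1)[OF S] unfolding D1_def D2_def by auto
    then show "(the_elem (insert (fst p) (snd p) \<inter> A), insert (fst p) (snd p) - A) = p" unfolding p by simp
  qed
  ultimately have "card (D1 \<times> nsets D2 3) \<le> card missing" using finite_sets(3) by (metis card_inj_on_le)
  then have prod: "real (card D1) * real (card D2 choose 3) \<le> n ^ 4 / 10 ^ 10"
    using few_missing unfolding missing_def card_cartesian_product card_nsets of_nat_mult[symmetric] by linarith
  have small: "real (card D1) < n / 100 \<or> real (card D2) < n / 100"
  proof (rule ccontr)
    assume "\<not> ?thesis"
    then have d: "real (card D1) \<ge> n / 100" "real (card D2) \<ge> n / 100" by auto
    have "real (card D2) \<ge> 10 ^ 10" using d n_large by simp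
    define k where "k = real (card D2)"
    have k: "k \<ge> n / 100" "k \<ge> 10 ^ 10" unfolding k_def by fact+
    have "real (card D2 choose 3) \<ge> k ^ 3 / 12"
    proof -
      have "6 * k ^ 2 \<le> k * k ^ 2" using k by (intro mult_right_mono) auto
      then have "k ^ 2 / 2 \<le> k ^ 3 / 12" by (simp add: power2_eq_square power3_eq_cube)
      then show ?thesis using choose_3_ge[of "card D2"] unfolding k_def[symmetric] by linarith
    qed
    moreover have "(n / 100) ^ 3 \<le> k ^ 3" using k n_powers by (intro power_mono) auto
    ultimately have "real (card D2 choose 3) \<ge> (n / 100) ^ 3 / 12" by linarith
    then have "real (card D1) * real (card D2 choose 3) \<ge> n / 100 * ((n / 100) ^ 3 / 12)"
      using d n_powers by (intro mult_mono) auto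
    moreover have "n / 100 * ((n / 100) ^ 3 / 12) = n ^ 4 / 1200000000"
      by (simp add: power3_eq_cube power4_eq_xxxx)
    moreover have False if "c \<ge> p" "p = x / 1200000000" "c \<le> x / 10 ^ 10" "x > 0" for c p x :: real
      using that by simp
    ultimately show False using prod zero_less_power[OF n_powers(4), of 4] by blast
  qed
  have "card (nb E T) = card D1 + card D2"
    unfolding D1_def D2_def using sub fin by (subst card_Un_disjoint[symmetric]) (auto simp: Int_Diff_Un intro: finite_subset)
  moreover have "card D1 \<le> card A" "card D2 \<le> card (V - A)"
    unfolding D1_def D2_def using sub fin finite_sets(5) by (auto intro!: card_mono)
  ultimately show ?thesis using small balanced card_compl by linarith
qed

text \<open>A mixed triple contains exactly two pairs with one vertex \<open>x\<close> in
  \<open>A\<close> and one vertex \<open>y\<close> outside. For a given pair, its third vertex lies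
  in the neighbourhood of \<open>{v, x, y}\<close>. At most \<open>n^2/4\<close> pairs with
  \<open>103n/200\<close> extensions each, halved, give \<open>103/1600\<close>.\<close>

lemma mixed_link_le:
  "real (card (link v (\<lambda>T. card (T \<inter> A) = 1 \<or> card (T \<inter> A) = 2))) \<le> n ^ 3 * (103 / 1600)"
proof -
  define R where "R = link v (\<lambda>T. card (T \<inter> A) = 1 \<or> card (T \<inter> A) = 2)"
  have finR: "finite R" unfolding R_def by (rule finite_sets)
  have fin2: "finite (A \<times> (V - A))" using fin finite_sets by blast
  have "card {p \<in> A \<times> (V - A). fst p \<in> T \<and> snd p \<in> T} = 2" if "T \<in> R" for T
  proof -
    have T: "T \<subseteq> V" "finite T" "card T = 3" "card (T \<inter> A) = 1 \<or> card (T \<inter> A) = 2"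
      using that unfolding R_def link_def nsets_def by auto
    have "{p \<in> A \<times> (V - A). fst p \<in> T \<and> snd p \<in> T} = (T \<inter> A) \<times> (T - A)" using T(1) by auto
    moreover have "card (T - A) = 3 - card (T \<inter> A)" using T by (metis card_Diff_subset_Int finite_Int)
    ultimately have "card {p \<in> A \<times> (V - A). fst p \<in> T \<and> snd p \<in> T} = card (T \<inter> A) * (3 - card (T \<inter> A))"
      by (simp only: card_cartesian_product)
    moreover have "k * (3 - k) = 2" if "k = 1 \<or> k = 2" for k :: nat using that by auto
    ultimately show ?thesis using T(4) by metis
  qed
  then have "(\<Sum>p\<in>A \<times> (V - A). card {T \<in> R. fst p \<in> T \<and> snd p \<in> T}) = (\<Sum>T\<in>R. 2)"
    by (intro sum_multicount_gen[OF fin2 finR]) auto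
  then have "2 * real (card R) = (\<Sum>p\<in>A \<times> (V - A). real (card {T \<in> R. fst p \<in> T \<and> snd p \<in> T}))"
    by (simp add: of_nat_sum[symmetric] del: of_nat_sum)
  also have "\<dots> \<le> (\<Sum>p\<in>A \<times> (V - A). n / 2 + n / 200 + n / 100)"
  proof (rule sum_mono, clarify)
    fix x y assume x: "x \<in> A" and y: "y \<in> V" "y \<notin> A"
    define T0 where "T0 = {v, x, y}"
    have xy: "x \<noteq> y" using x y by blast
    show "real (card {T \<in> R. fst (x, y) \<in> T \<and> snd (x, y) \<in> T}) \<le> n / 2 + n / 200 + n / 100"
    proof (cases "v = x \<or> v = y")
      case True
      then have "{T \<in> R. fst (x, y) \<in> T \<and> snd (x, y) \<in> T} = {}" unfolding R_def link_def by auto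
      then have "card {T \<in> R. fst (x, y) \<in> T \<and> snd (x, y) \<in> T} = 0" by (simp only: card.empty)
      then show ?thesis using n_powers(4) by linarith
    next
      case False
      then have T0: "card T0 = 3" unfolding T0_def using xy by auto
      have "{T \<in> R. fst (x, y) \<in> T \<and> snd (x, y) \<in> T} \<subseteq> (\<lambda>w. {x, y, w}) ` nb E T0"
      proof
        fix T assume "T \<in> {T \<in> R. fst (x, y) \<in> T \<and> snd (x, y) \<in> T}"
        then have T: "T \<in> nsets V 3" "insert v T \<in> E" "x \<in> T" "y \<in> T" unfolding R_def link_def by auto
        have "card (T - {x, y}) = 1" using nsetsD[OF T(1)] T xy by (simp add: card_Diff_subset)
        then obtain w where "T - {x, y} = {w}" using card_1_singletonE by blast
        then have "T = {x, y, w}" using T(3,4) by blast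
        moreover from this have "insert w T0 = insert v T" unfolding T0_def by blast
        then have "w \<in> nb E T0" using T(2) unfolding nb_def by simp
        ultimately show "T \<in> (\<lambda>w. {x, y, w}) ` nb E T0" by blast
      qed
      moreover have "finite (nb E T0)" using nb_subset[OF E] fin finite_subset by blast
      ultimately have "card {T \<in> R. fst (x, y) \<in> T \<and> snd (x, y) \<in> T} \<le> card (nb E T0)"
        by (meson card_image_le card_mono finite_imageI order_trans)
      then show ?thesis using card_nb_le[OF T0] by linarith
    qed
  qed
  also have "\<dots> = real (card A) * real (card (V - A)) * (n * (103 / 200))"
    by (simp add: card_cartesian_product)
  also have "\<dots> \<le> n ^ 2 / 4 * (n * (103 / 200))"
  proof (rule mult_right_mono)
    have "real (card (V - A)) = n - real (card A)" using card_compl by simp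
    moreover have "real (card A) * (n - real (card A)) = n ^ 2 / 4 - (real (card A) - n / 2) ^ 2"
      by (simp add: power2_eq_square field_simps)
    ultimately show "real (card A) * real (card (V - A)) \<le> n ^ 2 / 4" by simp
  qed (use n_powers in simp)
  finally show ?thesis unfolding R_def by (simp add: power2_eq_square power3_eq_cube)
qed

text \<open>Mixed triples account for about \<open>n^3/16\<close> of the link, less than its size of
  about \<open>n^3/12\<close>. So at least \<open>n^3/120\<close> triples of the link lie inside one
  of the parts. If that part is \<open>A\<close>, \<open>cross\<close> makes even link triples rare,
  because adding a vertex of \<open>A\<close> to them gives an odd quadruple; if it is the other
  part, odd ones are rare.\<close>

lemma link_parity:
  assumes v: "v \<in> V"
  shows "real (card (link v (\<lambda>T. even (card (T \<inter> A))))) \<le> n ^ 3 / 10 ^ 6 / 5 \<or>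
    real (card (link v (\<lambda>T. odd (card (T \<inter> A))))) \<le> n ^ 3 / 10 ^ 6 / 5"
proof -
  define L0 L3 Ev Od where "L0 = link v (\<lambda>T. card (T \<inter> A) = 0)" and "L3 = link v (\<lambda>T. card (T \<inter> A) = 3)"
    and "Ev = link v (\<lambda>T. even (card (T \<inter> A)))" and "Od = link v (\<lambda>T. odd (card (T \<inter> A)))"
  have sub: "L0 \<subseteq> link v (\<lambda>_. True)" "L3 \<subseteq> link v (\<lambda>_. True)" "Ev \<subseteq> link v (\<lambda>_. True)" "Od \<subseteq> link v (\<lambda>_. True)"
    unfolding L0_def L3_def Ev_def Od_def link_def by auto
  have c1: "real (card Ev) * real (card L3) \<le> n ^ 6 / 10 ^ 9"
  proof (rule cross[OF sub(3,2)])
    fix T T' w assume T: "T \<in> Ev" "T' \<in> L3" "w \<in> T'" "w \<notin> T"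
    have T': "T' \<in> nsets V 3" "card (T' \<inter> A) = 3" using T(2) unfolding L3_def link_def by auto
    have "T' \<inter> A = T'" using nsetsD[OF T'(1)] T'(2) by (intro card_subset_eq) auto
    then have "w \<in> A" using T(3) by blast
    moreover have "finite T" "even (card (T \<inter> A))" using T(1) unfolding Ev_def link_def nsets_def by auto
    ultimately show "odd (card (insert w T \<inter> A))" using card_insert_Int[of T w A] T(4) by simp
  qed
  have c2: "real (card Od) * real (card L0) \<le> n ^ 6 / 10 ^ 9"
  proof (rule cross[OF sub(4,1)])
    fix T T' w assume T: "T \<in> Od" "T' \<in> L0" "w \<in> T'" "w \<notin> T"
    have T': "T' \<in> nsets V 3" "card (T' \<inter> A) = 0" using T(2) unfolding L0_def link_def by auto
    have "T' \<inter> A = {}" using nsetsD[OF T'(1)] T'(2) by auto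
    then have "w \<notin> A" using T(3) by blast
    moreover have "finite T" "odd (card (T \<inter> A))" using T(1) unfolding Od_def link_def nsets_def by auto
    ultimately show "odd (card (insert w T \<inter> A))" using card_insert_Int[of T w A] T(4) by simp
  qed
  have "link v (\<lambda>_. True) \<subseteq> L0 \<union> L3 \<union> link v (\<lambda>T. card (T \<inter> A) = 1 \<or> card (T \<inter> A) = 2)"
  proof
    fix T assume T: "T \<in> link v (\<lambda>_. True)"
    then have "card (T \<inter> A) \<le> 3" unfolding link_def nsets_def by (auto intro: order_trans[OF card_mono])
    then have "card (T \<inter> A) = 0 \<or> card (T \<inter> A) = 1 \<or> card (T \<inter> A) = 2 \<or> card (T \<inter> A) = 3" by linarith
    then show "T \<in> L0 \<union> L3 \<union> link v (\<lambda>T. card (T \<inter> A) = 1 \<or> card (T \<inter> A) = 2)"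
      using T unfolding L0_def L3_def link_def by blast
  qed
  then have "card (link v (\<lambda>_. True)) \<le> card (L0 \<union> L3 \<union> link v (\<lambda>T. card (T \<inter> A) = 1 \<or> card (T \<inter> A) = 2))"
    unfolding L0_def L3_def by (intro card_mono finite_UnI finite_sets)
  also have "\<dots> \<le> card L0 + card L3 + card (link v (\<lambda>T. card (T \<inter> A) = 1 \<or> card (T \<inter> A) = 2))"
    by (intro order_trans[OF card_Un_le] add_mono card_Un_le order_refl)
  finally have "real (card (link v (\<lambda>_. True))) \<le> real (card L0) + real (card L3) + n ^ 3 * (103 / 1600)"
    using mixed_link_le[of v] by linarith
  moreover have "card (link v (\<lambda>_. True)) = deg E v"
    using card_link[OF fin E, of v "\<lambda>_. True"] unfolding link_def deg_def by simp
  moreover have n3: "n ^ 3 > 0" using n_powers by simp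
  ultimately have "real (card L0) + real (card L3) \<ge> n ^ 3 / 60" using min_degree[OF v] by simp
  then consider "real (card L0) \<ge> n ^ 3 / 120" | "real (card L3) \<ge> n ^ 3 / 120" by linarith
  then show ?thesis
  proof cases
    case 1
    then have "real (card Od) * (n ^ 3 / 120) \<le> real (card Od) * real (card L0)" by (intro mult_left_mono) auto
    then have "real (card Od) * n ^ 3 \<le> 120 / 10 ^ 9 * n ^ 3 * n ^ 3" using c2 by (simp add: eval_nat_numeral)
    then have "real (card Od) \<le> 120 / 10 ^ 9 * n ^ 3" using n3 by (simp only: mult_le_cancel_right_pos)
    then show ?thesis using n3 unfolding Od_def by simp
  next
    case 2
    then have "real (card Ev) * (n ^ 3 / 120) \<le> real (card Ev) * real (card L3)" by (intro mult_left_mono) auto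
    then have "real (card Ev) * n ^ 3 \<le> 120 / 10 ^ 9 * n ^ 3 * n ^ 3" using c1 by (simp add: eval_nat_numeral)
    then have "real (card Ev) \<le> 120 / 10 ^ 9 * n ^ 3" using n3 by (simp only: mult_le_cancel_right_pos)
    then show ?thesis using n3 unfolding Ev_def by simp
  qed
qed

text \<open>\<open>link_parity\<close> does not tell which parity is rare. The cut decides: moving
  \<open>v\<close> to the other side exchanges the odd and the even edges at \<open>v\<close>, so by
  maximality the even ones are no more numerous. As \<open>v\<close> lies in \<open>A\<close>, even
  edges correspond to odd triples of the link.\<close>

lemma bad_at_vertex_le:
  assumes v: "v \<in> A"
  shows "real (card {e \<in> E. v \<in> e \<and> e \<notin> odd_quads V A}) \<le> n ^ 3 / 10 ^ 6 / 5"
proof -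
  define bad good where "bad = {e \<in> E. v \<in> e \<and> even (card (e \<inter> A))}"
    and "good = {e \<in> E. v \<in> e \<and> odd (card (e \<inter> A))}"
  have fin2: "finite bad" "finite good" unfolding bad_def good_def using finite_sets by auto
  have move: "card (e \<inter> A) = Suc (card ((e - {v}) \<inter> A))" if "v \<in> e" "e \<in> E" for e
  proof -
    have "e \<inter> A = insert v ((e - {v}) \<inter> A)" using that v by blast
    then show ?thesis using edgeD(2)[OF E that(2)] by simp
  qed
  have bad: "card bad = card (link v (\<lambda>T. odd (card (T \<inter> A))))"
    unfolding link_def card_link[OF fin E, of v "\<lambda>T. odd (card (T \<inter> A))"] bad_def
  proof (intro arg_cong[where f = card] Collect_cong)
    show "(e \<in> E \<and> v \<in> e \<and> even (card (e \<inter> A))) = (e \<in> E \<and> v \<in> e \<and> odd (card ((e - {v}) \<inter> A)))" for e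
      using move[of e] by (cases "v \<in> e \<and> e \<in> E") auto
  qed
  have good: "card good = card (link v (\<lambda>T. even (card (T \<inter> A))))"
    unfolding link_def card_link[OF fin E, of v "\<lambda>T. even (card (T \<inter> A))"] good_def
  proof (intro arg_cong[where f = card] Collect_cong)
    show "(e \<in> E \<and> v \<in> e \<and> odd (card (e \<inter> A))) = (e \<in> E \<and> v \<in> e \<and> even (card ((e - {v}) \<inter> A)))" for e
      using move[of e] by (cases "v \<in> e \<and> e \<in> E") auto
  qed
  have "card bad \<le> card good"
  proof -
    define other where "other = {e \<in> E. v \<notin> e \<and> odd (card (e \<inter> A))}"
    have fo: "finite other" unfolding other_def using finite_sets by auto
    have "E \<inter> odd_quads V A = other \<union> good"
      unfolding odd_quads_def other_def good_def using E by auto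
    then have "card (E \<inter> odd_quads V A) = card other + card good"
      using fo fin2 by (simp add: card_Un_disjoint other_def good_def disjoint_iff)
    moreover have "E \<inter> odd_quads V (A - {v}) = other \<union> bad"
    proof -
      have 1: "e \<inter> (A - {v}) = e \<inter> A" if "v \<notin> e" for e using that by blast
      have 2: "e \<inter> (A - {v}) = (e - {v}) \<inter> A" for e by blast
      have flip: "odd (card (e \<inter> (A - {v}))) \<longleftrightarrow> (if v \<in> e then even (card (e \<inter> A)) else odd (card (e \<inter> A)))"
        if "e \<in> E" for e
      proof (cases "v \<in> e")
        case True
        then show ?thesis using move[OF True that] unfolding 2 by simp
      next
        case False
        then show ?thesis unfolding 1[OF False] by simp
      qed
      show ?thesis
      proof (rule set_eqI)
        show "e \<in> E \<inter> odd_quads V (A - {v}) \<longleftrightarrow> e \<in> other \<union> bad" for e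
          using flip[of e] E unfolding odd_quads_def other_def bad_def by (auto split: if_splits)
      qed
    qed
    then have "card (E \<inter> odd_quads V (A - {v})) = card other + card bad"
      using fo fin2 by (simp add: card_Un_disjoint other_def bad_def disjoint_iff)
    moreover have "card (E \<inter> odd_quads V (A - {v})) \<le> card (E \<inter> odd_quads V A)"
      using A by (intro max_cut) blast
    ultimately show ?thesis by linarith
  qed
  moreover have "v \<in> V" using v A by blast
  ultimately have "real (card bad) \<le> n ^ 3 / 10 ^ 6 / 5"
    using link_parity[of v] unfolding bad[symmetric] good[symmetric] by linarith
  moreover have "{e \<in> E. v \<in> e \<and> e \<notin> odd_quads V A} = bad"
    unfolding bad_def odd_quads_def using E by blast
  ultimately show ?thesis by (simp only:)
qed

text \<open>A vertex of \<open>A\<close> lies in at most \<open>n^3/12 - 2x^3/3\<close> odd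
  quadruples up to rounding, by balance hardly more than its degree can fall short of. Few edges at
  it are even, so nearly all those quadruples are edges.\<close>

lemma missing_at_part:
  assumes v: "v \<in> A"
  shows "real (card {m \<in> missing. v \<in> m}) \<le> n ^ 3 / 10 ^ 6"
proof -
  define all good bad where "all = {m \<in> odd_quads V A. v \<in> m}" and "good = {e \<in> E. v \<in> e \<and> e \<in> odd_quads V A}"
    and "bad = {e \<in> E. v \<in> e \<and> e \<notin> odd_quads V A}"
  have fin3: "finite all" "finite good" "finite bad"
    unfolding all_def good_def bad_def using finite_sets by (auto simp: odd_quads_def)
  have "deg E v = card good + card bad"
    unfolding deg_def using fin3
    by (subst card_Un_disjoint[symmetric]) (auto simp: good_def bad_def intro: arg_cong[where f = card])
  moreover have "card all = card good + card {m \<in> missing. v \<in> m}"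
    using fin3 finite_sets
    by (subst card_Un_disjoint[symmetric]) (auto simp: good_def all_def missing_def intro: arg_cong[where f = card])
  moreover have "real (card all) \<le> n ^ 3 / 12 + n ^ 3 / 10 ^ 6 / 2"
  proof -
    have "(\<lambda>e. e - {v}) ` all \<subseteq> {T \<in> nsets V 3. card (T \<inter> A) = 0} \<union> {T \<in> nsets V 3. card (T \<inter> A) = 2}"
    proof
      fix T assume "T \<in> (\<lambda>e. e - {v}) ` all"
      then obtain e where e: "e \<in> odd_quads V A" "v \<in> e" "T = e - {v}" unfolding all_def by blast
      have e': "e \<subseteq> V" "finite e" "card e = 4" using e(1) unfolding odd_quads_def nsets_def by auto
      have "e \<inter> A = insert v (T \<inter> A)" "v \<notin> T \<inter> A" using e v by auto
      then have "card (e \<inter> A) = Suc (card (T \<inter> A))" using e' e(3) by simp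
      moreover have "card (e \<inter> A) = 1 \<or> card (e \<inter> A) = 3" using e(1) unfolding odd_quads_eq by blast
      moreover have "T \<in> nsets V 3" using e e' by (intro nsetsI) auto
      ultimately show "T \<in> {T \<in> nsets V 3. card (T \<inter> A) = 0} \<union> {T \<in> nsets V 3. card (T \<inter> A) = 2}" by auto
    qed
    moreover have "inj_on (\<lambda>e. e - {v}) all" unfolding all_def
      by (rule inj_on_inverseI[where g = "insert v"]) auto
    ultimately have "card all \<le> card ({T \<in> nsets V 3. card (T \<inter> A) = 0} \<union> {T \<in> nsets V 3. card (T \<inter> A) = 2})"
      using finite_sets(1)[of 3] by (intro card_inj_on_le) auto
    also have "\<dots> \<le> card {T \<in> nsets V 3. card (T \<inter> A) = 0} + card {T \<in> nsets V 3. card (T \<inter> A) = 2}"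
      by (rule card_Un_le)
    also have "\<dots> = (card (V - A) choose 3) + (card A choose 2) * card (V - A)"
      using card_nsets_split[OF fin A, of 0 3] card_nsets_split[OF fin A, of 2 3] by simp
    finally have le: "real (card all) \<le> real (card (V - A) choose 3) + real (card A choose 2) * real (card (V - A))"
      by (metis of_nat_add of_nat_le_iff of_nat_mult)
    define x where "x = real (card A) - n / 2"
    have ab: "real (card A) = n / 2 + x" "real (card (V - A)) = n / 2 - x"
      unfolding x_def using card_compl by linarith+
    have "real (card A choose 2) * real (card (V - A)) \<le> real (card A) ^ 2 / 2 * real (card (V - A))"
      using choose_2_le by (intro mult_right_mono) auto
    then have "real (card all) \<le> (n / 2 - x) ^ 3 / 6 + (n / 2 + x) ^ 2 / 2 * (n / 2 - x)"
      using le choose_3_le[of "card (V - A)"] unfolding ab by linarith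
    also have "\<dots> = n ^ 3 / 12 - 2 / 3 * x ^ 3" by (simp add: power2_eq_square power3_eq_cube field_simps)
    finally have "real (card all) \<le> n ^ 3 / 12 - 2 / 3 * x ^ 3" .
    moreover have "\<bar>x ^ 3\<bar> \<le> (n / 200) ^ 3"
      unfolding power_abs using balanced unfolding x_def by (intro power_mono) auto
    then have "\<bar>x ^ 3\<bar> \<le> n ^ 3 / 8000000" by (simp add: power_divide)
    ultimately show ?thesis using n_powers(4) zero_le_power[of n 3] by simp
  qed
  moreover have "n ^ 3 > 0" using n_powers by simp
  ultimately show ?thesis
    using bad_at_vertex_le[OF v] min_degree[of v] v A unfolding bad_def[symmetric] by fastforce
qed

lemma missing_at_vertex: "v \<in> V \<Longrightarrow> real (card {m \<in> missing. v \<in> m}) \<le> n ^ 3 / 10 ^ 6"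
proof (cases "v \<in> A")
  case False
  interpret co: near_odd V E "V - A" n by (rule near_odd_compl)
  assume "v \<in> V"
  then show ?thesis using co.missing_at_part[of v] False unfolding co.missing_def missing_def odd_quads_compl by auto
qed (use missing_at_part in auto)

text \<open>For an edge \<open>e\<close> inside \<open>A\<close> and any triple of the other part,
  F-freeness makes some vertex of \<open>e\<close> together with the triple a missing quadruple. All
  these triples would be charged to only four vertices, each in few missing quadruples.\<close>

lemma no_edge_in_part:
  assumes e: "e \<in> E"
  shows "\<not> e \<subseteq> A"
proof
  assume eA: "e \<subseteq> A"
  note e' = edgeD[OF E e]
  have "nsets (V - A) 3 \<subseteq> (\<Union>w\<in>e. (\<lambda>m. m - {w}) ` {m \<in> missing. w \<in> m})"
  proof
    fix T assume T: "T \<in> nsets (V - A) 3"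
    obtain w where w: "w \<in> e" "insert w T \<notin> E"
      using F_freeD[OF free nsetsD(3)[OF T] e] unfolding nb_def by blast
    have "w \<notin> T" "insert w T \<inter> A = {w}" using w eA nsetsD(1)[OF T] by auto
    moreover have "insert w T \<in> nsets V 4"
      using w(1) e'(1) nsetsD[OF T] \<open>w \<notin> T\<close> by (intro nsetsI) auto
    ultimately have "insert w T \<in> missing" "T = insert w T - {w}"
      using w(2) unfolding missing_def odd_quads_def by auto
    then show "T \<in> (\<Union>w\<in>e. (\<lambda>m. m - {w}) ` {m \<in> missing. w \<in> m})" using w(1) by blast
  qed
  then have "card (nsets (V - A) 3) \<le> card (\<Union>w\<in>e. (\<lambda>m. m - {w}) ` {m \<in> missing. w \<in> m})"
    using e'(2) finite_sets by (intro card_mono) auto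
  also have "\<dots> \<le> (\<Sum>w\<in>e. card ((\<lambda>m. m - {w}) ` {m \<in> missing. w \<in> m}))" by (rule card_UN_le[OF e'(2)])
  also have "\<dots> \<le> (\<Sum>w\<in>e. card {m \<in> missing. w \<in> m})"
    using finite_sets by (intro sum_mono card_image_le) auto
  finally have "real (card (V - A) choose 3) \<le> (\<Sum>w\<in>e. real (card {m \<in> missing. w \<in> m}))"
    by (simp add: of_nat_sum[symmetric] del: of_nat_sum)
  also have "\<dots> \<le> (\<Sum>w\<in>e. n ^ 3 / 10 ^ 6)" using missing_at_vertex e'(1) by (intro sum_mono) auto
  also have "\<dots> = 4 * (n ^ 3 / 10 ^ 6)" using e'(3) by simp
  finally have up: "real (card (V - A) choose 3) \<le> 4 * (n ^ 3 / 10 ^ 6)" .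
  have "(n / 4) ^ 3 \<le> real (card (V - A)) ^ 3" using balanced card_compl n_powers by (intro power_mono) linarith+
  moreover have "real (card (V - A)) ^ 2 \<le> n ^ 2" using card_compl by (intro power_mono) auto
  ultimately have "real (card (V - A) choose 3) \<ge> n ^ 3 / 384 - n ^ 2 / 2"
    using choose_3_ge[of "card (V - A)"] by (simp add: power_divide)
  moreover have "False" if "c \<ge> x / 384 - y / 2" "c \<le> 4 * (x / 10 ^ 6)" "y \<le> x / 10 ^ 12" "x > 0" for c x y :: real
    using that by simp
  ultimately show False using up n_powers(3) zero_less_power[OF n_powers(4), of 3] by blast
qed

text \<open>Write \<open>e\<close> as \<open>T\<close> plus \<open>y\<close>, with \<open>y\<close>
  outside \<open>A\<close>. Any three neighbours of \<open>T\<close> in \<open>A\<close> together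
  with \<open>y\<close> form an odd quadruple inside the neighbourhood of \<open>T\<close>, hence a
  missing one at \<open>y\<close>. So \<open>T\<close> has at most \<open>n/40\<close> neighbours in
  \<open>A\<close>, and every other vertex of \<open>A - T\<close> gives a missing quadruple above
  \<open>T\<close>. The constant comes from \<open>0.495 - 0.025 = 0.47\<close>, less 3 for
  \<open>T\<close>.\<close>

lemma missing_above_triple_part:
  assumes e: "e \<in> E" "card (e \<inter> A) = 2" and T: "T \<in> nsets e 3" "card (T \<inter> A) = 2"
  shows "real (card {f \<in> missing. T \<subseteq> f}) \<ge> n * (46 / 100)"
proof -
  note e' = edgeD[OF E e(1)] and T' = nsetsD[OF T(1)]
  define W where "W = nb E T \<inter> A"
  have finW: "finite W" unfolding W_def using finite_sets by blast
  have "card (e - T) = 1" using e' T' by (simp add: card_Diff_subset)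
  then obtain y where y: "e - T = {y}" using card_1_singletonE by blast
  have ins: "insert y T = e" and ye: "y \<in> e" "y \<notin> T" using y T'(1) by auto
  have yA: "y \<notin> A"
  proof
    assume "y \<in> A"
    then have "e \<inter> A = insert y (T \<inter> A)" using ins by blast
    then show False using e(2) T(2) ye T'(2) by simp
  qed
  have "insert y ` nsets W 3 \<subseteq> {m \<in> missing. y \<in> m}"
  proof clarify
    fix S assume S: "S \<in> nsets W 3"
    have SA: "insert y S \<inter> A = S" "y \<notin> S" using nsetsD(1)[OF S] yA unfolding W_def by auto
    have "insert y S \<subseteq> nb E T" using nsetsD(1)[OF S] ins e(1) unfolding W_def nb_def by auto
    then have "insert y S \<notin> E" using F_freeD[OF free T'(3)] by blast
    moreover have "insert y S \<in> nsets V 4"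
      using SA nsetsD[OF S] A ye e' by (intro nsetsI) (auto simp: W_def)
    ultimately show "insert y S \<in> missing \<and> y \<in> insert y S"
      using SA nsetsD(3)[OF S] unfolding missing_def odd_quads_def by auto
  qed
  moreover have "inj_on (insert y) (nsets W 3)"
    using yA by (intro inj_on_inverseI[where g = "\<lambda>m. m - {y}"]) (auto simp: W_def nsets_def)
  ultimately have "card (nsets W 3) \<le> card {m \<in> missing. y \<in> m}"
    using finite_sets by (intro card_inj_on_le) auto
  moreover have "y \<in> V" using ye e' by blast
  ultimately have W3: "real (card W choose 3) \<le> n ^ 3 / 10 ^ 6"
    using missing_at_vertex[of y] unfolding card_nsets by linarith
  have W: "real (card W) \<le> n / 40"
  proof (rule ccontr)
    assume "\<not> ?thesis"
    then have "(n / 40) ^ 3 \<le> real (card W) ^ 3" using n_powers by (intro power_mono) auto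
    moreover have "card W \<le> card V" unfolding W_def using A fin by (intro card_mono) auto
    then have "real (card W) ^ 2 \<le> n ^ 2" unfolding n_def by (intro power_mono) auto
    ultimately have "real (card W choose 3) \<ge> n ^ 3 / 384000 - n ^ 2 / 2"
      using choose_3_ge[of "card W"] by (simp add: power_divide)
    moreover have "False" if "c \<ge> x / 384000 - y / 2" "c \<le> x / 10 ^ 6" "y \<le> x / 10 ^ 12" "x > 0" for c x y :: real
      using that by simp
    ultimately show False using W3 n_powers(3) zero_less_power[OF n_powers(4), of 3] by blast
  qed
  have "(\<lambda>w. insert w T) ` (A - T - W) \<subseteq> {f \<in> missing. T \<subseteq> f}"
  proof clarify
    fix w assume w: "w \<in> A" "w \<notin> T" "w \<notin> W"
    have "card (insert w T \<inter> A) = 3" using card_insert_Int[OF T'(2) w(2), of A] w(1) T(2) by simp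
    moreover have "insert w T \<notin> E" using w unfolding W_def nb_def by blast
    moreover have "insert w T \<in> nsets V 4" using w A T' e' by (intro nsetsI) auto
    ultimately show "insert w T \<in> missing \<and> T \<subseteq> insert w T" unfolding missing_def odd_quads_def by auto
  qed
  moreover have "inj_on (\<lambda>w. insert w T) (A - T - W)" by (auto simp: inj_on_def)
  ultimately have "card (A - T - W) \<le> card {f \<in> missing. T \<subseteq> f}"
    using finite_sets by (intro card_inj_on_le) auto
  moreover have "card A \<le> card (A - T - W) + card T + card W"
    using finite_sets(5) finW T'(2) diff_card_le_card_Diff[of T A] diff_card_le_card_Diff[of W "A - T"] by linarith
  ultimately have "real (card {f \<in> missing. T \<subseteq> f}) \<ge> real (card A) - 3 - real (card W)"
    using T'(3) by linarith
  then show ?thesis using W balanced n_powers(5) by linarith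
qed

lemma card_even_edge:
  assumes e: "e \<in> E" "e \<notin> odd_quads V A"
  shows "card (e \<inter> A) = 2"
proof -
  interpret co: near_odd V E "V - A" n by (rule near_odd_compl)
  note e' = edgeD[OF E e(1)]
  have "even (card (e \<inter> A))" using e E unfolding odd_quads_def by blast
  moreover have "card (e \<inter> A) \<noteq> 0"
    using co.no_edge_in_part[OF e(1)] e' by auto
  moreover have "card (e \<inter> A) \<noteq> 4"
  proof
    assume "card (e \<inter> A) = 4"
    then have "e \<inter> A = e" using e' by (intro card_subset_eq) auto
    then show False using no_edge_in_part[OF e(1)] by blast
  qed
  moreover have "card (e \<inter> A) \<le> 4" using e' by (metis card_mono inf_le1)
  ultimately show ?thesis by presburger
qed

lemma missing_above_triple:
  assumes e: "e \<in> E" "e \<notin> odd_quads V A" and T: "T \<in> nsets e 3"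
  shows "real (card {f \<in> missing. T \<subseteq> f}) \<ge> n * (46 / 100)"
proof -
  interpret co: near_odd V E "V - A" n by (rule near_odd_compl)
  note e' = edgeD[OF E e(1)] and T' = nsetsD[OF T]
  have c2: "card (e \<inter> A) = 2" by (rule card_even_edge[OF e])
  have compl: "card (S \<inter> (V - A)) = card S - card (S \<inter> A)" if "S \<subseteq> e" for S
  proof -
    have "S \<inter> (V - A) = S - A" "finite S" using that e' finite_subset by auto
    then show ?thesis by (metis card_Diff_subset_Int finite_Int)
  qed
  have "card (T \<inter> A) \<le> 2" using c2 T'(1) e'(2) by (metis Int_mono card_mono finite_Int order_refl)
  moreover have "card (T \<inter> (V - A)) \<le> 2"
  proof -
    have "card (T \<inter> (V - A)) \<le> card (e \<inter> (V - A))" using T'(1) e'(2) by (intro card_mono) auto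
    then show ?thesis using compl[of e] c2 e'(3) by simp
  qed
  ultimately consider "card (T \<inter> A) = 2" | "card (T \<inter> (V - A)) = 2"
    using compl[OF T'(1)] T'(3) by linarith
  then show ?thesis
  proof cases
    case 1
    then show ?thesis by (rule missing_above_triple_part[OF e(1) c2 T])
  next
    case 2
    moreover have "card (e \<inter> (V - A)) = 2" using compl[of e] c2 e'(3) by simp
    ultimately show ?thesis
      using co.missing_above_triple_part[OF e(1) _ T] unfolding co.missing_def missing_def odd_quads_compl by blast
  qed
qed

text \<open>The triple \<open>f \<inter> A\<close> is below no even edge, as even edges have type
  (2,2). The other three triples of \<open>f\<close> already have two vertices in \<open>A\<close>,
  so an even edge above one of them must add a vertex of \<open>V - A\<close>; three times
  \<open>0.505n\<close> fits into \<open>1.52n\<close>.\<close>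

lemma even_above_part:
  assumes f: "f \<in> missing" "card (f \<inter> A) = 3"
  shows "real (\<Sum>T\<in>nsets f 3. card {e \<in> E - odd_quads V A. T \<subseteq> e}) \<le> n * (152 / 100)"
proof -
  note f' = edgeD[OF missing_subset f(1)]
  define g where "g = (\<lambda>T. card {e \<in> E - odd_quads V A. T \<subseteq> e})"
  have finf: "finite (nsets f 3)" using f'(2) by (rule finite_imp_finite_nsets)
  have g: "g T \<le> (if T = f \<inter> A then 0 else card (V - A))" if T: "T \<in> nsets f 3" for T
  proof (cases "T = f \<inter> A")
    case True
    have "\<not> T \<subseteq> e" if "e \<in> E - odd_quads V A" for e
    proof
      assume "T \<subseteq> e"
      then have "f \<inter> A \<subseteq> e \<inter> A" using True by blast
      then have "3 \<le> card (e \<inter> A)" using f(2) that edgeD(2)[OF E] by (metis DiffD1 card_mono finite_Int)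
      then show False using card_even_edge[of e] that by simp
    qed
    then show ?thesis using True unfolding g_def by (simp add: card_eq_0_iff) blast
  next
    case False
    note T' = nsetsD[OF T]
    have "f \<inter> A \<noteq> T \<inter> A"
    proof
      assume eq: "f \<inter> A = T \<inter> A"
      then have "f \<inter> A = T" using T' f(2) by (intro card_subset_eq) auto
      then show False using False by blast
    qed
    then have "T \<inter> A \<subset> f \<inter> A" using T'(1) by blast
    then have "card (T \<inter> A) < 3" using f(2) f'(2) psubset_card_mono[of "f \<inter> A" "T \<inter> A"] by simp
    moreover have "card (T \<inter> A) \<ge> 2"
    proof -
      have "card (f - T) = 1" using f' T' by (simp add: card_Diff_subset)
      moreover have "f \<inter> A \<subseteq> (T \<inter> A) \<union> (f - T)" by blast
      then have "card (f \<inter> A) \<le> card ((T \<inter> A) \<union> (f - T))" using f'(2) T'(2) by (intro card_mono) auto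
      ultimately show ?thesis using f(2) card_Un_le[of "T \<inter> A" "f - T"] by linarith
    qed
    ultimately have TA: "card (T \<inter> A) = 2" by linarith
    have "{e \<in> E - odd_quads V A. T \<subseteq> e} \<subseteq> (\<lambda>w. insert w T) ` (V - A)"
    proof
      fix e assume e: "e \<in> {e \<in> E - odd_quads V A. T \<subseteq> e}"
      then have e2: "card (e \<inter> A) = 2" using card_even_edge by blast
      have e': "e \<subseteq> V" "finite e" "card e = 4" using edgeD[OF E] e by auto
      have "card (e - T) = 1" using e' T' e by (simp add: card_Diff_subset)
      then obtain w where w: "e - T = {w}" using card_1_singletonE by blast
      then have we: "e = insert w T" "w \<notin> T" using e by auto
      have "w \<notin> A" using e2 TA card_insert_Int[OF T'(2) we(2), of A] unfolding we(1) by auto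
      then show "e \<in> (\<lambda>w. insert w T) ` (V - A)" using we e'(1) by blast
    qed
    then have "g T \<le> card (V - A)" unfolding g_def using fin
      by (meson card_image_le card_mono finite_Diff finite_imageI order_trans)
    then show ?thesis using False by simp
  qed
  have mem: "f \<inter> A \<in> nsets f 3" using f' f(2) by (intro nsetsI) auto
  have "(\<Sum>T\<in>nsets f 3. g T) \<le> (\<Sum>T\<in>nsets f 3. if T = f \<inter> A then 0 else card (V - A))"
    using g by (rule sum_mono)
  also have "\<dots> = (\<Sum>T\<in>nsets f 3 - {f \<inter> A}. card (V - A))"
    using finf mem by (subst sum.remove[of _ "f \<inter> A"]) auto
  also have "\<dots> = 3 * card (V - A)" using finf mem f'(2,3) by (simp add: numeral_3_eq_3 eval_nat_numeral)
  finally have "real (\<Sum>T\<in>nsets f 3. g T) \<le> 3 * real (card (V - A))" by linarith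
  also have "\<dots> \<le> n * (152 / 100)" using balanced card_compl n_powers by linarith
  finally show ?thesis unfolding g_def .
qed

lemma even_above:
  assumes f: "f \<in> missing"
  shows "real (\<Sum>T\<in>nsets f 3. card {e \<in> E - odd_quads V A. T \<subseteq> e}) \<le> n * (152 / 100)"
proof -
  interpret co: near_odd V E "V - A" n by (rule near_odd_compl)
  note f' = edgeD[OF missing_subset f]
  have "f \<inter> (V - A) = f - A" using f'(1) by blast
  then have c: "card (f \<inter> (V - A)) = 4 - card (f \<inter> A)" using f' by (metis card_Diff_subset_Int finite_Int)
  have "card (f \<inter> A) = 1 \<or> card (f \<inter> A) = 3" using f unfolding missing_def odd_quads_eq by blast
  then show ?thesis
  proof
    assume "card (f \<inter> A) = 1"
    then show ?thesis using co.even_above_part[of f] f c unfolding co.missing_def missing_def odd_quads_compl by simp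
  qed (use even_above_part[OF f] in simp)
qed

text \<open>Pairs sharing a triple are counted with multiplicity from both sides: at least four
  times \<open>0.46n\<close> for each even edge, at most \<open>1.52n\<close> for each missing
  quadruple. As 184 exceeds 152, missing quadruples outnumber even edges unless there are none of
  either.\<close>

lemma even_le_missing: "184 * card (E - odd_quads V A) \<le> 152 * card missing"
proof -
  define bad where "bad = E - odd_quads V A"
  have bad: "bad \<subseteq> nsets V 4" unfolding bad_def using E by blast
  have "(\<Sum>e\<in>bad. \<Sum>T\<in>nsets e 3. card {f \<in> missing. T \<subseteq> f}) =
      (\<Sum>T\<in>nsets V 3. card {e \<in> bad. T \<subseteq> e} * card {f \<in> missing. T \<subseteq> f})"
    by (rule sum_over_triples[OF fin bad])
  also have "\<dots> = (\<Sum>T\<in>nsets V 3. card {f \<in> missing. T \<subseteq> f} * card {e \<in> bad. T \<subseteq> e})"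
    by (simp add: mult.commute)
  also have "\<dots> = (\<Sum>f\<in>missing. \<Sum>T\<in>nsets f 3. card {e \<in> bad. T \<subseteq> e})"
    by (rule sum_over_triples[OF fin missing_subset, symmetric])
  finally have eq: "(\<Sum>e\<in>bad. real (\<Sum>T\<in>nsets e 3. card {f \<in> missing. T \<subseteq> f})) =
      (\<Sum>f\<in>missing. real (\<Sum>T\<in>nsets f 3. card {e \<in> bad. T \<subseteq> e}))"
    unfolding of_nat_sum[symmetric] by simp
  have "(\<Sum>e\<in>bad. n * (184 / 100)) \<le> (\<Sum>e\<in>bad. real (\<Sum>T\<in>nsets e 3. card {f \<in> missing. T \<subseteq> f}))"
  proof (rule sum_mono)
    fix e assume e: "e \<in> bad"
    have "(\<Sum>T\<in>nsets e 3. n * (46 / 100)) \<le> (\<Sum>T\<in>nsets e 3. real (card {f \<in> missing. T \<subseteq> f}))"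
      using e missing_above_triple unfolding bad_def by (intro sum_mono) auto
    moreover have "card (nsets e 3) = 4" using edgeD[OF bad e] by (simp add: numeral_3_eq_3 eval_nat_numeral)
    ultimately show "n * (184 / 100) \<le> real (\<Sum>T\<in>nsets e 3. card {f \<in> missing. T \<subseteq> f})" by simp
  qed
  also have "\<dots> \<le> (\<Sum>f\<in>missing. n * (152 / 100))"
    unfolding eq using even_above unfolding bad_def by (intro sum_mono) auto
  finally have "n * (184 * real (card bad)) \<le> n * (152 * real (card missing))" by (simp add: algebra_simps)
  then have "184 * real (card bad) \<le> 152 * real (card missing)" using n_powers by (simp only: mult_le_cancel_left_pos)
  then show ?thesis unfolding bad_def by linarith
qed

text \<open>If \<open>E\<close> is at least as large as the family of odd quadruples, there are at
  least as many even edges as missing quadruples. With \<open>even_le_missing\<close> both counts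
  vanish.\<close>

lemma exact:
  assumes "card (odd_quads V A) \<le> card E"
  shows "E = odd_quads V A"
proof -
  have finO: "finite (odd_quads V A)" using finite_sets by (simp add: odd_quads_def)
  have "card E = card (E \<inter> odd_quads V A) + card (E - odd_quads V A)"
    using finite_sets by (subst card_Un_disjoint[symmetric]) (auto simp: Int_Diff_Un)
  moreover have "card (odd_quads V A) = card (E \<inter> odd_quads V A) + card missing"
    unfolding missing_def using finO
    by (subst card_Un_disjoint[symmetric]) (auto intro: arg_cong[where f = card])
  ultimately have "card missing = 0" "card (E - odd_quads V A) = 0" using assms even_le_missing by linarith+
  then show ?thesis using finite_sets unfolding missing_def by auto
qed

end

section \<open>Extremal F-free hypergraphs on many vertices\<close>

theorem extremal_odd:
  assumes fin: "finite V" and ext: "pack_extremal V 1 E" and n: "real (card V) \<ge> 10 ^ 40"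
  shows "\<exists>A\<subseteq>V. E = odd_quads V A"
proof -
  define n where "n = real (card V)"
  \<comment> \<open>Chosen so that \<open>2 * \<epsilon> * n^4\<close> fits into the allowance
    \<open>n^4/10^10\<close>, while \<open>100 / \<epsilon>^3 = 10^35\<close> stays below the size
    assumed of \<open>V\<close>.\<close>
  define \<epsilon> :: real where "\<epsilon> = 1 / 10 ^ 11"
  have \<epsilon>: "0 < \<epsilon>" "\<epsilon> \<le> 1 / 10" "real (card V) \<ge> 100 / \<epsilon> ^ 3"
    using n unfolding \<epsilon>_def by (simp_all add: power_divide)
  note near = extremal_near_odd[OF fin ext \<epsilon>]
  have n12: "n \<ge> 10 ^ 12" using n unfolding n_def by simp
  then have n0: "n > 0" by (rule less_le_trans[rotated]) simp
  have E: "E \<subseteq> nsets V 4" and free: "F_free E"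
    using ext unfolding pack_extremal_def packs_1_iff by auto
  have finE: "finite E" using E fin finite_edges by blast
  have opt: "card (odd_quads V A) \<le> card E" for A
    using ext F_free_odd_quads[of V A] unfolding pack_extremal_def packs_1_iff odd_quads_def by auto
  obtain A0 where A0: "A0 \<subseteq> V" "real (card (E - odd_quads V A0)) \<le> 2 * \<epsilon> * n ^ 4"
    using near(2) unfolding n_def by blast
  \<comment> \<open>\<open>A0\<close> guarantees that some partition has almost all edges odd. The
    best partition inherits this and is in addition locally optimal at each vertex.\<close>
  obtain A where A: "A \<subseteq> V" and cut: "\<forall>A'\<in>Pow V. card (E \<inter> odd_quads V A') \<le> card (E \<inter> odd_quads V A)"
    using ex_maximizer[of "Pow V" "\<lambda>A. card (E \<inter> odd_quads V A)"] fin by blast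
  have finO: "finite (odd_quads V A)" using fin by (simp add: odd_quads_def finite_imp_finite_nsets)
  have n34: "n ^ 3 \<le> n ^ 4 / 10 ^ 12"
    using mult_right_mono[OF n12, of "n ^ 3"] n0 by (simp add: eval_nat_numeral mult_ac)
  have n23: "n ^ 2 \<le> n ^ 3 / 10 ^ 12"
    using mult_right_mono[OF n12, of "n ^ 2"] n0 by (simp add: eval_nat_numeral mult_ac)
  have n4: "n ^ 4 > 0" "n ^ 3 > 0" using n0 by auto
  have "card E = card (E \<inter> odd_quads V A0) + card (E - odd_quads V A0)"
    using finE by (subst card_Un_disjoint[symmetric]) (auto simp: Int_Diff_Un)
  moreover have "card (E \<inter> odd_quads V A0) \<le> card (E \<inter> odd_quads V A)" using cut A0(1) by blast
  ultimately have "real (card (E \<inter> odd_quads V A)) \<ge> real (card E) - 2 * \<epsilon> * n ^ 4"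
    using A0(2) by linarith
  then have good: "real (card (E \<inter> odd_quads V A)) \<ge> n ^ 4 / 48 - n ^ 4 / 10 ^ 10"
    using near(3) n34 n4 unfolding n_def[symmetric] \<epsilon>_def by simp
  define x where "x = real (card A) - n / 2"
  have "card V = card A + card (V - A)"
    using A fin by (metis card_Diff_subset card_mono finite_subset le_add_diff_inverse)
  then have ab: "real (card A) = n / 2 + x" "real (card (V - A)) = n / 2 - x" unfolding x_def n_def by simp_all
  \<comment> \<open>This makes the best cut balanced: \<open>x\<close> beyond \<open>n/200\<close>
    would lower the number of odd quadruples by more than the \<open>n^4/10^10\<close> that can be
    missing.\<close>
  have up: "real (card (odd_quads V A)) \<le> n ^ 4 / 48 - x ^ 4 / 3"
  proof -
    have "real (card (odd_quads V A)) \<le> real (card A) * real (card (V - A)) *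
        (real (card A) ^ 2 + real (card (V - A)) ^ 2) / 6"
      unfolding card_odd_quads_real[OF fin A] using n12 unfolding n_def
      by (intro divide_right_mono mult_left_mono) auto
    also have "\<dots> = n ^ 4 / 48 - x ^ 4 / 3"
      unfolding ab by (simp add: power2_eq_square power4_eq_xxxx field_simps)
    finally show ?thesis .
  qed
  have "card (odd_quads V A) = card (E \<inter> odd_quads V A) + card (odd_quads V A - E)"
    using finO by (subst card_Un_disjoint[symmetric]) (auto intro: arg_cong[where f = card])
  then have miss: "x ^ 4 / 3 + real (card (odd_quads V A - E)) \<le> n ^ 4 / 10 ^ 10"
    using up good by linarith
  have x4: "x ^ 4 \<ge> 0" by simp
  interpret near_odd V E A n
  proof
    show "real (card (odd_quads V A - E)) \<le> n ^ 4 / 10 ^ 10" using miss x4 by linarith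
    show "\<bar>real (card A) - n / 2\<bar> \<le> n / 200"
    proof (rule ccontr)
      assume "\<not> ?thesis"
      then have "(n / 200) ^ 4 \<le> \<bar>x\<bar> ^ 4" unfolding x_def using n0 by (intro power_mono) auto
      then have "n ^ 4 / 1600000000 \<le> x ^ 4" by (simp add: power_divide)
      then show False using miss n4 by simp
    qed
    show "n ^ 3 / 12 - n ^ 3 / 10 ^ 9 \<le> real (deg E v)" if "v \<in> V" for v
      using near(1) that n23 n4 unfolding n_def[symmetric] by fastforce
  qed (use fin E free A n_def n12 cut in auto)
  show ?thesis using exact[OF opt] A by blast
qed

section \<open>Disjoint copies\<close>

text \<open>For \<open>card L = t\<close>, these are the edges of a join with a complete 4-graph on
  \<open>L\<close> that are not edges of the other factor.\<close>

definition touching :: "'a set \<Rightarrow> 'a set \<Rightarrow> 'a set set" where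
  "touching V L = {e \<in> nsets V 4. e \<inter> L \<noteq> {}}"

lemma not_packs_F_free:
  assumes "F_free E" "s > 0"
  shows "\<not> packs E s"
proof
  assume "packs E s"
  then obtain C where "finite C" "card C = s" "\<forall>S\<in>C. is_copy E S" unfolding packs_def by blast
  then show False using assms unfolding F_free_def by (metis card_gt_0_iff ex_in_conv)
qed

text \<open>Each vertex of \<open>L\<close> lies in at most one of the disjoint copies, so at least
  \<open>s\<close> of them avoid \<open>L\<close>. Those use only edges of \<open>E\<close>.\<close>

lemma not_packs_touching:
  assumes E: "E \<subseteq> nsets V 4" and V: "finite V" and L: "finite L" and no: "\<not> packs E s"
  shows "\<not> packs (E \<union> touching V L) (s + card L)"
proof
  assume "packs (E \<union> touching V L) (s + card L)"
  then obtain C where C: "finite C" "card C = s + card L" "pairwise disjnt C"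
    and copy: "\<And>S. S \<in> C \<Longrightarrow> is_copy (E \<union> touching V L) S" unfolding packs_def by blast
  define CL where "CL = {S \<in> C. S \<inter> L \<noteq> {}}"
  have "\<forall>S\<in>CL. \<exists>x. x \<in> S \<inter> L" unfolding CL_def by blast
  then obtain pick where pick: "\<And>S. S \<in> CL \<Longrightarrow> pick S \<in> S \<inter> L" by metis
  have "inj_on pick CL"
  proof (rule inj_onI)
    fix S S' assume S: "S \<in> CL" "S' \<in> CL" "pick S = pick S'"
    then have "\<not> disjnt S S'" using pick[of S] pick[of S'] unfolding disjnt_def by auto
    then show "S = S'" using C(3) S unfolding CL_def pairwise_def by blast
  qed
  then have "card CL \<le> card L" using pick L by (intro card_inj_on_le[of pick]) auto
  moreover have "card (C - CL) = card C - card CL"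
    using C(1) unfolding CL_def by (intro card_Diff_subset) auto
  ultimately have "s \<le> card (C - CL)" using C(2) by linarith
  then obtain D where D: "D \<subseteq> C - CL" "card D = s" "finite D" using obtain_subset_with_card_n by metis
  have "is_copy E S" if S: "S \<in> D" for S
  proof -
    have SC: "S \<in> C" "S \<inter> L = {}" using S D unfolding CL_def by auto
    then obtain T Q where TQ: "card T = 3" "Q \<in> E \<union> touching V L"
      "\<forall>w\<in>Q. insert w T \<in> E \<union> touching V L" "S = T \<union> Q"
      using copy unfolding is_copy_def by blast
    have "e \<in> E" if "e \<in> E \<union> touching V L" "e \<subseteq> S" for e
      using that SC(2) unfolding touching_def by blast
    then have "Q \<in> E" "\<forall>w\<in>Q. insert w T \<in> E" using TQ by auto
    then show ?thesis using TQ(1,4) unfolding is_copy_def by blast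
  qed
  moreover have "pairwise disjnt D" using C(3) D(1) by (meson Diff_subset pairwise_subset)
  ultimately have "packs E s" using D unfolding packs_def by blast
  then show False using no by blast
qed

lemma card_touching_ge:
  assumes "finite V" "L \<subseteq> V"
  shows "card L * (card (V - L) choose 3) \<le> card (touching V L)"
proof -
  have "{e \<in> nsets V 4. card (e \<inter> L) = 1} \<subseteq> touching V L" unfolding touching_def by auto
  then have "card {e \<in> nsets V 4. card (e \<inter> L) = 1} \<le> card (touching V L)"
    using assms by (intro card_mono) (auto simp: touching_def finite_imp_finite_nsets)
  then show ?thesis using card_nsets_split[OF assms, of 1 4] by simp
qed

lemma codegree_le:
  assumes V: "finite V" and E: "E \<subseteq> nsets V 4" and W: "W \<subseteq> V" and v: "v \<in> V" "v \<notin> W"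
  shows "deg E v \<le> deg {e \<in> E. e \<inter> W = {}} v + card W * (card V choose 2)"
proof -
  have finE: "finite E" using V E finite_edges by blast
  have finW: "finite W" using W V finite_subset by blast
  have finU: "finite (\<Union>w\<in>W. {e \<in> nsets V 4. {v, w} \<subseteq> e})"
    using finW V by (auto simp: finite_imp_finite_nsets)
  have "{e \<in> E. v \<in> e} \<subseteq> {e \<in> {e \<in> E. e \<inter> W = {}}. v \<in> e} \<union> (\<Union>w\<in>W. {e \<in> nsets V 4. {v, w} \<subseteq> e})"
    using E by blast
  then have "deg E v \<le> card ({e \<in> {e \<in> E. e \<inter> W = {}}. v \<in> e} \<union> (\<Union>w\<in>W. {e \<in> nsets V 4. {v, w} \<subseteq> e}))"
    unfolding deg_def using finU finE by (intro card_mono) auto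
  also have "\<dots> \<le> deg {e \<in> E. e \<inter> W = {}} v + card (\<Union>w\<in>W. {e \<in> nsets V 4. {v, w} \<subseteq> e})"
    unfolding deg_def by (rule card_Un_le)
  also have "card (\<Union>w\<in>W. {e \<in> nsets V 4. {v, w} \<subseteq> e}) \<le> (\<Sum>w\<in>W. card {e \<in> nsets V 4. {v, w} \<subseteq> e})"
    by (rule card_UN_le[OF finW])
  also have "\<dots> \<le> (\<Sum>w\<in>W. card V choose 2)"
  proof (rule sum_mono)
    fix w assume w: "w \<in> W"
    then have "v \<noteq> w" using v(2) by blast
    then have "{v, w} \<subseteq> V" "card {v, w} = 2" using v(1) W w by auto
    then show "card {e \<in> nsets V 4. {v, w} \<subseteq> e} \<le> card V choose 2"
      using card_nsets_superset_le[OF V, of "{v, w}" 4] by simp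
  qed
  finally show ?thesis by simp
qed

lemma card_minus_vertices_ge:
  assumes "finite E" "finite W"
  shows "card E \<le> card {e \<in> E. e \<inter> W = {}} + (\<Sum>w\<in>W. deg E w)"
proof -
  have "E \<subseteq> {e \<in> E. e \<inter> W = {}} \<union> (\<Union>w\<in>W. {e \<in> E. w \<in> e})" by blast
  then have "card E \<le> card ({e \<in> E. e \<inter> W = {}} \<union> (\<Union>w\<in>W. {e \<in> E. w \<in> e}))"
    using assms by (intro card_mono) auto
  also have "\<dots> \<le> card {e \<in> E. e \<inter> W = {}} + card (\<Union>w\<in>W. {e \<in> E. w \<in> e})" by (rule card_Un_le)
  also have "card (\<Union>w\<in>W. {e \<in> E. w \<in> e}) \<le> (\<Sum>w\<in>W. deg E w)" unfolding deg_def by (rule card_UN_le[OF assms(2)])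
  finally show ?thesis by simp
qed

text \<open>Adding about \<open>n/50\<close> clones of a vertex of too large a degree would beat the density bound.\<close>

lemma deg_near_extremal_le:
  fixes E :: "'a set set" and n :: real
  assumes inf: "infinite (UNIV :: 'a set)" and V: "finite V" and E: "E \<subseteq> nsets V 4"
    and free: "F_free E" and v: "v \<in> V" and n: "real (card V) \<le> n" "n \<ge> 10 ^ 7"
    and large: "real (card E) \<ge> n ^ 4 / 48 - n ^ 4 / 10 ^ 5"
  shows "real (deg E v) \<le> n ^ 3 * (1 / 12 + 4 / 1000)"
proof -
  have n0: "n > 0" using n(2) by (rule less_le_trans[rotated]) simp
  \<comment> \<open>The size of \<open>k\<close> balances two errors in the degree bound after
    division by \<open>x\<close>: the second order term of \<open>(n + x)^4 / 48\<close> costs about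
    \<open>n^2 x / 8\<close>, and the deficit in \<open>large\<close> costs
    \<open>n^4 / (10^5 x)\<close>.\<close>
  define k where "k = nat \<lceil>n / 50\<rceil>"
  have k: "real k \<ge> n / 50" "real k \<le> n / 50 + 1" unfolding k_def using n0 by linarith+
  \<comment> \<open>The infinite vertex type supplies new names for the clones.\<close>
  have "infinite (UNIV - V)" using inf V by simp
  then obtain X where X: "X \<subseteq> UNIV - V" "finite X" "card X = k"
    using infinite_arbitrarily_large by blast
  then obtain E' where E': "E' \<subseteq> nsets (V \<union> X) 4" "F_free E'" "card E' = card E + k * deg E v"
    using ex_add_clones[OF X(2) V E free v] by auto
  define x where "x = real k"
  have x: "n / 50 \<le> x" "x \<le> n / 49" using k n(2) unfolding x_def by auto
  have x0: "x > 0" using x(1) n0 by linarith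
  have "card (V \<union> X) = card V + k" using X V by (subst card_Un_disjoint) auto
  then have cVX: "real (card (V \<union> X)) \<le> n + x" using n(1) unfolding x_def by simp
  have "real (card E') \<le> real (card (V \<union> X)) ^ 4 / 48 + real (card (V \<union> X)) ^ 3 / 8"
    using V X(2) by (intro card_F_free_le[OF _ E'(1,2)]) auto
  also have "\<dots> \<le> (n + x) ^ 4 / 48 + (n + x) ^ 3 / 8"
    using cVX by (intro add_mono divide_right_mono power_mono) auto
  finally have 1: "real (card E) + x * real (deg E v) \<le> (n + x) ^ 4 / 48 + (n + x) ^ 3 / 8"
    unfolding E'(3) x_def by simp
  have "(n + x) ^ 4 / 48 = n ^ 4 / 48 + x * (n ^ 3 / 12 + n ^ 2 * x / 8 + n * x ^ 2 / 12 + x ^ 3 / 48)"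
    by (simp add: eval_nat_numeral field_simps)
  moreover have "x * (n ^ 3 / 12 + n ^ 2 * x / 8 + n * x ^ 2 / 12 + x ^ 3 / 48) \<le>
      x * (n ^ 3 / 12 + n ^ 2 * (n / 49) / 8 + n * (n / 49) ^ 2 / 12 + (n / 49) ^ 3 / 48)"
    using x x0 n0 by (intro mult_left_mono add_mono divide_right_mono power_mono) auto
  moreover have "n ^ 3 / 12 + n ^ 2 * (n / 49) / 8 + n * (n / 49) ^ 2 / 12 + (n / 49) ^ 3 / 48
      \<le> n ^ 3 * (1 / 12 + 3 / 1000)"
    using n0 by (simp add: eval_nat_numeral field_simps)
  then have "x * (n ^ 3 / 12 + n ^ 2 * (n / 49) / 8 + n * (n / 49) ^ 2 / 12 + (n / 49) ^ 3 / 48)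
      \<le> x * (n ^ 3 * (1 / 12 + 3 / 1000))"
    using x0 by (intro mult_left_mono) auto
  moreover have "n ^ 4 / 10 ^ 5 \<le> x * (n ^ 3 * (5 / 10000))"
  proof -
    have "n / 50 * (n ^ 3 * (5 / 10000)) \<le> x * (n ^ 3 * (5 / 10000))"
      using x n0 by (intro mult_right_mono) auto
    then show ?thesis by (simp add: eval_nat_numeral)
  qed
  moreover have "(n + x) ^ 3 / 8 \<le> x * (n ^ 3 * (1 / 10000))"
  proof -
    have "(n + x) ^ 3 \<le> (n + n) ^ 3" using x n0 by (intro power_mono) auto
    also have "\<dots> = 8 * n ^ 3" by (simp add: power3_eq_cube)
    finally have "(n + x) ^ 3 / 8 \<le> 1 * n ^ 3" by simp
    also have "1 * n ^ 3 \<le> (x * (1 / 10000)) * n ^ 3"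
      using x n n0 by (intro mult_right_mono) auto
    finally show ?thesis by (simp add: mult_ac)
  qed
  ultimately have "x * real (deg E v) \<le> x * (n ^ 3 * (1 / 12 + 3 / 1000)) + x * (n ^ 3 * (5 / 10000)) + x * (n ^ 3 * (1 / 10000))"
    using 1 large by linarith
  also have "\<dots> = x * (n ^ 3 * (1 / 12 + 36 / 10000))" by (simp add: field_simps)
  finally have "real (deg E v) \<le> n ^ 3 * (1 / 12 + 36 / 10000)" using x0 by (simp only: mult_le_cancel_left_pos)
  then show ?thesis using n0 zero_le_power[of n 3] by (simp add: field_simps)
qed

section \<open>Vertices that some family of disjoint copies avoids\<close>

lemma ex_deg_ge_average:
  assumes "finite V" "E \<subseteq> nsets V 4" "V \<noteq> {}"
  shows "\<exists>u\<in>V. 4 * card E \<le> card V * deg E u"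
proof -
  obtain u where u: "u \<in> V" "\<forall>v\<in>V. deg E v \<le> deg E u" using ex_maximizer[OF assms(1,3), of "deg E"] by blast
  then have "(\<Sum>v\<in>V. deg E v) \<le> card V * deg E u" using sum_bounded_above[of V "deg E" "deg E u"] by auto
  then show ?thesis using handshake[OF assms(1,2)] u(1) by auto
qed

text \<open>Take \<open>W\<close> to be the union of \<open>s\<close> disjoint copies avoiding
  \<open>v\<close>. A further copy outside \<open>W\<close> would complete a packing of
  \<open>s + 1\<close>, so what remains is F-free, and it still contains the vertex
  \<open>v\<close>.\<close>

lemma packing_complement:
  assumes V: "finite V" and E: "E \<subseteq> nsets V 4" and no: "\<not> packs E (Suc s)"
    and pk: "packs {e \<in> E. v \<notin> e} s" and v: "v \<in> V"
  obtains W where "W \<subseteq> V" "v \<notin> W" "card W = 7 * s" "F_free {e \<in> E. e \<inter> W = {}}"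
proof -
  obtain C where C: "finite C" "card C = s" "pairwise disjnt C"
    and copy: "\<And>S. S \<in> C \<Longrightarrow> is_copy {e \<in> E. v \<notin> e} S" using pk unfolding packs_def by blast
  define W where "W = \<Union> C"
  have sub: "{e \<in> E. v \<notin> e} \<subseteq> nsets (V - {v}) 4" using E by (auto simp: nsets_def)
  note props = is_copy_props[OF copy sub]
  have W: "W \<subseteq> V" "v \<notin> W" unfolding W_def using props(1) by auto
  have cW: "card W = 7 * s"
  proof -
    have "card W = (\<Sum>S\<in>C. card S)" unfolding W_def
      using props(2) C(3) by (intro card_Union_disjoint) auto
    then show ?thesis using props(3) C(2) by simp
  qed
  have "F_free {e \<in> E. e \<inter> W = {}}" unfolding F_free_def
  proof
    assume "\<exists>S. is_copy {e \<in> E. e \<inter> W = {}} S"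
    then obtain S where S: "is_copy {e \<in> E. e \<inter> W = {}} S" by blast
    have "{e \<in> E. e \<inter> W = {}} \<subseteq> nsets (V - W) 4" using E by (auto simp: nsets_def)
    note S' = is_copy_props[OF S this]
    have "S \<notin> C"
    proof
      assume "S \<in> C"
      then have "S \<subseteq> W" unfolding W_def by blast
      then have "S = {}" using S'(1) by blast
      then show False using S'(3) by simp
    qed
    then have "card (insert S C) = Suc s" using C by simp
    moreover have "pairwise disjnt (insert S C)"
      using C(3) S'(1) unfolding pairwise_insert W_def disjnt_def by blast
    moreover have "is_copy E S'" if "S' \<in> insert S C" for S'
      using that is_copy_mono[OF S, of E] is_copy_mono[OF copy, of S' E] by auto
    ultimately have "packs E (Suc s)" using C(1) unfolding packs_def by (intro exI[of _ "insert S C"]) auto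
    then show False using no by blast
  qed
  then show ?thesis using that W cW by blast
qed

text \<open>If every vertex could be avoided by \<open>s\<close> disjoint copies, all degrees would be about half of
  the possible ones. But then deleting the vertices of \<open>s\<close> copies, putting \<open>6s\<close> of them back as
  clones and the other \<open>s\<close> as vertices of full degree would gain edges.\<close>

lemma ex_universal_vertex:
  fixes E :: "'a set set"
  assumes inf: "infinite (UNIV :: 'a set)" and V: "finite V" and ext: "pack_extremal V (Suc s) E"
    and s: "s > 0" and n: "real (card V) \<ge> 10 ^ 7" "10 ^ 6 * real s \<le> real (card V)"
  shows "\<exists>v\<in>V. \<not> packs {e \<in> E. v \<notin> e} s"
proof (rule ccontr)
  assume "\<not> ?thesis"
  then have all: "\<And>v. v \<in> V \<Longrightarrow> packs {e \<in> E. v \<notin> e} s" by blast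
  define n x where "n = real (card V)" and "x = real s"
  have n7: "n \<ge> 10 ^ 7" and x: "x > 0" "10 ^ 6 * x \<le> n" using n s unfolding n_def x_def by auto
  have n0: "n > 0" using n7 by (rule less_le_trans[rotated]) simp
  have n3: "n ^ 3 \<le> n ^ 4 / 10 ^ 7" "n ^ 2 \<le> n ^ 3 / 10 ^ 7"
    using mult_right_mono[OF n7, of "n ^ 3"] mult_right_mono[OF n7, of "n ^ 2"] n0
    by (simp_all add: eval_nat_numeral mult_ac)
  have xn: "10 ^ 6 * (x * n ^ 3) \<le> n ^ 4" "10 ^ 6 * (x * n ^ 2) \<le> n ^ 3"
    using mult_right_mono[OF x(2), of "n ^ 3"] mult_right_mono[OF x(2), of "n ^ 2"] n0
    by (simp_all add: eval_nat_numeral mult_ac)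
  have p3: "n ^ 3 > 0" and p4: "n ^ 4 > 0" using n0 by simp_all
  have E: "E \<subseteq> nsets V 4" and no: "\<not> packs E (Suc s)"
    and best: "\<And>E'. E' \<subseteq> nsets V 4 \<Longrightarrow> \<not> packs E' (Suc s) \<Longrightarrow> card E' \<le> card E"
    using ext unfolding pack_extremal_def by auto
  have finE: "finite E" using V E finite_edges by blast
  have lower: "real (card E) \<ge> n ^ 4 / 48 - n ^ 3"
  proof -
    obtain A where A: "real (card (odd_quads V A)) \<ge> n ^ 4 / 48 - n ^ 3"
      using ex_large_odd_quads[OF V] unfolding n_def by blast
    have "card (odd_quads V A) \<le> card E"
      using not_packs_F_free[OF F_free_odd_quads] by (intro best) (auto simp: odd_quads_def)
    then show ?thesis using A by linarith
  qed
  have deg_all: "real (deg E w) \<le> n ^ 3 / 6" if "w \<in> V" for w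
    using deg_le[OF V E that] choose_3_le[of "card V"] unfolding n_def by linarith
  have H: "real (card {e \<in> E. e \<inter> W = {}}) \<ge> n ^ 4 / 48 - n ^ 4 / 10 ^ 5"
    if W: "W \<subseteq> V" "card W = 7 * s" for W
  proof -
    have finW: "finite W" using W V finite_subset by blast
    have "real (card E) \<le> real (card {e \<in> E. e \<inter> W = {}}) + (\<Sum>w\<in>W. real (deg E w))"
      using card_minus_vertices_ge[OF finE finW] unfolding of_nat_sum[symmetric] by linarith
    moreover have "(\<Sum>w\<in>W. real (deg E w)) \<le> (\<Sum>w\<in>W. n ^ 3 / 6)" using deg_all W by (intro sum_mono) auto
    then have "(\<Sum>w\<in>W. real (deg E w)) \<le> 7 / 6 * (x * n ^ 3)" unfolding x_def using W(2) by simp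
    ultimately show ?thesis using lower n3 xn p4 by simp
  qed
  \<comment> \<open>\<open>W\<close> depends on \<open>v\<close> and avoids it, so the clone bound
    applies to the degree of \<open>v\<close> in the F-free remainder. Putting \<open>W\<close> back
    adds at most \<open>7s\<close> times \<open>card V choose 2\<close> edges at \<open>v\<close>,
    negligible since \<open>s\<close> is at most \<open>n/10^6\<close>.\<close>
  have deg_small: "real (deg E v) \<le> n ^ 3 * (1 / 12 + 5 / 1000)" if v: "v \<in> V" for v
  proof -
    obtain W where W: "W \<subseteq> V" "v \<notin> W" "card W = 7 * s" "F_free {e \<in> E. e \<inter> W = {}}"
      using packing_complement[OF V E no all[OF v] v] by blast
    have sub: "{e \<in> E. e \<inter> W = {}} \<subseteq> nsets (V - W) 4" using E by (auto simp: nsets_def)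
    have "real (card (V - W)) \<le> n" unfolding n_def using V by (simp add: card_mono)
    then have "real (deg {e \<in> E. e \<inter> W = {}} v) \<le> n ^ 3 * (1 / 12 + 4 / 1000)"
      using v W(2) V H[OF W(1,3)] n7 by (intro deg_near_extremal_le[OF inf _ sub W(4)]) auto
    moreover have "real (deg E v) \<le> real (deg {e \<in> E. e \<inter> W = {}} v) + 7 * x * real (card V choose 2)"
      using codegree_le[OF V E W(1) v W(2)] unfolding W(3) x_def
      by (metis of_nat_add of_nat_le_iff of_nat_mult of_nat_numeral)
    moreover have "7 * x * real (card V choose 2) \<le> 7 * x * (n ^ 2 / 2)"
      unfolding n_def using choose_2_le x by (intro mult_left_mono) auto
    ultimately show ?thesis using xn(2) p3 by simp
  qed
  have "V \<noteq> {}" using n0 unfolding n_def by auto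
  then obtain v where v: "v \<in> V" by blast
  obtain W where W: "W \<subseteq> V" "v \<notin> W" "card W = 7 * s" and free: "F_free {e \<in> E. e \<inter> W = {}}"
    using packing_complement[OF V E no all[OF v] v] by blast
  define Hs where "Hs = {e \<in> E. e \<inter> W = {}}"
  have finW: "finite W" using W V finite_subset by blast
  have sub: "Hs \<subseteq> nsets (V - W) 4" unfolding Hs_def using E by (auto simp: nsets_def)
  have "V - W \<noteq> {}" "finite (V - W)" using v W V by auto
  then obtain u where u: "u \<in> V - W" "4 * card Hs \<le> card (V - W) * deg Hs u"
    using ex_deg_ge_average[OF _ sub] by blast
  have degu: "real (deg Hs u) \<ge> n ^ 3 * (1 / 12 - 4 / 10 ^ 5)"
  proof -
    have "card (V - W) \<le> card V" using V by (simp add: card_mono)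
    then have "4 * card Hs \<le> card V * deg Hs u" using u(2) by (meson mult_le_mono1 order_trans)
    then have "4 * real (card Hs) \<le> n * real (deg Hs u)" unfolding n_def of_nat_mult[symmetric] by linarith
    moreover have "real (card Hs) \<ge> n ^ 4 / 48 - n ^ 4 / 10 ^ 5" unfolding Hs_def by (rule H[OF W(1,3)])
    moreover have "4 * (y / 48 - y / 10 ^ 5) \<le> d" if "4 * c \<le> d" "c \<ge> y / 48 - y / 10 ^ 5" for c d y :: real
      using that by simp
    ultimately have "4 * (n ^ 4 / 48 - n ^ 4 / 10 ^ 5) \<le> n * real (deg Hs u)" by blast
    moreover have "4 * (n ^ 4 / 48 - n ^ 4 / 10 ^ 5) = n * (n ^ 3 * (1 / 12 - 4 / 10 ^ 5))"
      by (simp add: eval_nat_numeral)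
    ultimately show ?thesis using n0 by (simp only: mult_le_cancel_left_pos)
  qed
  \<comment> \<open>Of the \<open>7s\<close> deleted vertices, \<open>s\<close> become universal.
    They permit only \<open>s\<close> disjoint copies over the F-free rest, which is exactly what
    the extremal condition allows.\<close>
  obtain L where L: "L \<subseteq> W" "card L = s" "finite L"
    using obtain_subset_with_card_n[of s W] W(3) by auto
  have LV: "L \<subseteq> V" using L W by blast
  have "card (W - L) = 6 * s" using L W finW by (simp add: card_Diff_subset)
  then obtain E' where E': "E' \<subseteq> nsets ((V - W) \<union> (W - L)) 4" "F_free E'"
    "card E' = card Hs + 6 * s * deg Hs u"
    using ex_add_clones[of "W - L" "V - W" Hs u] finW V sub free u(1) unfolding Hs_def by auto
  have sub': "E' \<subseteq> nsets (V - L) 4"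
  proof -
    have "(V - W) \<union> (W - L) = V - L" using L W by blast
    then show ?thesis using E'(1) by simp
  qed
  have E'V: "E' \<subseteq> nsets V 4" using sub' by (auto simp: nsets_def)
  have "\<not> packs (E' \<union> touching V L) (1 + card L)"
    using E'V V L(3) not_packs_F_free[OF E'(2)] by (intro not_packs_touching) auto
  then have "card (E' \<union> touching V L) \<le> card E"
    using E'V L(2) by (intro best) (auto simp: touching_def)
  moreover have "E' \<inter> touching V L = {}" using sub' unfolding touching_def by (auto simp: nsets_def)
  then have "card (E' \<union> touching V L) = card E' + card (touching V L)"
    using E'V V by (intro card_Un_disjoint finite_edges) (auto simp: touching_def finite_imp_finite_nsets)
  ultimately have "card Hs + 6 * s * deg Hs u + s * (card (V - L) choose 3) \<le> card E"
    using card_touching_ge[OF V LV] E'(3) L(2) by auto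
  then have "real (card Hs + 6 * s * deg Hs u + s * (card (V - L) choose 3)) \<le> real (card E)"
    by (simp only: of_nat_le_iff)
  then have low: "real (card Hs) + 6 * x * real (deg Hs u) + x * real (card (V - L) choose 3) \<le> real (card E)"
    unfolding x_def by (simp only: of_nat_add of_nat_mult of_nat_numeral)
  have "real (card E) \<le> real (card Hs) + (\<Sum>w\<in>W. real (deg E w))"
    using card_minus_vertices_ge[OF finE finW] unfolding Hs_def of_nat_sum[symmetric] by linarith
  moreover have "(\<Sum>w\<in>W. real (deg E w)) \<le> x * (7 * (n ^ 3 * (1 / 12 + 5 / 1000)))"
  proof -
    have "(\<Sum>w\<in>W. real (deg E w)) \<le> (\<Sum>w\<in>W. n ^ 3 * (1 / 12 + 5 / 1000))"
      using deg_small W by (intro sum_mono) auto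
    then show ?thesis unfolding x_def using W(3) by simp
  qed
  moreover have "x * (6 * real (deg Hs u) + real (card (V - L) choose 3)) =
      6 * x * real (deg Hs u) + x * real (card (V - L) choose 3)" by (simp add: distrib_left)
  ultimately have "x * (6 * real (deg Hs u) + real (card (V - L) choose 3)) \<le> x * (7 * (n ^ 3 * (1 / 12 + 5 / 1000)))"
    using low by linarith
  then have "6 * real (deg Hs u) + real (card (V - L) choose 3) \<le> 7 * (n ^ 3 * (1 / 12 + 5 / 1000))"
    using x(1) by (simp only: mult_le_cancel_left_pos)
  moreover have "real (card (V - L) choose 3) \<ge> n ^ 3 * (15 / 100)"
  proof -
    have "card (V - L) = card V - s" using L LV V by (simp add: card_Diff_subset)
    then have c: "real (card (V - L)) \<ge> n - x" "real (card (V - L)) \<le> n" unfolding n_def x_def by linarith+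
    have "n * (99 / 100) \<le> real (card (V - L))" using c(1) x by simp
    then have "(n * (99 / 100)) ^ 3 \<le> real (card (V - L)) ^ 3" using n0 by (intro power_mono) auto
    moreover have "real (card (V - L)) ^ 2 \<le> n ^ 2" using c by (intro power_mono) auto
    ultimately have "real (card (V - L) choose 3) \<ge> (n * (99 / 100)) ^ 3 / 6 - n ^ 2 / 2"
      using choose_3_ge[of "card (V - L)"] by linarith
    moreover have "(n * (99 / 100)) ^ 3 = n ^ 3 * (970299 / 1000000)" by (simp add: power_mult_distrib power_divide)
    ultimately have "real (card (V - L) choose 3) \<ge> n ^ 3 * (970299 / 1000000) / 6 - n ^ 2 / 2" by simp
    moreover have "c \<ge> y * (15 / 100)"
      if "c \<ge> y * (970299 / 1000000) / 6 - z / 2" "z \<le> y / 10 ^ 7" "y > 0" for c y z :: real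
      using that by simp
    ultimately show ?thesis using n3(2) p3 by blast
  qed
  \<comment> \<open>Per copy and in units of \<open>n^3\<close>, the new vertices bring nearly
    \<open>6/12 + 0.15 = 0.65\<close>, while the seven old ones had at most
    \<open>7 * (1/12 + 0.005)\<close>, below \<open>0.62\<close>. The gain comes from a universal
    vertex having degree near \<open>1/6\<close>, twice the usual one.\<close>
  moreover have False
    if "6 * d + c \<le> 7 * (y * (1 / 12 + 5 / 1000))" "c \<ge> y * (15 / 100)" "d \<ge> y * (1 / 12 - 4 / 10 ^ 5)" "y > 0"
    for c d y :: real
    using that by (simp add: field_simps)
  ultimately show False using degu p3 by blast
qed

text \<open>The universal vertices are peeled off one at a time. A step lowers \<open>card V\<close>
  by 1 but the threshold by \<open>10^6\<close>, so the size condition is inherited down to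
  \<open>t = 0\<close>, where \<open>10^40\<close> is left for \<open>extremal_odd\<close>.\<close>

theorem pack_extremal_structure:
  fixes E :: "'a set set"
  assumes inf: "infinite (UNIV :: 'a set)"
  shows "finite V \<Longrightarrow> pack_extremal V (Suc t) E \<Longrightarrow> real (card V) \<ge> 10 ^ 40 + 10 ^ 6 * real t \<Longrightarrow>
    \<exists>L A. L \<subseteq> V \<and> card L = t \<and> A \<subseteq> V - L \<and> E = touching V L \<union> odd_quads (V - L) A"
proof (induction t arbitrary: V E)
  case 0
  then have "\<exists>A\<subseteq>V. E = odd_quads V A" by (intro extremal_odd) auto
  then obtain A where "A \<subseteq> V" "E = odd_quads V A" by blast
  moreover have "touching V {} = {}" unfolding touching_def by blast
  ultimately show ?case by (intro exI[of _ "{}"] exI[of _ A]) auto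
next
  case (Suc t)
  note V = Suc.prems(1) and ext = Suc.prems(2)
  have E: "E \<subseteq> nsets V 4" and no: "\<not> packs E (Suc (Suc t))"
    and best: "\<And>E'. E' \<subseteq> nsets V 4 \<Longrightarrow> \<not> packs E' (Suc (Suc t)) \<Longrightarrow> card E' \<le> card E"
    using ext unfolding pack_extremal_def by auto
  have finE: "finite E" using V E finite_edges by blast
  have "real (card V) \<ge> 10 ^ 7" "10 ^ 6 * real (Suc t) \<le> real (card V)" using Suc.prems(3) by simp_all
  then obtain v where v: "v \<in> V" and nov: "\<not> packs {e \<in> E. v \<notin> e} (Suc t)"
    using ex_universal_vertex[OF inf V ext] by auto
  define E0 where "E0 = {e \<in> E. v \<notin> e}"
  have E0: "E0 \<subseteq> nsets (V - {v}) 4" using E unfolding E0_def by (auto simp: nsets_def)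
  have fint: "finite (touching V {v})" using V unfolding touching_def by (simp add: finite_imp_finite_nsets)
  \<comment> \<open>Any admissible hypergraph on \<open>V - {v}\<close> competes with
    \<open>E\<close> once all quadruples through \<open>v\<close> are added. This gives both the
    extremality of \<open>E0\<close> and the completeness of \<open>E\<close> at
    \<open>v\<close>.\<close>
  have plus: "card E' + card (touching V {v}) \<le> card E"
    if "E' \<subseteq> nsets (V - {v}) 4" "\<not> packs E' (Suc t)" for E'
  proof -
    have sub: "E' \<subseteq> nsets V 4" using that(1) by (auto simp: nsets_def)
    have "\<not> packs (E' \<union> touching V {v}) (Suc t + card {v})"
      by (rule not_packs_touching[OF sub V _ that(2)]) simp
    then have "card (E' \<union> touching V {v}) \<le> card E" using sub by (intro best) (auto simp: touching_def)
    moreover have "E' \<inter> touching V {v} = {}" using that(1) unfolding touching_def by (auto simp: nsets_def)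
    then have "card (E' \<union> touching V {v}) = card E' + card (touching V {v})"
      using finite_edges[OF V sub] fint by (intro card_Un_disjoint)
    ultimately show ?thesis by simp
  qed
  have E_sub: "E \<subseteq> E0 \<union> touching V {v}" using E unfolding E0_def touching_def by auto
  have finE0: "finite E0" using finE unfolding E0_def by simp
  have "card E \<le> card (E0 \<union> touching V {v})" using E_sub finE0 fint by (intro card_mono) auto
  then have le: "card E \<le> card E0 + card (touching V {v})" using card_Un_le le_trans by blast
  have "pack_extremal (V - {v}) (Suc t) E0"
    unfolding pack_extremal_def
  proof (intro conjI allI impI)
    show "\<not> packs E0 (Suc t)" using nov unfolding E0_def .
    show "card E' \<le> card E0" if "E' \<subseteq> nsets (V - {v}) 4 \<and> \<not> packs E' (Suc t)" for E'
      using plus[of E'] that le by linarith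
  qed (rule E0)
  moreover have "real (card (V - {v})) \<ge> 10 ^ 40 + 10 ^ 6 * real t"
    using Suc.prems(3) v V by simp
  ultimately obtain L A where L: "L \<subseteq> V - {v}" "card L = t" "A \<subseteq> V - {v} - L"
    "E0 = touching (V - {v}) L \<union> odd_quads (V - {v} - L) A"
    using Suc.IH[of "V - {v}" E0] V by blast
  have "E0 \<union> touching V {v} = E"
  \<comment> \<open>The right side contains \<open>E\<close> and is itself admissible, so it cannot
    have more edges; hence every quadruple through \<open>v\<close> is an edge.\<close>
  proof (rule sym, rule card_subset_eq[OF _ E_sub])
    have "card (E0 \<union> touching V {v}) \<le> card E" using plus[OF E0] nov card_Un_le[of E0 "touching V {v}"]
      unfolding E0_def by linarith
    then show "card E = card (E0 \<union> touching V {v})"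
      using \<open>card E \<le> card (E0 \<union> touching V {v})\<close> by linarith
  qed (use finE0 fint in simp)
  moreover have "touching (V - {v}) L \<union> touching V {v} = touching V (insert v L)"
    unfolding touching_def nsets_def by auto
  moreover have "V - {v} - L = V - insert v L" by blast
  ultimately have "E = touching V (insert v L) \<union> odd_quads (V - insert v L) A" using L(4) by auto
  moreover have "finite L" using L(1) V by (meson finite_Diff finite_subset)
  then have "card (insert v L) = Suc t" using L(1,2) by (subst card_insert_disjoint) auto
  ultimately show ?case using L(1,3) v by (intro exI[of _ "insert v L"] exI[of _ A]) auto
qed

section \<open>The sizes of the parts\<close>

text \<open>Moving one vertex out of \<open>A\<close> changes the count by one sixth of
  \<open>(d - 1) * ((d^2 + (d - 2)^2) / 2 - 3 * n + 4)\<close>, where \<open>d\<close> is the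
  difference of the part sizes. At an optimum \<open>d^2\<close> is therefore at most about
  \<open>3n\<close>. Since \<open>d\<close> is about \<open>2m\<close>, the bound
  \<open>4 * card V\<close> is comfortable.\<close>

lemma odd_quads_balance:
  assumes V: "finite V" and A: "A \<subseteq> V" and m: "card A = card V div 2 + m"
    and best: "\<And>A'. A' \<subseteq> V \<Longrightarrow> card (odd_quads V A') \<le> card (odd_quads V A)"
  shows "m ^ 2 \<le> 4 * card V"
proof (rule ccontr)
  assume big: "\<not> ?thesis"
  have "card A \<le> card V" using A V by (simp add: card_mono)
  then have "m \<le> card V" using m by linarith
  then have "card V \<ge> 1" using big by (cases "card V = 0") auto
  then have "\<not> m \<le> 2" using big power_mono[of m 2 2] by auto
  then have m3: "m \<ge> 3" by simp
  then have "card A > 0" using m by simp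
  then obtain a where a: "a \<in> A" by fastforce
  define p q n d where "p = real (card A)" and "q = real (card (V - A))" and "n = real (card V)" and "d = p - q"
  have "card V = card A + card (V - A)"
    using A V by (metis card_Diff_subset card_mono finite_subset le_add_diff_inverse)
  then have pq: "p + q = n" unfolding p_def q_def n_def by simp
  have finA: "finite A" using A V finite_subset by blast
  have p': "real (card (A - {a})) = p - 1"
    unfolding p_def using a finA \<open>card A > 0\<close> by (simp add: of_nat_diff)
  have "V - (A - {a}) = insert a (V - A)" using a A by blast
  then have q': "real (card (V - (A - {a}))) = q + 1" unfolding q_def using a V by simp
  have "A - {a} \<subseteq> V" using A by blast
  then have "real (card (odd_quads V (A - {a}))) \<le> real (card (odd_quads V A))" using best by simp
  then have "(p - 1) * (q + 1) * ((p - 1) ^ 2 + (q + 1) ^ 2 - 3 * n + 4) \<le> p * q * (p ^ 2 + q ^ 2 - 3 * n + 4)"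
    unfolding card_odd_quads_real[OF V A] card_odd_quads_real[OF V \<open>A - {a} \<subseteq> V\<close>] p' q'
      p_def[symmetric] q_def[symmetric] n_def[symmetric] by simp
  moreover have "(p - 1) * (q + 1) * ((p - 1) ^ 2 + (q + 1) ^ 2 - 3 * n + 4) - p * q * (p ^ 2 + q ^ 2 - 3 * n + 4)
      = (d - 1) * ((d ^ 2 + (d - 2) ^ 2) / 2 - 3 * n + 4)"
    unfolding d_def pq[symmetric] by (simp add: power2_eq_square field_simps)
  ultimately have neg: "(d - 1) * ((d ^ 2 + (d - 2) ^ 2) / 2 - 3 * n + 4) \<le> 0" by linarith
  have "card V \<le> 2 * (card V div 2) + 1" by presburger
  then have d: "d \<ge> 2 * real m - 1" using m pq unfolding d_def p_def q_def n_def by linarith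
  \<comment> \<open>From \<open>d \<ge> 2m - 1\<close>, where the 1 accounts for odd
    \<open>card V\<close>, one has \<open>d - 2 \<ge> 2m - 3\<close>, which is at least
    \<open>m\<close> because \<open>m \<ge> 3\<close>.\<close>
  have "real m ^ 2 \<le> d ^ 2" "real m ^ 2 \<le> (d - 2) ^ 2" using d m3 by (intro power_mono; linarith)+
  moreover have "real (m ^ 2) > 4 * n" using big unfolding n_def by linarith
  then have "real m ^ 2 > 4 * n" by simp
  moreover have "n \<ge> 0" unfolding n_def by simp
  moreover have "(u + w) / 2 - 3 * n + 4 > 0" if "k \<le> u" "k \<le> w" "k > 4 * n" "n \<ge> 0" for k u w :: real
    using that unfolding add_divide_distrib by linarith
  ultimately have "(d ^ 2 + (d - 2) ^ 2) / 2 - 3 * n + 4 > 0" by blast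
  moreover have "d - 1 > 0" using d m3 by linarith
  ultimately show False using neg by (meson mult_pos_pos not_le)
qed

section \<open>Translation to the hypergraph vocabulary\<close>

lemma verts_F43: "verts F43 = {1,2,3} \<union> {4,5,6,7}"
  unfolding F43_def by auto

lemma edges_F43: "edges F43 = insert {4,5,6,7} ((\<lambda>w. insert w {1,2,3}) ` {4,5,6,7})"
  unfolding F43_def by auto

text \<open>A copy given by \<open>T\<close> and \<open>Q\<close> forgets the embedding. Any
  bijections from \<open>{1,2,3}\<close> to \<open>T\<close> and from \<open>{4,5,6,7}\<close> to
  \<open>Q\<close> restore one, because \<open>F43\<close> is invariant under all permutations
  within these two classes.\<close>

lemma contains_disjoint_copies_iff:
  assumes "E \<subseteq> nsets V 4"
  shows "contains_copy (Hypergraph V E) (disjoint_copies s F43) \<longleftrightarrow> packs E s"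
proof
  assume "contains_copy (Hypergraph V E) (disjoint_copies s F43)"
  then obtain f where inj: "inj_on f ({..<s} \<times> verts F43)"
    and f: "\<forall>e\<in>{{i} \<times> e | i e. i < s \<and> e \<in> edges F43}. f ` e \<in> E"
    unfolding contains_copy_def disjoint_copies_def by auto
  have edge: "f ` ({i} \<times> e) \<in> E" if "i < s" "e \<in> edges F43" for i e
    using f that by blast
  define S where "S = (\<lambda>i. f ` ({i} \<times> verts F43))"
  have copy: "is_copy E (S i)" if i: "i < s" for i
    unfolding is_copy_def
  proof (intro exI conjI)
    have "inj_on f ({i} \<times> {1,2,3})" using i by (intro inj_on_subset[OF inj]) (auto simp: verts_F43)
    then show "card (f ` ({i} \<times> {1,2,3})) = 3" by (simp add: card_image card_cartesian_product)
    show "f ` ({i} \<times> {4,5,6,7}) \<in> E" using edge[OF i, of "{4,5,6,7}"] by (simp add: edges_F43)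
    show "\<forall>w\<in>f ` ({i} \<times> {4,5,6,7}). insert w (f ` ({i} \<times> {1,2,3})) \<in> E"
    proof
      fix w assume "w \<in> f ` ({i} \<times> {4,5,6,7})"
      then obtain j where j: "j \<in> {4,5,6,7}" "w = f (i, j)" by blast
      then have "f ` ({i} \<times> insert j {1,2,3}) \<in> E" by (intro edge[OF i]) (auto simp: edges_F43)
      then show "insert w (f ` ({i} \<times> {1,2,3})) \<in> E" using j(2) by simp
    qed
    show "S i = f ` ({i} \<times> {1,2,3}) \<union> f ` ({i} \<times> {4,5,6,7})"
      unfolding S_def verts_F43 by blast
  qed
  have dis: "disjnt (S i) (S j)" if "i < s" "j < s" "i \<noteq> j" for i j
    unfolding S_def disjnt_def using inj that by (auto simp: inj_on_def)
  have "inj_on S {..<s}"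
  proof (rule inj_onI)
    fix i j assume ij: "i \<in> {..<s}" "j \<in> {..<s}" "S i = S j"
    have "S i \<noteq> {}" unfolding S_def verts_F43 by simp
    then show "i = j" using dis[of i j] ij unfolding disjnt_def by auto
  qed
  then have "card (S ` {..<s}) = s" by (simp add: card_image)
  moreover have "pairwise disjnt (S ` {..<s})" unfolding pairwise_def using dis by fastforce
  ultimately show "packs E s" unfolding packs_def using copy by (intro exI[of _ "S ` {..<s}"]) auto
next
  assume "packs E s"
  then obtain C where C: "finite C" "card C = s" "pairwise disjnt C" and copy: "\<And>S. S \<in> C \<Longrightarrow> is_copy E S"
    unfolding packs_def by blast
  obtain h where h: "bij_betw h {..<s} C" using C ex_bij_betw_nat_finite by (metis atLeast0LessThan)
  have "\<exists>g. bij_betw g (verts F43) S \<and> (\<forall>e\<in>edges F43. g ` e \<in> E)" if S: "S \<in> C" for S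
  proof -
    obtain T Q where TQ: "card T = 3" "Q \<in> E" "\<forall>w\<in>Q. insert w T \<in> E" "S = T \<union> Q"
      using copy[OF S] unfolding is_copy_def by blast
    note Q = edgeD[OF assms TQ(2)]
    have finT: "finite T" using TQ(1) card.infinite by fastforce
    have dis: "T \<inter> Q = {}" using notin_nb[OF assms TQ(1)] TQ(3) unfolding nb_def by blast
    obtain gT where gT: "bij_betw gT {1,2,3::nat} T"
      using finite_same_card_bij[of "{1,2,3::nat}" T] finT TQ(1) by auto
    obtain gQ where gQ: "bij_betw gQ {4,5,6,7::nat} Q"
      using finite_same_card_bij[of "{4,5,6,7::nat}" Q] Q by auto
    define g where "g = (\<lambda>i. if i \<in> {1,2,3} then gT i else gQ i)"
    have b1: "bij_betw g {1,2,3} T" using gT by (rule bij_betw_cong[THEN iffD1, rotated]) (auto simp: g_def)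
    have b2: "bij_betw g {4,5,6,7} Q" using gQ by (rule bij_betw_cong[THEN iffD1, rotated]) (auto simp: g_def)
    have bij: "bij_betw g (verts F43) S"
      unfolding verts_F43 TQ(4) by (rule bij_betw_combine[OF b1 b2 dis])
    have im: "g ` {1,2,3} = T" "g ` {4,5,6,7} = Q"
      by (rule bij_betw_imp_surj_on[OF b1], rule bij_betw_imp_surj_on[OF b2])
    have "g ` e \<in> E" if "e \<in> edges F43" for e
    proof -
      have "e = {4,5,6,7} \<or> (\<exists>j\<in>{4,5,6,7}. e = insert j {1,2,3})"
        using that unfolding edges_F43 by (simp only: insert_iff[of e] image_iff)
      then show ?thesis
      proof
        assume "e = {4,5,6,7}"
        then show ?thesis using im(2) TQ(2) by (simp only:)
      next
        assume "\<exists>j\<in>{4,5,6,7}. e = insert j {1,2,3}"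
        then obtain j where j: "j \<in> {4,5,6,7}" "e = insert j {1,2,3}" by (elim bexE)
        have "g ` e = insert (g j) T" unfolding j(2) image_insert[of g j] im(1) ..
        moreover have "g j \<in> Q" using imageI[OF j(1), of g] im(2) by (simp only:)
        ultimately show ?thesis using TQ(3) by simp
      qed
    qed
    then show ?thesis using bij by blast
  qed
  then obtain G where G: "\<And>S. S \<in> C \<Longrightarrow> bij_betw (G S) (verts F43) S"
    "\<And>S e. S \<in> C \<Longrightarrow> e \<in> edges F43 \<Longrightarrow> G S ` e \<in> E" by metis
  define f where "f = (\<lambda>(i, x). G (h i) x)"
  have hC: "h i \<in> C" if "i < s" for i using h that unfolding bij_betw_def by auto
  have fmem: "f (i, x) \<in> h i" if "i < s" "x \<in> verts F43" for i x
    using bij_betwE[OF G(1)[OF hC[OF that(1)]]] that(2) unfolding f_def by simp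
  have "inj_on f ({..<s} \<times> verts F43)"
  proof (rule inj_onI, clarify)
    fix i x j y assume a: "i < s" "j < s" "x \<in> verts F43" "y \<in> verts F43" "f (i, x) = f (j, y)"
    note mem = fmem[OF a(1,3)] fmem[OF a(2,4)]
    have "h i = h j"
    proof (rule ccontr)
      assume "h i \<noteq> h j"
      then have "disjnt (h i) (h j)" using C(3) hC a unfolding pairwise_def by blast
      then show False using mem a(5) unfolding disjnt_def by auto
    qed
    then have "i = j" using h a unfolding bij_betw_def inj_on_def by auto
    moreover from this have "x = y"
      using G(1)[OF hC[OF a(1)]] a unfolding f_def bij_betw_def inj_on_def by auto
    ultimately show "i = j \<and> x = y" by blast
  qed
  moreover have "f ` ({i} \<times> e) \<in> E" if "i < s" "e \<in> edges F43" for i e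
  proof -
    have "f ` ({i} \<times> e) = G (h i) ` e" unfolding f_def by force
    then show ?thesis using G(2)[OF hC] that by simp
  qed
  moreover have "f ` ({..<s} \<times> verts F43) \<subseteq> V"
  proof clarify
    fix i x assume a: "i < s" "x \<in> verts F43"
    have "f (i, x) \<in> h i" by (rule fmem[OF a])
    moreover have "h i \<subseteq> V" using is_copy_props(1)[OF copy[OF hC] assms] a by blast
    ultimately show "f (i, x) \<in> V" by blast
  qed
  ultimately show "contains_copy (Hypergraph V E) (disjoint_copies s F43)"
    unfolding contains_copy_def disjoint_copies_def by (intro exI[of _ f]) auto
qed

lemma pack_extremal_if_extremal:
  assumes "G \<in> extremal n (disjoint_copies s F43)"
  shows "verts G = {1..n}" "pack_extremal {1..n} s (edges G)"
proof -
  have free_iff: "Hypergraph {1..n} E \<in> free_four_graphs n (disjoint_copies s F43) \<longleftrightarrow>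
      E \<subseteq> nsets {1..n} 4 \<and> \<not> packs E s" for E
  proof -
    have "four_graph (Hypergraph {1..n} E) \<longleftrightarrow> E \<subseteq> nsets {1..n} 4"
      unfolding four_graph_def nsets_def by (auto intro: finite_subset)
    then show ?thesis unfolding free_four_graphs_def using contains_disjoint_copies_iff[of E "{1..n}" s] by auto
  qed
  show V: "verts G = {1..n}" using assms unfolding extremal_def free_four_graphs_def by blast
  then have "G = Hypergraph {1..n} (edges G)" by (cases G) auto
  then show "pack_extremal {1..n} s (edges G)"
    using assms free_iff unfolding extremal_def pack_extremal_def
    by (metis (no_types, lifting) hypergraph.sel(2) mem_Collect_eq)
qed

text \<open>A quadruple meeting the complete side either lies in it or meets both sides, and is an
  edge in both cases, so the three kinds of edges of the join merge into one condition. The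
  assumption keeps the first part of \<open>B_odd N m\<close> within \<open>{1..N}\<close>.\<close>

lemma edges_join_K4_B_odd:
  assumes "N div 2 + m \<le> N"
  shows "edges (join (K4 t) (B_odd N m)) = {e \<in> nsets ({1..t} <+> {1..N}) 4.
    e \<inter> Inl ` {1..t} \<noteq> {} \<or> odd (card (e \<inter> Inr ` {1..N div 2 + m}))}"
    (is "_ = {e \<in> nsets ?V 4. ?P e}")
proof -
  define p where "p = N div 2 + m"
  have VB: "verts (B_odd N m) = {1..N}" and VK: "verts (K4 t) = {1..t}"
    using assms unfolding B_odd_def K4_def Let_def by auto
  have "{1..p} \<union> {p + 1..N} = {1..N}" using assms unfolding p_def by auto
  then have EB: "edges (B_odd N m) = {e. e \<subseteq> {1..N} \<and> card e = 4 \<and> (card (e \<inter> {1..p}) = 1 \<or> card (e \<inter> {1..p}) = 3)}"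
    unfolding B_odd_def Let_def p_def by simp
  have EB': "edges (B_odd N m) = odd_quads {1..N} {1..p}"
    unfolding EB odd_quads_eq nsets_def by (auto intro: finite_subset)
  have EK: "edges (K4 t) = nsets {1..t} 4" unfolding K4_def nsets_def by (auto intro: finite_subset)
  have Inr_card: "card ((Inr :: nat \<Rightarrow> nat + nat) ` e \<inter> Inr ` X) = card (e \<inter> X)" for e X :: "nat set"
  proof -
    have "(Inr :: nat \<Rightarrow> nat + nat) ` e \<inter> Inr ` X = Inr ` (e \<inter> X)" by auto
    then show ?thesis by (simp only:) (simp add: card_image)
  qed
  show ?thesis unfolding p_def[symmetric]
  proof (intro equalityI subsetI)
    fix e :: "(nat + nat) set"
    assume "e \<in> edges (join (K4 t) (B_odd N m))"
    then consider e' where "e' \<in> edges (K4 t)" "e = Inl ` e'" | e' where "e' \<in> edges (B_odd N m)" "e = Inr ` e'"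
      | "e \<subseteq> ?V" "card e = 4" "e \<inter> Inl ` {1..t} \<noteq> {}"
      unfolding join_def VB VK by auto
    then show "e \<in> {e \<in> nsets ?V 4. e \<inter> Inl ` {1..t} \<noteq> {} \<or> odd (card (e \<inter> Inr ` {1..p}))}"
    proof cases
      case 1
      note e' = nsetsD[OF 1(1)[unfolded EK]]
      have "e' \<noteq> {}" using e'(3) by auto
      then show ?thesis using e' 1(2) by (auto intro!: nsetsI simp: card_image)
    next
      case 2
      then have "e' \<in> nsets {1..N} 4" "odd (card (e' \<inter> {1..p}))" unfolding EB' odd_quads_def by auto
      then show ?thesis using 2(2) Inr_card[of e' "{1..p}"]
        by (auto intro!: nsetsI simp: card_image dest: nsetsD)
    next
      case 3
      moreover have "finite e" using 3(1) by (rule finite_subset) auto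
      ultimately show ?thesis by (auto intro: nsetsI)
    qed
  next
    fix e :: "(nat + nat) set"
    assume "e \<in> {e \<in> nsets ?V 4. e \<inter> Inl ` {1..t} \<noteq> {} \<or> odd (card (e \<inter> Inr ` {1..p}))}"
    then have e: "e \<subseteq> ?V" "finite e" "card e = 4" and P: "e \<inter> Inl ` {1..t} \<noteq> {} \<or> odd (card (e \<inter> Inr ` {1..p}))"
      by (auto simp: nsets_def)
    consider "e \<inter> Inl ` {1..t} = {}" | "e \<inter> Inr ` {1..N} = {}"
      | "e \<inter> Inl ` {1..t} \<noteq> {}" "e \<inter> Inr ` {1..N} \<noteq> {}" by blast
    then show "e \<in> edges (join (K4 t) (B_odd N m))"
    proof cases
      case 1
      then have "e \<subseteq> Inr ` {1..N}" using e(1) unfolding Plus_def by blast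
      then obtain e' where e': "e' \<subseteq> {1..N}" "e = Inr ` e'" by (metis subset_imageE)
      have "card e' = 4" using e(3) e'(2) by (simp add: card_image)
      moreover have "odd (card (e' \<inter> {1..p}))" using P 1 Inr_card[of e' "{1..p}"] unfolding e'(2) by auto
      ultimately have "e' \<in> edges (B_odd N m)"
        unfolding EB' odd_quads_def using e'(1) by (auto intro!: nsetsI intro: finite_subset)
      then show ?thesis unfolding join_def using e'(2) by auto
    next
      case 2
      then have "e \<subseteq> Inl ` {1..t}" using e(1) unfolding Plus_def by blast
      then obtain e' where e': "e' \<subseteq> {1..t}" "e = Inl ` e'" by (metis subset_imageE)
      have "card e' = 4" using e(3) e'(2) by (simp add: card_image)
      then have "e' \<in> edges (K4 t)" unfolding EK using e'(1) by (auto intro!: nsetsI intro: finite_subset)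
      then show ?thesis unfolding join_def using e'(2) by auto
    next
      case 3
      then show ?thesis unfolding join_def VB VK using e by auto
    qed
  qed
qed

text \<open>On both sides being an edge depends only on the intersections with two sets. So any
  bijection that carries \<open>L\<close> to the complete side and \<open>A\<close> to the first
  part is an isomorphism; it is glued from three pieces.\<close>

lemma isomorphic_join:
  fixes G :: "'a hypergraph"
  assumes V: "finite (verts G)" and L: "L \<subseteq> verts G" "card L = t" and A: "A \<subseteq> verts G - L"
    and N: "card (verts G - L) = N" and m: "card A = N div 2 + m"
    and E: "edges G = touching (verts G) L \<union> odd_quads (verts G - L) A"
  shows "isomorphic G (join (K4 t) (B_odd N m))"
proof -
  define W C p where "W = verts G" and "C = verts G - L - A" and "p = N div 2 + m"
  have fin: "finite L" "finite A" "finite C" using V L A unfolding C_def by (auto intro: finite_subset)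
  have "card A \<le> card (verts G - L)" using A V by (intro card_mono) auto
  then have pN: "p \<le> N" unfolding p_def using m N by linarith
  have cC: "card C = N - p" unfolding C_def using A fin m N p_def by (simp add: card_Diff_subset)
  obtain bL where bL: "bij_betw bL L {1..t}" using finite_same_card_bij[OF fin(1), of "{1..t}"] L by auto
  obtain bA where bA: "bij_betw bA A {1..p}" using finite_same_card_bij[OF fin(2), of "{1..p}"] m p_def by auto
  obtain bC where bC: "bij_betw bC C {p + 1..N}"
    using finite_same_card_bij[OF fin(3), of "{p + 1..N}"] cC pN by auto
  define f where "f = (\<lambda>x. if x \<in> L then Inl (bL x) else if x \<in> A then Inr (bA x) else Inr (bC x) :: nat + nat)"
  have Inl_bij: "bij_betw (Inl :: nat \<Rightarrow> nat + nat) X (Inl ` X)"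
    and Inr_bij: "bij_betw (Inr :: nat \<Rightarrow> nat + nat) X (Inr ` X)" for X
    by (simp_all add: bij_betw_def)
  have "bij_betw f L (Inl ` {1..t}) = bij_betw ((Inl :: nat \<Rightarrow> nat + nat) \<circ> bL) L (Inl ` {1..t})"
    by (rule bij_betw_cong) (simp add: f_def)
  then have fL: "bij_betw f L (Inl ` {1..t})" using bij_betw_trans[OF bL Inl_bij] by (simp only:)
  have "bij_betw f A (Inr ` {1..p}) = bij_betw ((Inr :: nat \<Rightarrow> nat + nat) \<circ> bA) A (Inr ` {1..p})"
    by (rule bij_betw_cong) (use A in \<open>auto simp: f_def\<close>)
  then have fA: "bij_betw f A (Inr ` {1..p})" using bij_betw_trans[OF bA Inr_bij] by (simp only:)
  have "bij_betw f C (Inr ` {p + 1..N}) = bij_betw ((Inr :: nat \<Rightarrow> nat + nat) \<circ> bC) C (Inr ` {p + 1..N})"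
    by (rule bij_betw_cong) (auto simp: f_def C_def)
  then have fC: "bij_betw f C (Inr ` {p + 1..N})" using bij_betw_trans[OF bC Inr_bij] by (simp only:)
  have "bij_betw f (A \<union> C) (Inr ` {1..p} \<union> Inr ` {p + 1..N})" by (rule bij_betw_combine[OF fA fC]) auto
  then have "bij_betw f (L \<union> (A \<union> C)) (Inl ` {1..t} \<union> (Inr ` {1..p} \<union> Inr ` {p + 1..N}))"
    by (rule bij_betw_combine[OF fL]) auto
  moreover have "L \<union> (A \<union> C) = W" unfolding C_def W_def using L A by blast
  moreover have "Inl ` {1..t} \<union> (Inr ` {1..p} \<union> Inr ` {p + 1..N}) = ({1..t} <+> {1..N} :: (nat + nat) set)"
    unfolding Plus_def image_Un[symmetric] using pN by (intro arg_cong2[where f = "(\<union>)"] arg_cong2[where f = "(`)"]) auto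
  ultimately have bij: "bij_betw f W ({1..t} <+> {1..N})" by simp
  then have inj: "inj_on f W" by (rule bij_betw_imp_inj_on)
  have LW: "L \<subseteq> W" and AW: "A \<subseteq> W" unfolding W_def using L A by auto
  have P: "f ` e \<inter> Inl ` {1..t} \<noteq> {} \<or> odd (card (f ` e \<inter> Inr ` {1..p})) \<longleftrightarrow> e \<inter> L \<noteq> {} \<or> odd (card (e \<inter> A))"
    if "e \<subseteq> W" for e
  proof -
    have "f ` e \<inter> f ` L = f ` (e \<inter> L)" "f ` e \<inter> f ` A = f ` (e \<inter> A)"
      using inj_on_image_Int[OF inj that LW] inj_on_image_Int[OF inj that AW] by auto
    moreover have "card (f ` (e \<inter> A)) = card (e \<inter> A)"
      using that by (intro card_image inj_on_subset[OF inj]) auto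
    ultimately show ?thesis using fL fA unfolding bij_betw_def by auto
  qed
  have EG: "edges G = {e \<in> nsets W 4. e \<inter> L \<noteq> {} \<or> odd (card (e \<inter> A))}"
    unfolding E touching_def odd_quads_def W_def nsets_def by auto
  have "edges (join (K4 t) (B_odd N m)) = (`) f ` edges G"
    unfolding edges_join_K4_B_odd[OF pN[unfolded p_def]] EG p_def[symmetric]
  proof (intro equalityI subsetI)
    fix d assume d: "d \<in> {e \<in> nsets ({1..t} <+> {1..N}) 4. e \<inter> Inl ` {1..t} \<noteq> {} \<or> odd (card (e \<inter> Inr ` {1..p}))}"
    then have "d \<subseteq> f ` W" using bij nsetsD(1) unfolding bij_betw_def by auto
    then obtain e where e: "e \<subseteq> W" "d = f ` e" by (metis subset_imageE)
    have "finite e" using e(1) V unfolding W_def by (rule finite_subset)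
    moreover have "card e = card d" unfolding e(2) using e(1) by (intro card_image[symmetric] inj_on_subset[OF inj])
    ultimately have "e \<in> nsets W 4" using e(1) d by (intro nsetsI) (auto simp: nsets_def)
    then show "d \<in> (`) f ` {e \<in> nsets W 4. e \<inter> L \<noteq> {} \<or> odd (card (e \<inter> A))}"
      using P[OF e(1)] d e(2) by blast
  next
    fix d assume "d \<in> (`) f ` {e \<in> nsets W 4. e \<inter> L \<noteq> {} \<or> odd (card (e \<inter> A))}"
    then obtain e where e: "e \<in> nsets W 4" "e \<inter> L \<noteq> {} \<or> odd (card (e \<inter> A))" "d = f ` e" by blast
    note e' = nsetsD[OF e(1)]
    have "card d = 4" unfolding e(3) using e' card_image[OF inj_on_subset[OF inj e'(1)]] by simp
    moreover have "d \<subseteq> {1..t} <+> {1..N}" using e'(1) bij unfolding e(3) bij_betw_def by blast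
    ultimately have "d \<in> nsets ({1..t} <+> {1..N}) 4" using e'(2) e(3) by (intro nsetsI) auto
    then show "d \<in> {e \<in> nsets ({1..t} <+> {1..N}) 4. e \<inter> Inl ` {1..t} \<noteq> {} \<or> odd (card (e \<inter> Inr ` {1..p}))}"
      using P[OF e'(1)] e(2,3) by blast
  qed
  moreover have "verts (join (K4 t) (B_odd N m)) = {1..t} <+> {1..N}"
    using pN unfolding join_def K4_def B_odd_def Let_def p_def by auto
  ultimately show ?thesis unfolding isomorphic_def using bij unfolding W_def by (intro exI[of _ f]) simp
qed

theorem theorem2p12:
  shows "\<exists>(N0::nat) (c::real). c > 0 \<and>
    (\<forall>(n::nat) (t::nat). n \<ge> N0 \<and> real t \<le> c * real n \<longrightarrow>
      iso_subset (extremal n (disjoint_copies (t + 1) F43))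
        (join (K4 t) ` {B_odd (n - t) m | m. real m \<le> sqrt (4 * real (n - t))}))"
\<comment> \<open>Half of \<open>n\<close> pays for \<open>10^40\<close>, and the other half for
  \<open>10^6 * t\<close>.\<close>
proof (rule exI[of _ "2 * 10 ^ 40"], rule exI[of _ "1 / (2 * 10 ^ 6)"], intro conjI allI impI)
  fix n t :: nat
  assume nt: "n \<ge> 2 * 10 ^ 40 \<and> real t \<le> 1 / (2 * 10 ^ 6) * real n"
  then have "real n \<ge> real (2 * 10 ^ 40)" unfolding of_nat_le_iff by blast
  then have large: "real (card {1..n}) \<ge> 10 ^ 40 + 10 ^ 6 * real t" using nt by simp
  show "iso_subset (extremal n (disjoint_copies (t + 1) F43))
      (join (K4 t) ` {B_odd (n - t) m | m. real m \<le> sqrt (4 * real (n - t))})"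
    unfolding iso_subset_def
  proof
    fix G assume G: "G \<in> extremal n (disjoint_copies (t + 1) F43)"
    have VG: "verts G = {1..n}" and ext: "pack_extremal (verts G) (Suc t) (edges G)"
      using pack_extremal_if_extremal[OF G] by auto
    have fin: "finite (verts G)" unfolding VG by simp
    obtain L A where L: "L \<subseteq> verts G" "card L = t" and A: "A \<subseteq> verts G - L"
      and E: "edges G = touching (verts G) L \<union> odd_quads (verts G - L) A"
      using pack_extremal_structure[OF infinite_UNIV_nat fin ext] large unfolding VG by blast
    define U where "U = verts G - L"
    have finU: "finite U" and finL: "finite L" unfolding U_def using fin L(1) finite_subset by auto
    have cU: "card U = n - t" unfolding U_def using L finL VG by (simp add: card_Diff_subset)
    \<comment> \<open>Since \<open>m\<close> is a natural number, the larger of the two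
      complementary parts has to be the first one.\<close>
    obtain A' where A': "A' \<subseteq> U" "odd_quads U A' = odd_quads U A" "card A' \<ge> card U div 2"
    proof (cases "card A \<ge> card U div 2")
      case True
      then show ?thesis using that A unfolding U_def by blast
    next
      case False
      have "card (U - A) = card U - card A" using A finU unfolding U_def by (simp add: card_Diff_subset finite_subset)
      then have "card (U - A) \<ge> card U div 2" using False by linarith
      then show ?thesis using that[of "U - A"] odd_quads_compl by blast
    qed
    define m where "m = card A' - card U div 2"
    have m: "card A' = card U div 2 + m" using A'(3) unfolding m_def by simp
    have disj: "touching (verts G) L \<inter> odd_quads U X = {}" for X
      unfolding touching_def odd_quads_def U_def nsets_def by auto
    have fint: "finite (touching (verts G) L)" "finite (odd_quads U X)" for X
      using fin finU unfolding touching_def odd_quads_def by (auto simp: finite_imp_finite_nsets)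
    \<comment> \<open>For every \<open>X\<close>, the odd quadruples of \<open>X\<close> together
      with the same universal vertices \<open>L\<close> form an admissible competitor. So the
      partition of \<open>U\<close> is optimal, as \<open>odd_quads_balance\<close>
      requires.\<close>
    have "card (odd_quads U X) \<le> card (odd_quads U A')" for X
    proof -
      have sub: "odd_quads U X \<subseteq> nsets (verts G) 4" unfolding odd_quads_def U_def by (auto simp: nsets_def)
      have "\<not> packs (odd_quads U X \<union> touching (verts G) L) (1 + card L)"
        by (rule not_packs_touching[OF sub fin finL not_packs_F_free[OF F_free_odd_quads]]) simp
      then have "card (odd_quads U X \<union> touching (verts G) L) \<le> card (edges G)"
        using ext sub L(2) unfolding pack_extremal_def by (auto simp: touching_def)
      moreover have "card (odd_quads U X \<union> touching (verts G) L) = card (odd_quads U X) + card (touching (verts G) L)"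
        using disj fint by (intro card_Un_disjoint) auto
      moreover have "card (edges G) = card (touching (verts G) L) + card (odd_quads U A')"
        unfolding E A'(2) U_def[symmetric] using disj fint by (intro card_Un_disjoint) auto
      ultimately show ?thesis by linarith
    qed
    then have "m ^ 2 \<le> 4 * card U" by (intro odd_quads_balance[OF finU A'(1) m])
    then have "real (m ^ 2) \<le> real (4 * card U)" by (simp only: of_nat_le_iff)
    then have "real m \<le> sqrt (4 * real (n - t))" unfolding cU by (intro real_le_rsqrt) simp
    moreover have "isomorphic G (join (K4 t) (B_odd (n - t) m))"
      by (rule isomorphic_join[OF fin L _ _ _ E[folded U_def, folded A'(2), unfolded U_def]])
        (use A' m cU in \<open>auto simp: U_def\<close>)
    ultimately show "\<exists>H\<in>join (K4 t) ` {B_odd (n - t) m | m. real m \<le> sqrt (4 * real (n - t))}. isomorphic G H"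
      by blast
  qed
qed simp

end
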